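(* Let $\mathcal A=\{H_0,\dots,H_n\}$ be a (primitive) central and essential toric arrangement in the complex torus $T$, with characters $\chi_0,\dots,\chi_n$ and $E=\{0,\dots,n\}$, whose matroid has exactly one circuit $C=\{0,\dots,k\}\subseteq E$; put $F=E\setminus C$, so $E=C\sqcup F$. Let $c_i\in\{1,-1\}$ ($i\in C$) be signs such that $\sum_{i\in C}c_i\,m(C\setminus\{i\})\,\chi_i=0$, and $c_B=\prod_{i\in B}c_i$ for $B\subseteq C$. Let $L$ be a connected component of $\bigcap_{i\in E}H_i$. Then the following identity of differential forms on $M(\mathcal A)$ holds: $$\sum_{j\in C}\ \sum_{\substack{A,B\subset E,\ A\supseteq F\\ E=A\sqcup B\sqcup\{j\}\\ |B|\text{ even}}}(-1)^{|A_{\le j}|}\,c_B\,\frac{m(A)}{m(A\cup B)}\,\overline{\eta}_{W,A,B}=0,$$ where in each term $W$ is the connected component of $\bigcap_{i\in A}H_i$ with $W\supseteq L$.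
   Context: Let $T=(\mathbb C^* )^d$ with character lattice $\Lambda\cong\mathbb Z^d$ (written additively; $e^{\chi}:T\to\mathbb C^*$ is the function given by $\chi\in\Lambda$). The $\chi_i$ ($i\in E$) are primitive elements of $\Lambda$; centrality means $H_i=\{e^{\chi_i}=1\}$; $M(\mathcal A)=T\setminus\bigcup_iH_i$. Essential means that the minimal (by inclusion) connected components of nonempty intersections of the $H_i$ are points. $A\subseteq E$ is independent if $(\chi_i)_{i\in A}$ is linearly independent in $\mathbb Q\otimes\Lambda$; circuits are the inclusion-minimal dependent subsets. $m(A)$ is the cardinality of the torsion subgroup of $\Lambda/\langle\chi_i:i\in A\rangle$. $A_{\le j}=\{a\in A:a\le j\}$. For disjoint $A,B\subseteq E$, $\ell(A,B)$ is the number of inversions of the permutation reordering the concatenation $(A,B)$ (each in increasing order) into increasing order. Forms. $\psi_i=\frac{1}{2\pi\sqrt{-1}}\operatorname{dlog}(e^{\chi_i})$ and $\psi_B=\prod_{i\in B}\psi_i$ (increasing order). Coverings. A finite covering $f:U\to T$ is one associated with a lattice $\Lambda\subseteq\Lambda'\subseteq\Lambda\otimes\mathbb Q$ of finite index over $\Lambda$: $U$ is the torus with character lattice $\Lambda'$ and $f$ is dual to the inclusion. Let $a_i$ be the number of connected components of $f^{-1}(H_i)$, and for $q\in f^{-1}(H_i)$ let $H_i^U(q)$ be the component containing $q$. Then $\chi_i/a_i$ is a primitive element of $\Lambda'$; write $\theta_i=e^{\chi_i/a_i}:U\to\mathbb C^*$ and put $\omega_i^U(q)=\frac{1}{2\pi\sqrt{-1}}\operatorname{dlog}\bigl(1-\theta_i(q)^{-1}\theta_i\bigr)$,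 $\psi_i^U=\frac{1}{a_i}f^*(\psi_i)$, $\overline{\omega}_i^U(q)=2\omega_i^U(q)-\psi_i^U$. For $A\subseteq E$ and $q\in f^{-1}(\bigcap_{i\in A}H_i)$ let $\overline{\omega}_A^U(q)=\prod_{i\in A}\overline{\omega}_i^U(q)$, in increasing order. For $A$ independent, $f$ separates $A$ if for every connected component $W$ of $\bigcap_{i\in A}H_i$ there exist $q_i\in f^{-1}(H_i)$ ($i\in A$) with $f(\bigcap_{i\in A}H_i^U(q_i))=W$. For $A$ independent and $W$ a connected component of $\bigcap_{i\in A}H_i$, $\overline{\omega}_{W,A}$ is the unique form on $M(\mathcal A)$ with $$f^*(\overline{\omega}_{W,A})=\frac{1}{|\bigcap_{i\in A}H_i^U(q_0)\cap f^{-1}(p)|}\sum_{q\in f^{-1}(p)}\overline{\omega}_A^U(q),$$ where $f$ is any covering separating $A$, $p\in W$, $q_0\in f^{-1}(p)$ (such coverings exist, and the form is independent of the choices). Finally $\overline{\eta}_{W,A,B}:=(-1)^{\ell(A,B)}\,\overline{\omega}_{W,A}\,\psi_B$. *)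

theory Defs
  imports "HOL-Analysis.Analysis" "HOL-Algebra.Generated_Groups"
begin

section \<open>The torus and its characters\<close>

text \<open>
  The torus \<open>(\<complex>\<^sup>*)\<^sup>d\<close> is an open subset of \<open>\<complex>\<^sup>d\<close>, with \<open>d = CARD('d)\<close>; its character lattice
  \<open>\<Lambda>\<close> is \<open>int ^ 'd\<close>, and \<open>\<Lambda> \<otimes> \<rat>\<close> is \<open>rat ^ 'd\<close>. An indexed family of characters is written
  \<open>ch\<close>, because \<open>\<chi>\<close> is the binder for vectors.
\<close>

definition torus :: "(complex ^ 'd) set"
  where "torus = {z. \<forall>i. z $ i \<noteq> 0}"

definition expchar :: "int ^ 'd \<Rightarrow> complex ^ 'd \<Rightarrow> complex"
  where "expchar x z = (\<Prod>i\<in>UNIV. (z $ i) powi (x $ i))"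

definition ratvec :: "int ^ 'd \<Rightarrow> rat ^ 'd"
  where "ratvec x = (\<chi> i. of_int (x $ i))"

definition primitive_char :: "int ^ 'd \<Rightarrow> bool"
  where "primitive_char x \<longleftrightarrow> x \<noteq> 0 \<and> (\<forall>(a::int) y. x = a *s y \<longrightarrow> \<bar>a\<bar> = 1)"


section \<open>Central toric arrangements\<close>

definition hyp :: "int ^ 'd \<Rightarrow> (complex ^ 'd) set"
  where "hyp x = {z \<in> torus. expchar x z = 1}"

text \<open>The intersection over the empty family is the whole torus.\<close>

definition hyp_inter :: "(nat \<Rightarrow> int ^ 'd) \<Rightarrow> nat set \<Rightarrow> (complex ^ 'd) set"
  where "hyp_inter ch A = {z \<in> torus. \<forall>i\<in>A. z \<in> hyp (ch i)}"

definition arr_complement :: "(nat \<Rightarrow> int ^ 'd) \<Rightarrow> nat set \<Rightarrow> (complex ^ 'd) set"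
  where "arr_complement ch E = torus - (\<Union>i\<in>E. hyp (ch i))"

definition layers :: "(nat \<Rightarrow> int ^ 'd) \<Rightarrow> nat set \<Rightarrow> (complex ^ 'd) set set"
  where "layers ch E = (\<Union>A\<in>Pow E. components (hyp_inter ch A))"

definition essential :: "(nat \<Rightarrow> int ^ 'd) \<Rightarrow> nat set \<Rightarrow> bool"
  where "essential ch E \<longleftrightarrow>
    (\<forall>W\<in>layers ch E. (\<forall>W'\<in>layers ch E. \<not> W' \<subset> W) \<longrightarrow> (\<exists>p. W = {p}))"

definition indep :: "(nat \<Rightarrow> int ^ 'd) \<Rightarrow> nat set \<Rightarrow> bool"
  where "indep ch A \<longleftrightarrow>
    inj_on (\<lambda>i. ratvec (ch i)) A \<and> vec.independent ((\<lambda>i. ratvec (ch i)) ` A)"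

definition circuits :: "(nat \<Rightarrow> int ^ 'd) \<Rightarrow> nat set \<Rightarrow> nat set set"
  where "circuits ch E = {D. D \<subseteq> E \<and> \<not> indep ch D \<and> (\<forall>D'. D' \<subset> D \<longrightarrow> indep ch D')}"

definition char_group :: "(int ^ 'd) monoid"
  where "char_group = \<lparr>carrier = UNIV, monoid.mult = (+), one = 0\<rparr>"

definition torsion :: "('a, 'b) monoid_scheme \<Rightarrow> 'a set"
  where "torsion G = {x \<in> carrier G. \<exists>r::nat. r > 0 \<and> x [^]\<^bsub>G\<^esub> r = \<one>\<^bsub>G\<^esub>}"

definition arith_mult :: "(nat \<Rightarrow> int ^ 'd) \<Rightarrow> nat set \<Rightarrow> nat"
  where "arith_mult ch A = card (torsion (char_group Mod generate char_group (ch ` A)))"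

text \<open>The number of inversions of the concatenation \<open>(A, B)\<close>.\<close>

definition ell :: "nat set \<Rightarrow> nat set \<Rightarrow> nat"
  where "ell A B = card {(a, b). a \<in> A \<and> b \<in> B \<and> b < a}"


section \<open>Differential forms\<close>

text \<open>
  An element of the exterior algebra \<open>\<Lambda>\<^sup>\<bullet>(\<complex>\<^sup>d)\<^sup>*\<close> is a function on lists of tangent vectors; its
  component of degree \<open>p\<close> is the restriction to lists of length \<open>p\<close>. A form is a function from
  points to such elements. The wedge product is the usual sum over shuffles.
\<close>

type_synonym 'd ext = "(complex ^ 'd) list \<Rightarrow> complex"
type_synonym 'd dform = "complex ^ 'd \<Rightarrow> 'd ext"

definition alternating :: "'d::finite ext \<Rightarrow> bool"
  where "alternating \<alpha> \<longleftrightarrow>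
    (\<forall>xs ys. Vector_Spaces.linear (*s) (*) (\<lambda>v. \<alpha> (xs @ v # ys))) \<and>
    (\<forall>vs. \<not> distinct vs \<longrightarrow> \<alpha> vs = 0)"

definition wedge :: "'d ext \<Rightarrow> 'd ext \<Rightarrow> 'd ext" (infixr \<open>\<and>\<^sub>w\<close> 70)
  where "(\<alpha> \<and>\<^sub>w \<beta>) vs =
    (\<Sum>S\<in>Pow {..<length vs}. (- 1) ^ ell S ({..<length vs} - S)
       * \<alpha> (nths vs S) * \<beta> (nths vs ({..<length vs} - S)))"

definition ext_one :: "'d ext"
  where "ext_one vs = (if vs = [] then 1 else 0)"

text \<open>The product over a finite set of indices, in increasing order.\<close>

definition ext_prod :: "(nat \<Rightarrow> 'd ext) \<Rightarrow> nat set \<Rightarrow> 'd ext"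
  where "ext_prod \<alpha> A = foldr (\<lambda>i \<beta>. \<alpha> i \<and>\<^sub>w \<beta>) (sorted_list_of_set A) ext_one"

definition dlog :: "(complex ^ 'd \<Rightarrow> complex) \<Rightarrow> 'd::finite dform"
  where "dlog g z vs = (case vs of [v] \<Rightarrow> frechet_derivative g (at z) v / g z | _ \<Rightarrow> 0)"

definition pullback :: "(complex ^ 'd \<Rightarrow> complex ^ 'd) \<Rightarrow> 'd dform \<Rightarrow> 'd::finite dform"
  where "pullback f \<omega> u vs = \<omega> (f u) (map (frechet_derivative f (at u)) vs)"

text \<open>
  Forms on \<open>M\<close> are extended by zero, so that two forms on \<open>M\<close> are equal as functions if and only
  if they agree on \<open>M\<close>. No regularity in \<open>z\<close> is imposed: the only forms singled out through this
  predicate are determined pointwise by their pullback along a local biholomorphism.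
\<close>

definition form_on :: "(complex ^ 'd) set \<Rightarrow> 'd::finite dform \<Rightarrow> bool"
  where "form_on M \<omega> \<longleftrightarrow> (\<forall>z\<in>M. alternating (\<omega> z)) \<and> (\<forall>z. z \<notin> M \<longrightarrow> \<omega> z = (\<lambda>_. 0))"

definition psi :: "(nat \<Rightarrow> int ^ 'd) \<Rightarrow> nat \<Rightarrow> 'd::finite dform"
  where "psi ch i z vs = 1 / (2 * of_real pi * \<i>) * dlog (expchar (ch i)) z vs"

definition psi_set :: "(nat \<Rightarrow> int ^ 'd) \<Rightarrow> nat set \<Rightarrow> 'd::finite dform"
  where "psi_set ch B z = ext_prod (\<lambda>i. psi ch i z) B"


section \<open>Finite coverings\<close>

text \<open>
  A lattice \<open>\<Lambda>'\<close> of finite index over \<open>\<Lambda>\<close> is given by a \<open>\<int>\<close>-basis, the rows of \<open>P\<close>; the index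
  is automatically finite, since \<open>P\<close> is a square rational matrix. The basis identifies the torus
  \<open>U\<close> with character lattice \<open>\<Lambda>'\<close> with \<open>(\<complex>\<^sup>*)\<^sup>d\<close>, the character \<open>\<Sum>\<^sub>j n\<^sub>j P\<^sub>j\<close> becoming
  \<open>expchar n\<close>.
\<close>

definition lattice_of :: "rat ^ 'd ^ 'd \<Rightarrow> (rat ^ 'd) set"
  where "lattice_of P = range (\<lambda>n. ratvec n v* P)"

definition is_covering :: "rat ^ 'd ^ 'd \<Rightarrow> bool"
  where "is_covering P \<longleftrightarrow> invertible P \<and> range ratvec \<subseteq> lattice_of P"

definition cov_char :: "rat ^ 'd ^ 'd \<Rightarrow> rat ^ 'd \<Rightarrow> complex ^ 'd \<Rightarrow> complex"
  where "cov_char P l u = expchar (THE n. ratvec n v* P = l) u"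

text \<open>
  The map dual to \<open>\<Lambda> \<subseteq> \<Lambda>'\<close>: the coordinate functions of \<open>T\<close> are the characters of the standard
  basis vectors, and they are pulled back to the same elements of \<open>\<Lambda>'\<close>.
\<close>

definition cov_map :: "rat ^ 'd ^ 'd \<Rightarrow> complex ^ 'd \<Rightarrow> complex ^ 'd"
  where "cov_map P u = (\<chi> i. cov_char P (axis i 1) u)"

definition cov_fibre :: "rat ^ 'd ^ 'd \<Rightarrow> (complex ^ 'd) set \<Rightarrow> (complex ^ 'd) set"
  where "cov_fibre P S = {u \<in> torus. cov_map P u \<in> S}"

definition num_comp :: "rat ^ 'd ^ 'd \<Rightarrow> int ^ 'd \<Rightarrow> nat"
  where "num_comp P x = card (components (cov_fibre P (hyp x)))"

definition cov_hyp :: "rat ^ 'd ^ 'd \<Rightarrow> int ^ 'd \<Rightarrow> complex ^ 'd \<Rightarrow> (complex ^ 'd) set"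
  where "cov_hyp P x q = connected_component_set (cov_fibre P (hyp x)) q"

definition cov_hyp_inter ::
    "rat ^ 'd ^ 'd \<Rightarrow> (nat \<Rightarrow> int ^ 'd) \<Rightarrow> nat set \<Rightarrow> (nat \<Rightarrow> complex ^ 'd) \<Rightarrow> (complex ^ 'd) set"
  where "cov_hyp_inter P ch A q = {u \<in> torus. \<forall>i\<in>A. u \<in> cov_hyp P (ch i) (q i)}"

definition theta :: "rat ^ 'd ^ 'd \<Rightarrow> int ^ 'd \<Rightarrow> complex ^ 'd \<Rightarrow> complex"
  where "theta P x = cov_char P ((1 / of_nat (num_comp P x)) *s ratvec x)"

definition omega_cov ::
    "rat ^ 'd ^ 'd \<Rightarrow> (nat \<Rightarrow> int ^ 'd) \<Rightarrow> nat \<Rightarrow> complex ^ 'd \<Rightarrow> 'd::finite dform"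
  where "omega_cov P ch i q u vs =
    1 / (2 * of_real pi * \<i>)
      * dlog (\<lambda>w. 1 - inverse (theta P (ch i) q) * theta P (ch i) w) u vs"

definition psi_cov :: "rat ^ 'd ^ 'd \<Rightarrow> (nat \<Rightarrow> int ^ 'd) \<Rightarrow> nat \<Rightarrow> 'd::finite dform"
  where "psi_cov P ch i u vs =
    1 / of_nat (num_comp P (ch i)) * pullback (cov_map P) (psi ch i) u vs"

definition omega_bar_cov ::
    "rat ^ 'd ^ 'd \<Rightarrow> (nat \<Rightarrow> int ^ 'd) \<Rightarrow> nat \<Rightarrow> complex ^ 'd \<Rightarrow> 'd::finite dform"
  where "omega_bar_cov P ch i q u vs = 2 * omega_cov P ch i q u vs - psi_cov P ch i u vs"

definition omega_bar_cov_set ::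
    "rat ^ 'd ^ 'd \<Rightarrow> (nat \<Rightarrow> int ^ 'd) \<Rightarrow> nat set \<Rightarrow> complex ^ 'd \<Rightarrow> 'd::finite dform"
  where "omega_bar_cov_set P ch A q u = ext_prod (\<lambda>i. omega_bar_cov P ch i q u) A"

definition separates :: "rat ^ 'd ^ 'd \<Rightarrow> (nat \<Rightarrow> int ^ 'd) \<Rightarrow> nat set \<Rightarrow> bool"
  where "separates P ch A \<longleftrightarrow>
    (\<forall>W\<in>components (hyp_inter ch A).
       \<exists>q. (\<forall>i\<in>A. q i \<in> cov_fibre P (hyp (ch i))) \<and> cov_map P ` cov_hyp_inter P ch A q = W)"


section \<open>The forms attached to layers\<close>

definition omega_bar ::
    "(nat \<Rightarrow> int ^ 'd) \<Rightarrow> nat set \<Rightarrow> (complex ^ 'd) set \<Rightarrow> nat set \<Rightarrow> 'd::finite dform"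
  where "omega_bar ch E W A = (THE \<omega>. form_on (arr_complement ch E) \<omega> \<and>
    (\<forall>P p q0. is_covering P \<longrightarrow> separates P ch A \<longrightarrow> p \<in> W \<longrightarrow> q0 \<in> cov_fibre P {p} \<longrightarrow>
      (\<forall>u\<in>cov_fibre P (arr_complement ch E). \<forall>vs.
        pullback (cov_map P) \<omega> u vs =
          1 / of_nat (card (cov_hyp_inter P ch A (\<lambda>_. q0) \<inter> cov_fibre P {p}))
            * (\<Sum>q\<in>cov_fibre P {p}. omega_bar_cov_set P ch A q u vs))))"

definition eta_bar ::
    "(nat \<Rightarrow> int ^ 'd) \<Rightarrow> nat set \<Rightarrow> (complex ^ 'd) set \<Rightarrow> nat set \<Rightarrow> nat set \<Rightarrow> 'd::finite dform"
  where "eta_bar ch E W A B z vs =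
    (- 1) ^ ell A B * (omega_bar ch E W A z \<and>\<^sub>w psi_set ch B z) vs"

definition layer_over ::
    "(nat \<Rightarrow> int ^ 'd) \<Rightarrow> nat set \<Rightarrow> (complex ^ 'd) set \<Rightarrow> (complex ^ 'd) set"
  where "layer_over ch A L = (THE W. W \<in> components (hyp_inter ch A) \<and> L \<subseteq> W)"

end

theory Submission
  imports Defs
begin

text \<open>Write \<open>\<kappa>(t) = (t + 1) / (t - 1)\<close>. Since \<open>2 dlog (1 - t) - dlog t = \<kappa>(t) dlog t\<close>, the forms on a
covering \<open>f\<close> are functions times pullbacks of the \<open>\<psi>\<^sub>i\<close>:
\<open>omega_bar_cov P ch i q = \<kappa>(\<theta>\<^sub>i / \<theta>\<^sub>i(q)) / a\<^sub>i * f\<^sup>* \<psi>\<^sub>i\<close>. In logarithmic coordinates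
\<open>z = p * vexp w\<close>, with \<open>p\<close> in the layer, the points of a fibre correspond to integer vectors \<open>b\<close> modulo
a lattice, and averaging over the fibre turns the form of a layer into \<open>\<psi>\<^sub>A\<close> times
\<open>1 / m(A)\<close> times the mean over \<open>b\<close> of \<open>\<Prod>\<^sub>i \<kappa>(exp (\<chi>\<^sub>i \<cdot> (w + 2 \<pi> \<i> b) / a\<^sub>i))\<close>.

Three facts make this work. The covering separates \<open>A\<close> if and only if the integers \<open>\<chi>\<^sub>i \<cdot> b\<close> take
all values \<open>a\<^sub>i k\<^sub>i\<close> simultaneously (\<open>separates_imp_attains\<close>,
\<open>attains_imp_separates\<close>). Under that condition the multiplicity \<open>m(A)\<close> equals
\<open>\<Prod>\<^sub>i a\<^sub>i\<close> times the density of the vectors \<open>b\<close> with \<open>a\<^sub>i dvd \<chi>\<^sub>i \<cdot> b\<close> for all \<open>i\<close>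
(\<open>arith_mult_mean\<close>), which gives the factor \<open>1 / m(A)\<close>. And the mean depends only on \<open>A\<close> and \<open>w\<close>,
not on the denominators \<open>a\<^sub>i\<close> (\<open>layer_mean_unique\<close>), because \<open>\<kappa>\<close> satisfies the distribution
relation \<open>\<Sum>\<^bsub>\<xi>\<^sup>m = 1\<^esub> \<kappa>(t \<xi>) = m \<kappa>(t\<^sup>m)\<close>. Hence the form of a layer exists and is
given by this formula for every admissible choice of the \<open>a\<^sub>i\<close> (\<open>omega_bar_eq\<close>).

For the circuit \<open>C\<close> with \<open>m\<^sub>i = m(C - {i})\<close> take \<open>a\<^sub>i = N / m\<^sub>i\<close>. Then the numbers
\<open>t\<^sub>i = exp (c\<^sub>i m\<^sub>i \<chi>\<^sub>i \<cdot> (w + 2 \<pi> \<i> b) / N)\<close> have product one over \<open>C\<close>. Expanding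
\<open>\<Prod> (\<kappa>(t\<^sub>i) + 1) - \<Prod> (\<kappa>(t\<^sub>i) - 1)\<close>, which vanishes because
\<open>\<kappa>(t) + 1 = t * (\<kappa>(t) - 1)\<close>, shows that the sum of \<open>\<Prod>\<^bsub>i \<in> C - D\<^esub> \<kappa>(t\<^sub>i)\<close> over the
subsets \<open>D\<close> of odd size is zero (\<open>kappa_relation\<close>). As for the forms \<open>\<psi>\<close>,
\<open>(-1)\<^sup>j c\<^sub>j \<psi>\<^bsub>E - {j}\<^esub> / m(E - {j})\<close> is the same for all \<open>j \<in> C\<close>. The terms of the theorem
with \<open>B \<union> {j} = D\<close> therefore differ only by the sign given by the position of \<open>j\<close> in \<open>D\<close>; these
signs add up to one as \<open>D\<close> has odd size, and what remains is the relation for the \<open>t\<^sub>i\<close>.\<close>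

section \<open>Wedge products of one-forms\<close>

text \<open>Interior product with a vector. Together with \<open>grade_sign\<close> it gives the recursion
\<open>wedge_Cons\<close> for the sum over shuffles, from which all laws of the wedge product follow by
induction on the list of vectors.\<close>

definition contract :: "(complex, 'd) vec \<Rightarrow> 'd ext \<Rightarrow> 'd ext" where "contract v \<alpha> vs = \<alpha> (v # vs)"

definition grade_sign :: "'d ext \<Rightarrow> 'd ext" where "grade_sign \<alpha> vs = (- 1) ^ length vs * \<alpha> vs"

lemma ell_0 [simp]: "ell {} B = 0" by (simp add: ell_def)

lemma wedge_Nil [simp]: "(\<alpha> \<and>\<^sub>w \<beta>) [] = \<alpha> [] * \<beta> []"
  by (simp add: wedge_def)

lemma sum_Pow_lessThan_Suc:
  "(\<Sum>S\<in>Pow {..<Suc n}. f S) = (\<Sum>S\<in>Pow {..<n}. f (insert 0 (Suc ` S))) + (\<Sum>S\<in>Pow {..<n}. f (Suc ` S))"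
proof -
  have e: "{..<Suc n} = insert 0 (Suc ` {..<n})"
    by (rule lessThan_Suc_eq_insert_0)
  have i1: "inj_on (\<lambda>S. Suc ` S) (Pow {..<n})" by (simp add: inj_on_image_Pow)
  have i2: "inj_on (insert 0) ((\<lambda>S. Suc ` S) ` (Pow {..<n}))" by (auto simp: inj_on_def)
  have dj: "(\<lambda>S. Suc ` S) ` Pow {..<n} \<inter> insert 0 ` (\<lambda>S. Suc ` S) ` Pow {..<n} = {}" by auto
  have "Pow {..<Suc n} = (\<lambda>S. Suc ` S) ` Pow {..<n} \<union> insert 0 ` (\<lambda>S. Suc ` S) ` Pow {..<n}"
    unfolding e Pow_insert image_Pow_surj[OF refl, symmetric] by simp
  then show ?thesis
    by (simp add: sum.union_disjoint[OF _ _ dj] sum.reindex[OF i1] sum.reindex[OF i2] add.commute)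
qed

lemma ell_Suc: "ell (Suc ` S) (Suc ` T) = ell S T"
proof -
  have "{(a, b). a \<in> Suc ` S \<and> b \<in> Suc ` T \<and> b < a} = (map_prod Suc Suc) ` {(a, b). a \<in> S \<and> b \<in> T \<and> b < a}"
    by auto
  then show ?thesis unfolding ell_def by (simp add: card_image inj_on_def)
qed

lemma ell_insert0_left: "ell (insert 0 S) T = ell S T"
proof -
  have "{(a, b). a \<in> insert 0 S \<and> b \<in> T \<and> b < a} = {(a, b). a \<in> S \<and> b \<in> T \<and> b < a}" by auto
  then show ?thesis by (simp add: ell_def)
qed

lemma ell_insert0_right: assumes "finite S" "finite T"
  shows "ell (Suc ` S) (insert 0 (Suc ` T)) = card S + ell S T"
proof -
  have "{(a, b). a \<in> Suc ` S \<and> b \<in> insert 0 (Suc ` T) \<and> b < a} =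
     (\<lambda>s. (Suc s, 0)) ` S \<union> {(a, b). a \<in> Suc ` S \<and> b \<in> (Suc ` T) \<and> b < a}" by auto
  moreover have "finite {(a, b). a \<in> Suc ` S \<and> b \<in> (Suc ` T) \<and> b < a}"
    by (rule finite_subset[of _ "Suc ` S \<times> Suc ` T"]) (use assms in auto)
  moreover have "(\<lambda>s. (Suc s, 0)) ` S \<inter> {(a, b). a \<in> Suc ` S \<and> b \<in> (Suc ` T) \<and> b < a} = {}" by auto
  ultimately have "ell (Suc ` S) (insert 0 (Suc ` T)) = card ((\<lambda>s. (Suc s, 0::nat)) ` S) + ell (Suc ` S) (Suc ` T)"
    unfolding ell_def using assms by (simp add: card_Un_disjoint)
  then show ?thesis by (simp add: card_image inj_on_def ell_Suc)
qed

lemma nths_Suc_image: "nths (v # vs) (Suc ` S) = nths vs S" "nths (v # vs) (insert 0 (Suc ` S)) = v # nths vs S"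
  by (auto simp: nths_Cons intro: arg_cong[of _ _ "nths vs"])

lemma length_nths_subset: "S \<subseteq> {..<length vs} \<Longrightarrow> length (nths vs S) = card S"
proof -
  assume "S \<subseteq> {..<length vs}"
  then have "{i. i < length vs \<and> i \<in> S} = S" by auto
  then show ?thesis by (simp add: length_nths)
qed

text \<open>A shuffle either sends the first vector to \<open>\<alpha>\<close>, creating no inversions, or to \<open>\<beta>\<close>, in which
case every vector given to \<open>\<alpha>\<close> is inverted against it. So the interior product is an
antiderivation.\<close>

lemma wedge_Cons: "(\<alpha> \<and>\<^sub>w \<beta>) (v # vs) = (contract v \<alpha> \<and>\<^sub>w \<beta>) vs + (grade_sign \<alpha> \<and>\<^sub>w contract v \<beta>) vs"
proof -
  let ?n = "length vs"
  have c1: "{..<Suc ?n} - insert 0 (Suc ` S) = Suc ` ({..<?n} - S)" for S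
    by (auto simp: lessThan_Suc_eq_insert_0)
  have c2: "{..<Suc ?n} - Suc ` S = insert 0 (Suc ` ({..<?n} - S))" for S
    by (auto simp: lessThan_Suc_eq_insert_0)
  have l: "length (v # vs) = Suc ?n" by simp
  show ?thesis
    unfolding wedge_def[of \<alpha> \<beta> "v # vs"] l sum_Pow_lessThan_Suc c1 c2 nths_Suc_image
    by (rule arg_cong2[of _ _ _ _ "(+)"];
      auto simp: wedge_def contract_def grade_sign_def ell_insert0_left ell_Suc ell_insert0_right
       finite_subset length_nths_subset power_add intro!: sum.cong)
qed

lemma wedge_add_left: "((\<lambda>vs. \<alpha> vs + \<alpha>' vs) \<and>\<^sub>w \<beta>) vs = (\<alpha> \<and>\<^sub>w \<beta>) vs + (\<alpha>' \<and>\<^sub>w \<beta>) vs"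
  by (simp add: wedge_def algebra_simps sum.distrib)

lemma wedge_add_right: "(\<alpha> \<and>\<^sub>w (\<lambda>vs. \<beta> vs + \<beta>' vs)) vs = (\<alpha> \<and>\<^sub>w \<beta>) vs + (\<alpha> \<and>\<^sub>w \<beta>') vs"
  by (simp add: wedge_def algebra_simps sum.distrib)

lemma wedge_scale_left: "((\<lambda>vs. s * \<alpha> vs) \<and>\<^sub>w \<beta>) vs = s * (\<alpha> \<and>\<^sub>w \<beta>) vs"
  by (simp add: wedge_def algebra_simps sum_distrib_left)

lemma wedge_scale_right: "(\<alpha> \<and>\<^sub>w (\<lambda>vs. s * \<beta> vs)) vs = s * (\<alpha> \<and>\<^sub>w \<beta>) vs"
  by (simp add: wedge_def algebra_simps sum_distrib_left)

lemma wedge_minus_left: "((\<lambda>vs. - \<alpha> vs) \<and>\<^sub>w \<beta>) vs = - (\<alpha> \<and>\<^sub>w \<beta>) vs"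
  by (simp add: wedge_def sum_negf)

lemma contract_wedge: "contract v (\<alpha> \<and>\<^sub>w \<beta>) = (\<lambda>vs. (contract v \<alpha> \<and>\<^sub>w \<beta>) vs + (grade_sign \<alpha> \<and>\<^sub>w contract v \<beta>) vs)"
  by (rule ext) (simp add: contract_def wedge_Cons)

lemma grade_sign_wedge: "grade_sign (\<alpha> \<and>\<^sub>w \<beta>) = grade_sign \<alpha> \<and>\<^sub>w grade_sign \<beta>"
proof
  fix vs :: "(complex, 'a) vec list"
  have "(- 1) ^ length vs = (- 1) ^ length (nths vs S) * ((- 1) ^ length (nths vs ({..<length vs} - S)) :: complex)"
    if "S \<subseteq> {..<length vs}" for S
  proof -
    have "card S + card ({..<length vs} - S) = card (S \<union> ({..<length vs} - S))"
      using that by (intro card_Un_disjoint[symmetric]) (auto intro: finite_subset)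
    also have "S \<union> ({..<length vs} - S) = {..<length vs}" using that by auto
    finally have "length vs = card S + card ({..<length vs} - S)" by simp
    then show ?thesis using that by (metis Diff_subset length_nths_subset power_add)
  qed
  then show "grade_sign (\<alpha> \<and>\<^sub>w \<beta>) vs = (grade_sign \<alpha> \<and>\<^sub>w grade_sign \<beta>) vs"
    unfolding grade_sign_def wedge_def sum_distrib_left
    by (intro sum.cong refl) simp
qed

text \<open>The recursion of \<open>wedge_Cons\<close> expands both sides into the same
three terms, to which the induction hypothesis applies.\<close>

lemma wedge_assoc: "(\<alpha> \<and>\<^sub>w \<beta>) \<and>\<^sub>w \<gamma> = \<alpha> \<and>\<^sub>w \<beta> \<and>\<^sub>w \<gamma>"
proof
  show "((\<alpha> \<and>\<^sub>w \<beta>) \<and>\<^sub>w \<gamma>) vs = (\<alpha> \<and>\<^sub>w \<beta> \<and>\<^sub>w \<gamma>) vs" for vs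
    by (induction vs arbitrary: \<alpha> \<beta> \<gamma>)
      (simp_all add: wedge_Cons contract_wedge grade_sign_wedge wedge_add_left wedge_add_right)
qed

lemma ext_one_wedge [simp]: "ext_one \<and>\<^sub>w \<beta> = \<beta>"
proof
  have z: "((\<lambda>vs. 0) \<and>\<^sub>w \<beta>) vs = 0" for \<beta> :: "'a ext" and vs by (simp add: wedge_def)
  have i: "contract v ext_one = (\<lambda>vs. 0)" for v :: "(complex, 'a) vec" by (rule ext) (simp add: contract_def ext_one_def)
  have t: "grade_sign ext_one = (ext_one :: 'a ext)" by (rule ext) (auto simp: grade_sign_def ext_one_def)
  show "(ext_one \<and>\<^sub>w \<beta>) vs = \<beta> vs" for vs
    by (induction vs arbitrary: \<beta>) (simp_all add: wedge_Cons z i t, simp_all add: ext_one_def contract_def)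
qed

lemma wedge_ext_one [simp]: "\<beta> \<and>\<^sub>w ext_one = \<beta>"
proof
  have z: "(\<beta> \<and>\<^sub>w (\<lambda>vs. 0)) vs = 0" for \<beta> :: "'a ext" and vs by (simp add: wedge_def)
  have i: "contract v ext_one = (\<lambda>vs. 0)" for v :: "(complex, 'a) vec" by (rule ext) (simp add: contract_def ext_one_def)
  show "(\<beta> \<and>\<^sub>w ext_one) vs = \<beta> vs" for vs
    by (induction vs arbitrary: \<beta>) (simp_all add: wedge_Cons z i, simp_all add: ext_one_def contract_def)
qed

definition one_form :: "'d ext \<Rightarrow> bool" where "one_form \<alpha> \<longleftrightarrow> (\<forall>vs. length vs \<noteq> 1 \<longrightarrow> \<alpha> vs = 0)"

text \<open>On a one-form the grading sign is \<open>-1\<close> and the interior product is a scalar, so \<open>wedge_Cons\<close>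
becomes expansion along the first vector.\<close>

lemma one_form_Cons: assumes "one_form \<alpha>"
  shows "(\<alpha> \<and>\<^sub>w \<beta>) (v # vs) = \<alpha> [v] * \<beta> vs - (\<alpha> \<and>\<^sub>w contract v \<beta>) vs"
proof -
  have "contract v \<alpha> = (\<lambda>vs. \<alpha> [v] * ext_one vs)"
    using assms by (auto simp: one_form_def contract_def ext_one_def fun_eq_iff)
  moreover have "grade_sign \<alpha> = (\<lambda>vs. (-1) * \<alpha> vs)"
  proof
    fix vs show "grade_sign \<alpha> vs = - 1 * \<alpha> vs" using assms by (cases "length vs = 1") (auto simp: grade_sign_def one_form_def)
  qed
  ultimately show ?thesis by (simp add: wedge_Cons wedge_scale_left wedge_minus_left)
qed

lemma one_form_Nil: "one_form \<alpha> \<Longrightarrow> \<alpha> [] = 0" by (simp add: one_form_def)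

lemma one_forms_anticommute:
  assumes "one_form \<alpha>" "one_form \<beta>"
  shows "(\<alpha> \<and>\<^sub>w \<beta>) vs = - (\<beta> \<and>\<^sub>w \<alpha>) vs"
proof (cases vs)
  case Nil then show ?thesis using assms by (simp add: one_form_Nil)
next
  case (Cons v ws)
  have A: "(\<alpha> \<and>\<^sub>w \<beta>) (v # ws) = \<alpha> [v] * \<beta> ws - \<beta> [v] * \<alpha> ws" if "one_form \<alpha>" "one_form \<beta>" for \<alpha> \<beta> :: "'a ext"
  proof -
    have "contract v \<beta> = (\<lambda>vs. \<beta> [v] * ext_one vs)"
      using that by (auto simp: one_form_def contract_def ext_one_def fun_eq_iff)
    then show ?thesis by (simp add: one_form_Cons[OF that(1)] wedge_scale_right)
  qed
  show ?thesis using A[OF assms] A[OF assms(2,1)] Cons by simp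
qed

lemma one_forms_swap:
  assumes "one_form \<alpha>" "one_form \<beta>"
  shows "(\<alpha> \<and>\<^sub>w \<beta> \<and>\<^sub>w \<gamma>) vs = - (\<beta> \<and>\<^sub>w \<alpha> \<and>\<^sub>w \<gamma>) vs"
proof -
  have "\<alpha> \<and>\<^sub>w \<beta> = (\<lambda>vs. (-1) * (\<beta> \<and>\<^sub>w \<alpha>) vs)"
    using one_forms_anticommute[OF assms] by auto
  then show ?thesis
    unfolding wedge_assoc[symmetric] by (simp add: wedge_minus_left)
qed

lemma one_form_twice: "one_form \<alpha> \<Longrightarrow> (\<alpha> \<and>\<^sub>w \<alpha> \<and>\<^sub>w \<gamma>) vs = 0"
  using one_forms_swap[of \<alpha> \<alpha> \<gamma> vs] by simp

lemma ext_prod_empty [simp]: "ext_prod \<alpha> {} = ext_one" by (simp add: ext_prod_def)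

lemma ext_prod_insert_min:
  assumes "finite S" "\<And>s. s \<in> S \<Longrightarrow> a < s"
  shows "ext_prod \<alpha> (insert a S) = \<alpha> a \<and>\<^sub>w ext_prod \<alpha> S"
proof -
  have "sorted_list_of_set (insert a S) = a # sorted_list_of_set S"
    using assms by (subst sorted_list_of_set_insert) (force intro!: insort_is_Cons)+
  then show ?thesis by (simp add: ext_prod_def)
qed

lemma finite_min_induct [consumes 1, case_names empty insert]:
  assumes "finite (S :: nat set)" "P {}"
    "\<And>a S. finite S \<Longrightarrow> (\<And>s. s \<in> S \<Longrightarrow> a < s) \<Longrightarrow> P S \<Longrightarrow> P (insert a S)"
  shows "P S"
  using assms(1)
proof (induction "card S" arbitrary: S)
  case 0 then show ?case using assms(2) by simp
next
  case (Suc n)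
  then have m: "Min S \<in> S" by (metis Min_in card.empty nat.distinct(1))
  have "P (S - {Min S})" using Suc m by (intro Suc.hyps) auto
  then have "P (insert (Min S) (S - {Min S}))"
    using Suc.prems by (intro assms(3)) (auto simp: order.strict_iff_order)
  then show ?case using m by (simp add: insert_absorb)
qed

text \<open>Moving the new factor to its place passes it over all smaller indices, each at the cost of a sign.\<close>

lemma wedge_ext_prod_insert:
  assumes "finite S" "a \<notin> S" "one_form (\<alpha> a)" "\<And>i. i \<in> S \<Longrightarrow> one_form (\<alpha> i)"
  shows "(\<alpha> a \<and>\<^sub>w ext_prod \<alpha> S) vs = (-1) ^ card {s \<in> S. s < a} * ext_prod \<alpha> (insert a S) vs"
  using assms
proof (induction S arbitrary: vs rule: finite_min_induct)
  case empty
  have "ext_prod \<alpha> (insert a {}) = \<alpha> a \<and>\<^sub>w ext_prod \<alpha> {}" by (rule ext_prod_insert_min) auto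
  then show ?case by simp
next
  case (insert s S)
  show ?case
  proof (cases "a < s")
    case True
    then have al: "a < t" if "t \<in> insert s S" for t using that insert.hyps(2)[of t] by auto
    then have e: "{t \<in> insert s S. t < a} = {}" using order.asym by blast
    have "ext_prod \<alpha> (insert a (insert s S)) = \<alpha> a \<and>\<^sub>w ext_prod \<alpha> (insert s S)"
      using insert.hyps(1) al by (intro ext_prod_insert_min) auto
    then show ?thesis by (simp only: e card.empty power_0 mult_1)
  next
    case False
    with insert.prems have sa: "s < a" by auto
    then have e: "{t \<in> insert s S. t < a} = insert s {t \<in> S. t < a}" by auto
    have c: "card {t \<in> insert s S. t < a} = Suc (card {t \<in> S. t < a})"
      unfolding e using insert.hyps by (subst card_insert_disjoint) auto
    have "ext_prod \<alpha> (insert s S) = \<alpha> s \<and>\<^sub>w ext_prod \<alpha> S"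
      using insert.hyps by (rule ext_prod_insert_min)
    then have "(\<alpha> a \<and>\<^sub>w ext_prod \<alpha> (insert s S)) vs = - (\<alpha> s \<and>\<^sub>w \<alpha> a \<and>\<^sub>w ext_prod \<alpha> S) vs"
      using one_forms_swap[of "\<alpha> a" "\<alpha> s"] insert.prems by simp
    also have "\<alpha> a \<and>\<^sub>w ext_prod \<alpha> S = (\<lambda>vs. (-1) ^ card {s \<in> S. s < a} * ext_prod \<alpha> (insert a S) vs)"
      using insert by auto
    finally have "(\<alpha> a \<and>\<^sub>w ext_prod \<alpha> (insert s S)) vs = (-1) ^ card {t \<in> insert s S. t < a} * (\<alpha> s \<and>\<^sub>w ext_prod \<alpha> (insert a S)) vs"
      by (simp only: c wedge_scale_right power_Suc) simp
    also have "\<alpha> s \<and>\<^sub>w ext_prod \<alpha> (insert a S) = ext_prod \<alpha> (insert a (insert s S))"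
      using insert.hyps sa by (subst insert_commute, subst ext_prod_insert_min) auto
    finally show ?thesis .
  qed
qed

lemma wedge_ext_prod_member:
  assumes "finite S" "a \<in> S" "\<And>i. i \<in> S \<Longrightarrow> one_form (\<alpha> i)"
  shows "(\<alpha> a \<and>\<^sub>w ext_prod \<alpha> S) vs = 0"
proof -
  have "ext_prod \<alpha> S = (\<lambda>vs. (-1) ^ card {s \<in> S - {a}. s < a} * (\<alpha> a \<and>\<^sub>w ext_prod \<alpha> (S - {a})) vs)"
    using wedge_ext_prod_insert[of "S - {a}" a \<alpha>] assms by (auto simp: insert_absorb)
  then show ?thesis
    using one_form_twice[of "\<alpha> a"] assms by (simp add: wedge_scale_right)
qed

lemma ell_insert_left:
  assumes "finite A" "finite B" "a \<notin> A"
  shows "ell (insert a A) B = card {b \<in> B. b < a} + ell A B"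
proof -
  have "{(x, b). x \<in> insert a A \<and> b \<in> B \<and> b < x} =
     Pair a ` {b \<in> B. b < a} \<union> {(x, b). x \<in> A \<and> b \<in> B \<and> b < x}" by auto
  moreover have "finite {(x, b). x \<in> A \<and> b \<in> B \<and> b < x}"
    by (rule finite_subset[of _ "A \<times> B"]) (use assms in auto)
  ultimately have "ell (insert a A) B = card (Pair a ` {b \<in> B. b < a}) + ell A B"
    unfolding ell_def using assms by (simp only:) (rule card_Un_disjoint, auto)
  then show ?thesis by (simp add: card_image inj_on_def)
qed

text \<open>This cancels the sign \<open>(- 1) ^ ell A B\<close> in the definition of \<open>eta_bar\<close>: after it only the union
of the two index sets matters.\<close>

lemma wedge_ext_prod_disjoint:
  assumes "finite A" "finite B" "A \<inter> B = {}" "\<And>i. i \<in> A \<union> B \<Longrightarrow> one_form (\<alpha> i)"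
  shows "(ext_prod \<alpha> A \<and>\<^sub>w ext_prod \<alpha> B) vs = (-1) ^ ell A B * ext_prod \<alpha> (A \<union> B) vs"
  using assms
proof (induction A arbitrary: vs rule: finite_min_induct)
  case empty
  then show ?case by simp
next
  case (insert a A)
  have a: "a \<notin> A" using insert.hyps by auto
  have "ext_prod \<alpha> A \<and>\<^sub>w ext_prod \<alpha> B = (\<lambda>vs. (-1) ^ ell A B * ext_prod \<alpha> (A \<union> B) vs)"
    using insert by auto
  then have "(ext_prod \<alpha> (insert a A) \<and>\<^sub>w ext_prod \<alpha> B) vs = (-1) ^ ell A B * (\<alpha> a \<and>\<^sub>w ext_prod \<alpha> (A \<union> B)) vs"
    using insert.hyps by (simp add: ext_prod_insert_min wedge_assoc wedge_scale_right)
  also have "(\<alpha> a \<and>\<^sub>w ext_prod \<alpha> (A \<union> B)) vs = (-1) ^ card {s \<in> A \<union> B. s < a} * ext_prod \<alpha> (insert a (A \<union> B)) vs"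
    using insert a by (intro wedge_ext_prod_insert) auto
  also have "{s \<in> A \<union> B. s < a} = {b \<in> B. b < a}" using insert.hyps(2) by force
  finally show ?case using insert a by (simp add: ell_insert_left power_add)
qed

lemma ext_prod_scale:
  assumes "finite A" "\<And>i. i \<in> A \<Longrightarrow> \<beta> i = (\<lambda>vs. s i * \<alpha> i vs)"
  shows "ext_prod \<beta> A = (\<lambda>vs. (\<Prod>i\<in>A. s i) * ext_prod \<alpha> A vs)"
  using assms
proof (induction A rule: finite_min_induct)
  case (insert a S)
  have "a \<notin> S" using insert.hyps by auto
  moreover have "ext_prod \<beta> S = (\<lambda>vs. (\<Prod>i\<in>S. s i) * ext_prod \<alpha> S vs)" "\<beta> a = (\<lambda>vs. s a * \<alpha> a vs)"
    using insert by auto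
  ultimately show ?case using insert.hyps
    by (simp add: ext_prod_insert_min wedge_scale_left wedge_scale_right mult.assoc)
qed auto

lemma ext_prod_map:
  assumes "finite A"
  shows "ext_prod \<alpha> A (map f vs) = ext_prod (\<lambda>i vs. \<alpha> i (map f vs)) A vs"
  using assms
proof (induction A arbitrary: vs rule: finite_min_induct)
  case empty
  show ?case by (simp add: ext_one_def)
next
  case (insert a S)
  then show ?case by (simp add: ext_prod_insert_min, simp add: wedge_def nths_map)
qed

definition multilin :: "'d::finite ext \<Rightarrow> bool" where
  "multilin \<alpha> \<longleftrightarrow> (\<forall>xs ys. Vector_Spaces.linear (*s) (*) (\<lambda>v. \<alpha> (xs @ v # ys)))"

lemma linear_scale_eq: "Vector_Spaces.linear (*s) (*) (f :: complex^'d \<Rightarrow> complex) \<longleftrightarrow>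
  (\<forall>x y. f (x + y) = f x + f y) \<and> (\<forall>c x. f (c *s x) = c * f x)"
  unfolding linear_iff_module_hom module_hom_iff
  using vec.module_axioms vector_space_over_itself.module_axioms by metis

lemma multilin_contract: "multilin \<alpha> \<Longrightarrow> multilin (contract v \<alpha>)"
  unfolding multilin_def contract_def
proof (intro allI)
  fix xs ys
  assume "\<forall>xs ys. Vector_Spaces.linear (*s) (*) (\<lambda>w. \<alpha> (xs @ w # ys))"
  from this[rule_format, of "v # xs" ys]
  show "Vector_Spaces.linear (*s) (*) (\<lambda>w. \<alpha> (v # xs @ w # ys))" by simp
qed

lemma multilin_wedge_one_form:
  assumes "one_form \<alpha>" "multilin \<alpha>" "multilin \<beta>" shows "multilin (\<alpha> \<and>\<^sub>w \<beta>)"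
  unfolding multilin_def
proof safe
  have a: "\<alpha> [x + y] = \<alpha> [x] + \<alpha> [y]" "\<alpha> [c *s x] = c * \<alpha> [x]" for x y c
    using assms(2)[unfolded multilin_def, rule_format, of "[]" "[]"] by (simp_all add: linear_scale_eq)
  fix xs ys
  show "Vector_Spaces.linear (*s) (*) (\<lambda>v. (\<alpha> \<and>\<^sub>w \<beta>) (xs @ v # ys))"
    using assms(3)
  proof (induction xs arbitrary: \<beta>)
    case Nil
    have i: "contract (x + y) \<beta> = (\<lambda>vs. contract x \<beta> vs + contract y \<beta> vs)" "contract (c *s x) \<beta> = (\<lambda>vs. c * contract x \<beta> vs)" for x y c
      using Nil[unfolded multilin_def, rule_format, of "[]"] by (simp_all add: linear_scale_eq contract_def fun_eq_iff)
    show ?case unfolding linear_scale_eq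
      by (auto simp: one_form_Cons[OF assms(1)] a i wedge_add_right wedge_scale_right algebra_simps)
  next
    case (Cons x xs)
    have "Vector_Spaces.linear (*s) (*) (\<lambda>v. \<beta> (xs @ v # ys))" using Cons.prems by (simp add: multilin_def)
    moreover have "Vector_Spaces.linear (*s) (*) (\<lambda>v. (\<alpha> \<and>\<^sub>w contract x \<beta>) (xs @ v # ys))"
      by (intro Cons.IH multilin_contract Cons.prems)
    ultimately show ?case unfolding linear_scale_eq
      by (auto simp: one_form_Cons[OF assms(1)] algebra_simps)
  qed
qed

text \<open>Unlike vanishing on all lists with a repetition, this condition passes directly through the
expansion \<open>one_form_Cons\<close>; together with multilinearity it implies \<open>alternating\<close>.\<close>

definition adjacent_vanishing :: "'d ext \<Rightarrow> bool" where "adjacent_vanishing \<beta> \<longleftrightarrow> (\<forall>xs v ys. \<beta> (xs @ v # v # ys) = 0)"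

lemma adjacent_vanishing_wedge_one_form:
  assumes "one_form \<alpha>" "adjacent_vanishing \<beta>" shows "adjacent_vanishing (\<alpha> \<and>\<^sub>w \<beta>)"
  unfolding adjacent_vanishing_def
proof (intro allI)
  fix xs v ys
  show "(\<alpha> \<and>\<^sub>w \<beta>) (xs @ v # v # ys) = 0"
    using assms(2)
  proof (induction xs arbitrary: \<beta>)
    case Nil
    have "\<beta> ([] @ v # v # vs) = 0" for vs using Nil unfolding adjacent_vanishing_def by blast
    then have "contract v (contract v \<beta>) = (\<lambda>_. 0)" by (simp add: contract_def fun_eq_iff)
    moreover have "(\<alpha> \<and>\<^sub>w (\<lambda>_. 0)) ys = 0" by (simp add: wedge_def)
    ultimately show ?case by (simp add: one_form_Cons[OF assms(1)] contract_def)
  next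
    case (Cons x xs)
    have "\<beta> ((x # xs) @ v # v # vs) = 0" for xs v vs using Cons.prems unfolding adjacent_vanishing_def by blast
    then have "adjacent_vanishing (contract x \<beta>)" by (simp add: contract_def adjacent_vanishing_def)
    moreover have "\<beta> (xs @ v # v # ys) = 0" using Cons.prems by (simp add: adjacent_vanishing_def)
    ultimately show ?case using Cons.IH by (simp add: one_form_Cons[OF assms(1)])
  qed
qed

text \<open>By linearity, vanishing on adjacent equal vectors means changing sign under adjacent swaps, and such
swaps bring two equal vectors next to each other.\<close>

lemma alternatingI:
  assumes "multilin \<beta>" "adjacent_vanishing \<beta>" shows "alternating \<beta>"
  unfolding alternating_def
proof (intro conjI allI impI)
  have sw: "\<beta> (xs @ v # w # ys) = - \<beta> (xs @ w # v # ys)" for xs v w ys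
  proof -
    have 1: "\<beta> (xs @ (a + b) # zs) = \<beta> (xs @ a # zs) + \<beta> (xs @ b # zs)" for a b xs zs
      using assms(1) unfolding multilin_def linear_scale_eq by blast
    have 2: "\<beta> (xs @ x # (a + b) # ys) = \<beta> (xs @ x # a # ys) + \<beta> (xs @ x # b # ys)" for x a b
      using 1[of "xs @ [x]" a b ys] by simp
    have "\<beta> (xs @ (v + w) # (v + w) # ys) = 0" using assms(2) by (simp add: adjacent_vanishing_def)
    moreover have "\<beta> (xs @ v # v # ys) = 0" "\<beta> (xs @ w # w # ys) = 0" using assms(2) by (simp_all add: adjacent_vanishing_def)
    ultimately have "\<beta> (xs @ v # w # ys) + \<beta> (xs @ w # v # ys) = 0" by (simp add: 1 2)
    then show ?thesis by (simp add: eq_neg_iff_add_eq_0)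
  qed
  have z: "\<beta> (xs @ v # ys @ v # zs) = 0" for xs v ys zs
  proof (induction ys arbitrary: xs)
    case Nil then show ?case using assms(2) by (simp add: adjacent_vanishing_def)
  next
    case (Cons y ys)
    show ?case using sw[of xs v y "ys @ v # zs"] Cons[of "xs @ [y]"] by simp
  qed
  show "Vector_Spaces.linear (*s) (*) (\<lambda>v. \<beta> (xs @ v # ys))" for xs ys
    using assms(1) by (simp add: multilin_def)
  show "\<beta> vs = 0" if "\<not> distinct vs" for vs
    using not_distinct_decomp[OF that] z by auto
qed

lemma ext_prod_alternating:
  assumes "finite A" "\<And>i. i \<in> A \<Longrightarrow> one_form (\<alpha> i)" "\<And>i. i \<in> A \<Longrightarrow> multilin (\<alpha> i)"
  shows "alternating (ext_prod \<alpha> A)"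
proof -
  have "multilin (ext_prod \<alpha> A) \<and> adjacent_vanishing (ext_prod \<alpha> A)"
    using assms
  proof (induction A rule: finite_min_induct)
    case empty
    show ?case by (simp add: multilin_def adjacent_vanishing_def ext_one_def linear_scale_eq)
  next
    case (insert a S)
    then show ?case by (simp add: ext_prod_insert_min multilin_wedge_one_form adjacent_vanishing_wedge_one_form)
  qed
  then show ?thesis by (simp add: alternatingI)
qed

section \<open>Pairings and means of periodic functions\<close>

text \<open>The scalars are left general because characters are paired with integer vectors, where the
values are compared for divisibility, and with complex vectors, the logarithms of points.\<close>

definition pairing :: "int^'d \<Rightarrow> 'a::comm_ring_1^'d \<Rightarrow> 'a" where
  "pairing x w = (\<Sum>i\<in>UNIV. of_int (x $ i) * w $ i)"

definition ivec :: "int^'d \<Rightarrow> 'a::comm_ring_1^'d" where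
  "ivec b = (\<chi> i. of_int (b $ i))"

lemma pairing_add_right: "pairing x (v + w) = pairing x v + pairing x w"
  by (simp add: pairing_def algebra_simps sum.distrib)

lemma pairing_add_left: "pairing (x + y) w = pairing x w + pairing y w"
  by (simp add: pairing_def algebra_simps sum.distrib)

lemma pairing_diff_right: "pairing x (v - w) = pairing x v - pairing x w"
  by (simp add: pairing_def algebra_simps sum_subtractf)

lemma pairing_diff_left: "pairing (x - y) w = pairing x w - pairing y w"
  by (simp add: pairing_def algebra_simps sum_subtractf)

lemma pairing_uminus_right: "pairing x (- w) = - pairing x w"
  by (simp add: pairing_def sum_negf)

lemma pairing_scale_right: "pairing x (c *s w) = c * pairing x w"
  by (simp add: pairing_def algebra_simps sum_distrib_left)

lemma pairing_scale_left: "pairing (c *s x) w = of_int c * pairing x w"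
  by (simp add: pairing_def algebra_simps sum_distrib_left)

lemma pairing_zero [simp]: "pairing x 0 = 0" "pairing 0 w = 0" by (simp_all add: pairing_def)

lemma pairing_sum_left: "pairing (\<Sum>i\<in>I. x i) w = (\<Sum>i\<in>I. pairing (x i) w)"
  by (induction I rule: infinite_finite_induct) (auto simp: pairing_add_left)

lemma pairing_sum_right: "pairing x (\<Sum>i\<in>I. w i) = (\<Sum>i\<in>I. pairing x (w i))"
  by (induction I rule: infinite_finite_induct) (auto simp: pairing_add_right)

lemma pairing_ivec: "pairing x (ivec b) = of_int (pairing x b)"
  by (simp add: pairing_def ivec_def)

lemma pairing_axis: "pairing x (axis i 1) = of_int (x $ i)"
  by (simp add: pairing_def axis_def if_distrib cong: if_cong)

lemma ivec_add: "ivec (a + b) = ivec a + ivec b" by (simp add: ivec_def vec_eq_iff)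

lemma ivec_scale: "ivec (c *s b) = of_int c *s ivec b" by (simp add: ivec_def vec_eq_iff)

lemma ivec_uminus: "ivec (- b) = - ivec b" by (simp add: ivec_def vec_eq_iff)

lemma ivec_0 [simp]: "ivec 0 = 0" by (simp add: ivec_def vec_eq_iff)

text \<open>Representatives of integer vectors modulo \<open>N\<close>.\<close>

definition cube :: "nat \<Rightarrow> (int^'d::finite) set" where
  "cube N = {b. \<forall>i. 0 \<le> b $ i \<and> b $ i < int N}"

definition periodic :: "nat \<Rightarrow> (int^'d \<Rightarrow> 'a) \<Rightarrow> bool" where
  "periodic N H \<longleftrightarrow> (\<forall>b c. H (b + int N *s c) = H b)"

text \<open>The average over \<open>\<int>\<^sup>d / N\<close> of a function with period \<open>N\<close>. It replaces every sum over a
finite quotient of lattices: it does not change when \<open>N\<close> is replaced by a multiple, and it is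
invariant under translation.\<close>

definition mean :: "nat \<Rightarrow> (int^'d::finite \<Rightarrow> complex) \<Rightarrow> complex" where
  "mean N H = (\<Sum>b\<in>cube N. H b) / of_nat (card (cube N :: (int^'d) set))"

lemma finite_cube [simp]: "finite (cube N :: (int^'d::finite) set)"
proof -
  have "(cube N :: (int^'d) set) \<subseteq> vec_lambda ` (PiE UNIV (\<lambda>_. {0..<int N}))"
  proof
    fix b :: "int^'d" assume "b \<in> cube N"
    then have "($) b \<in> PiE UNIV (\<lambda>_. {0..<int N})" by (auto simp: cube_def)
    then show "b \<in> vec_lambda ` (PiE UNIV (\<lambda>_. {0..<int N}))"
      by (metis image_eqI vec_nth_inverse)
  qed
  then show ?thesis by (rule finite_subset) (intro finite_imageI finite_PiE; simp)
qed

lemma card_cube_pos: "N > 0 \<Longrightarrow> card (cube N :: (int^'d::finite) set) > 0"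
proof -
  assume "N > 0"
  then have "(0 :: int^'d) \<in> cube N" by (simp add: cube_def)
  then show ?thesis by (auto simp: card_gt_0_iff)
qed

lemma periodicD: "periodic N H \<Longrightarrow> H (b + int N *s c) = H b"
  by (simp add: periodic_def)

lemma periodic_mod:
  assumes "periodic N H" shows "H (\<chi> i. (b $ i) mod int N) = H b"
proof -
  have "b = (\<chi> i. (b $ i) mod int N) + int N *s (\<chi> i. (b $ i) div int N)"
    by (simp add: vec_eq_iff)
  then show ?thesis using assms by (metis periodicD)
qed

lemma sum_cube_shift:
  fixes H :: "int^'d::finite \<Rightarrow> 'a::comm_monoid_add"
  assumes "N > 0" "periodic N H"
  shows "(\<Sum>b\<in>cube N. H (b + c)) = (\<Sum>b\<in>cube N. H b)"
proof -
  have "(\<Sum>b\<in>cube N. H (b + c)) = (\<Sum>b\<in>cube N. H (\<chi> i. (b $ i + c $ i) mod int N))"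
    using periodic_mod[OF assms(2)] by (intro sum.cong refl) (simp add: vector_add_component[symmetric] del: vector_add_component)
  also have "\<dots> = (\<Sum>b\<in>cube N. H b)"
    by (rule sum.reindex_bij_witness[of _ "\<lambda>b. \<chi> i. (b $ i - c $ i) mod int N" "\<lambda>b. \<chi> i. (b $ i + c $ i) mod int N"])
      (use assms(1) in \<open>auto simp: cube_def vec_eq_iff mod_simps\<close>)
  finally show ?thesis .
qed

lemma mean_shift: "N > 0 \<Longrightarrow> periodic N H \<Longrightarrow> mean N (\<lambda>b. H (b + c)) = mean N H"
  by (simp add: mean_def sum_cube_shift)

lemma mean_cong: "(\<And>b. b \<in> cube N \<Longrightarrow> G b = H b) \<Longrightarrow> mean N G = mean N H"
  unfolding mean_def by (metis (no_types, lifting) sum.cong)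

lemma mean_scale: "mean N (\<lambda>b. c * H b) = c * mean N H"
  by (simp add: mean_def sum_distrib_left)

lemma mean_sum: "mean N (\<lambda>b. \<Sum>i\<in>I. H i b) = (\<Sum>i\<in>I. mean N (H i))"
  by (simp add: mean_def sum_divide_distrib sum.swap[of _ I])

lemma mean_zero [simp]: "mean N (\<lambda>b. 0) = 0" by (simp add: mean_def)

lemma mean_const: "N > 0 \<Longrightarrow> mean N (\<lambda>b::int^'d::finite. c) = c"
  using card_cube_pos[of N, where 'd='d] by (auto simp: mean_def)

text \<open>Averaging \<open>H (b + c)\<close> over \<open>b\<close> modulo \<open>N\<close> and \<open>c\<close> modulo \<open>M\<close> in both orders, translation
invariance removes the other variable each time.\<close>

lemma mean_dvd:
  fixes H :: "int^'d::finite \<Rightarrow> complex"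
  assumes "periodic N H" "N dvd M" "M > 0"
  shows "mean M H = mean N H"
proof -
  have N: "N > 0" using assms by (auto intro: Nat.gr0I)
  obtain k where k: "M = N * k" using assms by auto
  have pM: "periodic M H"
    using assms(1) unfolding periodic_def k by (metis of_nat_mult vector_smult_assoc)
  have "of_nat (card (cube M :: (int^'d) set)) * (\<Sum>b\<in>cube N. H b) = (\<Sum>c\<in>cube M. \<Sum>b\<in>cube N. H (b + c))"
    by (simp add: sum_cube_shift[OF N assms(1)])
  also have "\<dots> = (\<Sum>b\<in>cube N. \<Sum>c\<in>cube M. H (c + b))"
    by (subst sum.swap) (simp add: add.commute)
  also have "\<dots> = of_nat (card (cube N :: (int^'d) set)) * (\<Sum>c\<in>cube M. H c)"
    by (simp add: sum_cube_shift[OF assms(3) pM])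
  finally show ?thesis
    using card_cube_pos[OF N, where 'd='d] card_cube_pos[OF assms(3), where 'd='d]
    unfolding mean_def by (subst frac_eq_eq) (auto simp: mult.commute card_gt_0_iff)
qed

section \<open>Roots of unity and the distribution relation\<close>

definition zeta :: "nat \<Rightarrow> int \<Rightarrow> complex" where "zeta m k = exp (2 * of_real pi * \<i> * of_int k / of_nat m)"

lemma zeta_add: "zeta m (j + k) = zeta m j * zeta m k"
  by (simp add: zeta_def exp_add[symmetric] algebra_simps add_divide_distrib)

lemma zeta_power: "zeta m k ^ n = zeta m (int n * k)"
  by (simp add: zeta_def exp_of_nat_mult[symmetric] algebra_simps)

lemma zeta_eq_1: assumes "m > 0" shows "zeta m k = 1 \<longleftrightarrow> int m dvd k"
proof
  assume "zeta m k = 1"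
  then obtain n :: int where n: "2 * of_real pi * \<i> * of_int k / of_nat m = of_int (2 * n) * pi * \<i>"
    unfolding zeta_def exp_eq_1 by (auto simp: complex_eq_iff)
  then have "(of_int k :: complex) = of_int n * of_nat m" using assms by (simp add: field_simps)
  then have "(of_int k :: complex) = of_int (n * int m)" by simp
  then show "int m dvd k" unfolding of_int_eq_iff by simp
next
  assume "int m dvd k"
  then obtain n where "k = int m * n" by auto
  then have "2 * of_real pi * \<i> * of_int k / of_nat m = of_int n * (2 * of_real pi * \<i>)"
    using assms by (simp add: field_simps)
  then show "zeta m k = 1" unfolding zeta_def by (simp add: exp_eq_1)
qed

lemma zeta_nonzero [simp]: "zeta m k \<noteq> 0" by (simp add: zeta_def)

lemma exp_zeta_power: "a > 0 \<Longrightarrow> (exp (w / of_nat a) * zeta a k) ^ a = exp w"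
  by (simp add: power_mult_distrib zeta_power zeta_eq_1 exp_of_nat_mult[symmetric])

lemma sum_zeta:
  assumes "m > 0"
  shows "(\<Sum>n<m. zeta m (int n * k)) = (if int m dvd k then of_nat m else 0)"
proof -
  have e: "(\<Sum>n<m. zeta m (int n * k)) = (\<Sum>n<m. zeta m k ^ n)" by (simp add: zeta_power)
  show ?thesis
  proof (cases "int m dvd k")
    case True
    then have "zeta m k = 1" using zeta_eq_1[OF assms] by simp
    then show ?thesis using True by (simp add: e)
  next
    case False
    then have "zeta m k \<noteq> 1" using zeta_eq_1[OF assms] by simp
    moreover have "zeta m k ^ m = 1" using zeta_eq_1[OF assms] by (simp add: zeta_power)
    ultimately show ?thesis using False by (simp add: e sum_gp_strict)
  qed
qed

text \<open>A cotangent in multiplicative form: \<open>\<kappa>(exp x)\<close> is the hyperbolic cotangent of \<open>x / 2\<close>. It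
is the coefficient of \<open>2 dlog (1 - t) - dlog t\<close> with respect to \<open>dlog t\<close>.\<close>

definition kappa :: "complex \<Rightarrow> complex" where "kappa t = (t + 1) / (t - 1)"

lemma kappa_inverse: "t \<noteq> 0 \<Longrightarrow> kappa (inverse t) = - kappa t"
proof (cases "t = 1")
  case True then show ?thesis by (auto simp: kappa_def)
next
  assume "t \<noteq> 0"
  case False
  then have "1 - t \<noteq> 0" "t - 1 \<noteq> 0" "inverse t - 1 \<noteq> 0" by (auto simp: field_simps)
  then show ?thesis using False \<open>t \<noteq> 0\<close> by (simp add: kappa_def divide_simps) (simp add: algebra_simps)
qed

text \<open>Write \<open>\<kappa>(s) = 1 + 2 / (s - 1)\<close>. For \<open>s = t \<xi>\<close> with \<open>\<xi>\<^sup>m = 1\<close>, the quotient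
\<open>(t\<^sup>m - 1) / (s - 1)\<close> is a geometric sum in \<open>s\<close>, and summing over \<open>\<xi>\<close> keeps only its constant
term.\<close>

lemma kappa_distribution:
  assumes "m > 0" "t ^ m \<noteq> 1"
  shows "(\<Sum>k<m. kappa (t * zeta m (int k))) = of_nat m * kappa (t ^ m)"
proof -
  have ne: "t * zeta m (int k) \<noteq> 1" for k
  proof
    assume "t * zeta m (int k) = 1"
    then have "(t * zeta m (int k)) ^ m = 1" by simp
    moreover have "zeta m (int k) ^ m = 1" using assms zeta_eq_1[of m] by (simp add: zeta_power)
    ultimately show False using assms by (simp add: power_mult_distrib)
  qed
  have k: "kappa s = 1 + 2 / (s - 1)" if "s \<noteq> 1" for s
    using that by (simp add: kappa_def field_simps)
  have g: "1 / (t * zeta m (int k) - 1) = (\<Sum>j<m. t ^ j * zeta m (int k * int j)) / (t ^ m - 1)" for k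
  proof -
    let ?s = "t * zeta m (int k)"
    have "?s ^ m = t ^ m" using assms zeta_eq_1[of m] by (simp add: power_mult_distrib zeta_power)
    moreover have "t ^ j * zeta m (int k * int j) = ?s ^ j" for j by (simp add: power_mult_distrib zeta_power mult.commute)
    moreover have "(\<Sum>j<m. ?s ^ j) = (1 - ?s ^ m) / (1 - ?s)"
      using ne[of k] sum_gp_strict[of ?s m] by simp
    moreover have "(1 - ?s ^ m) / (1 - ?s) = (?s ^ m - 1) / (?s - 1)"
      by (metis minus_diff_eq minus_divide_divide)
    ultimately have "(\<Sum>j<m. t ^ j * zeta m (int k * int j)) = (t ^ m - 1) / (?s - 1)"
      by simp
    then show ?thesis using assms by simp
  qed
  have "(\<Sum>k<m. \<Sum>j<m. t ^ j * zeta m (int k * int j)) = (\<Sum>j<m. t ^ j * (\<Sum>k<m. zeta m (int k * int j)))"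
    by (subst sum.swap) (simp add: sum_distrib_left)
  also have "\<dots> = (\<Sum>j<m. if j = 0 then of_nat m else 0)"
    using assms by (intro sum.cong refl) (auto simp: sum_zeta zdvd_not_zless dest: dvd_imp_le)
  also have "\<dots> = of_nat m" using assms by simp
  finally have s: "(\<Sum>k<m. 1 / (t * zeta m (int k) - 1)) = of_nat m / (t ^ m - 1)"
    by (simp add: g sum_divide_distrib[symmetric])
  have "(\<Sum>k<m. kappa (t * zeta m (int k))) = of_nat m + 2 * (\<Sum>k<m. 1 / (t * zeta m (int k) - 1))"
    by (simp add: k[OF ne] sum.distrib sum_distrib_left)
  then show ?thesis using assms by (simp add: s k algebra_simps)
qed

text \<open>Expanding the two products over subsets, the terms with an even number of factors \<open>\<plusminus>1\<close> cancel.\<close>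

lemma sum_Pow_odd:
  fixes x :: "'i \<Rightarrow> complex"
  assumes "finite C"
  shows "2 * (\<Sum>D\<in>{D. D \<subseteq> C \<and> odd (card D)}. \<Prod>i\<in>C - D. x i) = (\<Prod>i\<in>C. x i + 1) - (\<Prod>i\<in>C. x i - 1)"
proof -
  have a: "(\<Prod>i\<in>C. x i + y) = (\<Sum>D\<in>Pow C. y ^ card D * (\<Prod>i\<in>C - D. x i))" for y
    using prod_add[OF assms, of "\<lambda>_. y" x] by (simp add: add.commute)
  have "(\<Prod>i\<in>C. x i + 1) - (\<Prod>i\<in>C. x i + (-1)) = (\<Sum>D\<in>Pow C. (1 - (-1) ^ card D) * (\<Prod>i\<in>C - D. x i))"
    unfolding a sum_subtractf[symmetric] by (simp add: algebra_simps)
  also have "\<dots> = (\<Sum>D\<in>Pow C. if odd (card D) then 2 * (\<Prod>i\<in>C - D. x i) else 0)"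
    by (intro sum.cong) auto
  also have "\<dots> = (\<Sum>D\<in>{D. D \<subseteq> C \<and> odd (card D)}. 2 * (\<Prod>i\<in>C - D. x i))"
    using assms by (subst sum.inter_filter[symmetric]) (auto simp: Pow_def)
  finally show ?thesis by (simp add: sum_distrib_left)
qed

lemma kappa_relation:
  assumes "finite C" "\<And>i. i \<in> C \<Longrightarrow> t i \<noteq> 1" "(\<Prod>i\<in>C. t i) = 1"
  shows "(\<Sum>D\<in>{D. D \<subseteq> C \<and> odd (card D)}. \<Prod>i\<in>C - D. kappa (t i)) = 0"
proof -
  have "(\<Prod>i\<in>C. kappa (t i) + 1) = (\<Prod>i\<in>C. t i * (2 / (t i - 1)))"
    using assms(2) by (intro prod.cong refl) (auto simp: kappa_def field_simps)
  also have "\<dots> = (\<Prod>i\<in>C. 2 / (t i - 1))" using assms(3) by (simp only: prod.distrib) simp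
  also have "\<dots> = (\<Prod>i\<in>C. kappa (t i) - 1)"
    using assms(2) by (intro prod.cong refl) (auto simp: kappa_def field_simps)
  finally show ?thesis using sum_Pow_odd[OF assms(1), of "\<lambda>i. kappa (t i)"] by simp
qed

section \<open>Integer duals and the multiplicity\<close>

text \<open>The image of \<open>b \<mapsto> (\<chi>\<^sub>i \<cdot> b)\<^sub>i\<close> contains \<open>\<Prod>\<^sub>i a\<^sub>i \<int>\<close>. Dually, an element of \<open>\<Lambda>\<close> in the
rational span of the \<open>\<chi>\<^sub>i\<close> is an integer combination of the \<open>\<chi>\<^sub>i / a\<^sub>i\<close>. Separating
coverings provide this property for their degrees \<open>a\<^sub>i\<close>, independence provides it for some constant.\<close>

definition attains :: "(nat \<Rightarrow> int^'d) \<Rightarrow> nat set \<Rightarrow> (nat \<Rightarrow> nat) \<Rightarrow> bool" where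
  "attains ch A a \<longleftrightarrow> (\<forall>k. \<exists>b::int^'d. \<forall>i\<in>A. pairing (ch i) b = int (a i) * k i)"

lemma attains_subset: "attains ch A a \<Longrightarrow> B \<subseteq> A \<Longrightarrow> attains ch B a"
  unfolding attains_def by (meson subsetD)

lemma attains_dvd:
  assumes "attains ch A a" "\<And>i. i \<in> A \<Longrightarrow> a i dvd a' i"
  shows "attains ch A a'"
  unfolding attains_def
proof
  fix k :: "nat \<Rightarrow> int"
  obtain b where b: "\<forall>i\<in>A. pairing (ch i) b = int (a i) * (int (a' i div a i) * k i)"
    using assms(1)[unfolded attains_def, rule_format, of "\<lambda>i. int (a' i div a i) * k i"] by blast
  have "pairing (ch i) b = int (a' i) * k i" if "i \<in> A" for i
    using b that assms(2)[OF that] by (metis dvd_mult_div_cancel mult.assoc of_nat_mult)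
  then show "\<exists>b. \<forall>i\<in>A. pairing (ch i) b = int (a' i) * k i" by blast
qed

lemma common_denominator:
  assumes "finite (S :: rat set)"
  shows "\<exists>N>0. \<forall>q\<in>S. \<exists>z. of_nat N * q = of_int z"
  using assms
proof (induction S)
  case empty then show ?case by (auto intro: exI[of _ 1])
next
  case (insert q S)
  then obtain N where N: "N > 0" "\<forall>q\<in>S. \<exists>z. of_nat N * q = of_int z" by auto
  obtain n d where nd: "quotient_of q = (n, d)" by force
  have d: "d > 0" using quotient_of_denom_pos[OF nd] .
  have q: "q = of_int n / of_int d" using quotient_of_div[OF nd] .
  have "of_nat (N * nat d) * q = of_int (int N * n)" using d by (simp add: q)
  moreover have "\<exists>z. of_nat (N * nat d) * p = of_int z" if "p \<in> S" for p
  proof -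
    obtain z where "of_nat N * p = of_int z" using N(2) \<open>p \<in> S\<close> by auto
    then have "of_nat (N * nat d) * p = of_int (z * d)" using d by (simp add: mult.assoc mult.left_commute[of _ "of_int d"] mult.commute)
    then show ?thesis by blast
  qed
  ultimately have "\<forall>p\<in>insert q S. \<exists>z. of_nat (N * nat d) * p = of_int z" by blast
  moreover have "N * nat d > 0" using N(1) d by simp
  ultimately show ?case by blast
qed

text \<open>A rational dual basis of the independent characters, with denominators cleared.\<close>

lemma indep_attains:
  fixes ch :: "nat \<Rightarrow> int^'d::finite"
  assumes "finite A" "indep ch A"
  shows "\<exists>N>0. attains ch A (\<lambda>_. N)"
proof -
  let ?v = "\<lambda>i. ratvec (ch i)"
  have inj: "inj_on ?v A" and ind: "vec.independent (?v ` A)" using assms(2) by (auto simp: indep_def)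
  fix j0 :: 'd
  have "\<exists>r :: rat^'d. \<forall>l\<in>A. (\<Sum>m\<in>UNIV. r $ m * ?v l $ m) = (if l = i then 1 else 0)" if "i \<in> A" for i
  proof -
    obtain g :: "rat^'d \<Rightarrow> rat^'d" where g: "\<forall>x\<in>?v ` A. g x = (if x = ?v i then axis j0 1 else 0)" "Vector_Spaces.linear (*s) (*s) g"
      using vec.linear_independent_extend[OF ind, of "\<lambda>x. if x = ?v i then axis j0 1 else 0"] by blast
    have "(\<Sum>m\<in>UNIV. (matrix g $ j0) $ m * ?v l $ m) = (if l = i then 1 else 0)" if "l \<in> A" for l
    proof -
      have "(\<Sum>m\<in>UNIV. (matrix g $ j0) $ m * ?v l $ m) = (matrix g *v ?v l) $ j0"
        by (simp add: matrix_vector_mult_def)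
      also have "\<dots> = g (?v l) $ j0" using g(2) by (simp add: matrix_works)
      also have "\<dots> = (if l = i then 1 else 0)"
        using g(1) that \<open>i \<in> A\<close> inj by (auto simp: inj_on_def)
      finally show ?thesis .
    qed
    then show ?thesis by blast
  qed
  then obtain r :: "nat \<Rightarrow> rat^'d" where r: "\<And>i l. i \<in> A \<Longrightarrow> l \<in> A \<Longrightarrow> (\<Sum>m\<in>UNIV. r i $ m * ?v l $ m) = (if l = i then 1 else 0)"
    by metis
  have "finite ((\<lambda>(i, m). r i $ m) ` (A \<times> UNIV))" using assms(1) by auto
  from common_denominator[OF this]
  obtain N where N: "N > 0" "\<forall>i\<in>A. \<forall>m. \<exists>z. of_nat N * r i $ m = of_int z" by auto
  define B where "B i = (\<chi> m. SOME z. of_nat N * r i $ m = of_int z)" for i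
  have B: "of_nat N * r i $ m = of_int (B i $ m)" if "i \<in> A" for i m
    unfolding B_def vec_lambda_beta by (rule someI_ex) (use N(2) that in blast)
  have P: "pairing (ch l) (B i) = (if l = i then int N else 0)" if "i \<in> A" "l \<in> A" for i l
  proof -
    have "(of_int (pairing (ch l) (B i)) :: rat) = (\<Sum>m\<in>UNIV. of_int (ch l $ m) * (of_nat N * r i $ m))"
      by (simp add: pairing_def B[OF that(1)])
    also have "\<dots> = of_nat N * (\<Sum>m\<in>UNIV. r i $ m * ?v l $ m)"
      by (simp add: ratvec_def sum_distrib_left mult_ac)
    also have "\<dots> = of_int (if l = i then int N else 0)" using r[OF that] by simp
    finally show ?thesis by (simp only: of_int_eq_iff)
  qed
  have "attains ch A (\<lambda>_. N)"
    unfolding attains_def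
  proof
    fix k :: "nat \<Rightarrow> int"
    have "pairing (ch l) (\<Sum>i\<in>A. k i *s B i) = int N * k l" if "l \<in> A" for l
    proof -
      have "pairing (ch l) (\<Sum>i\<in>A. k i *s B i) = (\<Sum>i\<in>A. if l = i then k l * int N else 0)"
        unfolding pairing_sum_right pairing_scale_right using P that by (intro sum.cong) auto
      then show ?thesis using that assms(1) by simp
    qed
    then show "\<exists>b. \<forall>i\<in>A. pairing (ch i) b = int N * k i" by blast
  qed
  then show ?thesis using N(1) by blast
qed

lemma smult_sum_right: "(c::'a::comm_ring_1) *s (\<Sum>i\<in>I. x i) = (\<Sum>i\<in>I. c *s x i)"
  by (simp add: vec_eq_iff sum_distrib_left)

lemma smult_minus_left: "(- c :: 'a::comm_ring_1) *s x = - (c *s x)"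
  by (simp add: vec_eq_iff)

lemma smult_diff_left: "(c - d :: 'a::comm_ring_1) *s x = c *s x - d *s x"
  by (simp add: vec_eq_iff algebra_simps)

lemma scale_cancel_int: "int N *s (x :: int^'d) = int N *s y \<Longrightarrow> N > 0 \<Longrightarrow> x = y"
  by (simp add: vec_eq_iff)

section \<open>The multiplicity as a count of tuples\<close>

lemma char_group_simps [simp]: "carrier char_group = UNIV" "x \<otimes>\<^bsub>char_group\<^esub> y = x + y" "\<one>\<^bsub>char_group\<^esub> = 0"
  by (simp_all add: char_group_def)

lemma comm_group_char_group: "comm_group (char_group :: (int^'d) monoid)"
  by (rule comm_groupI) (auto simp: algebra_simps intro: exI[of _ "- _"])

lemma inv_char_group: "inv\<^bsub>char_group\<^esub> x = - (x :: int^'d)"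
  by (rule group.inv_equality) (auto simp: comm_group.axioms(2)[OF comm_group_char_group])

lemma pow_char_group: "x [^]\<^bsub>char_group\<^esub> (r :: nat) = int r *s (x :: int^'d)"
proof (induction r)
  case 0 then show ?case by (simp add: nat_pow_def)
next
  case (Suc r)
  interpret comm_group "char_group :: (int^'d) monoid" by (rule comm_group_char_group)
  show ?case using Suc by (simp add: algebra_simps)
qed

definition int_span :: "(nat \<Rightarrow> int^'d) \<Rightarrow> nat set \<Rightarrow> (int^'d) set" where
  "int_span ch A = range (\<lambda>k. \<Sum>i\<in>A. k i *s ch i)"

lemma int_spanI: "(\<Sum>i\<in>A. k i *s ch i) \<in> int_span ch A"
  unfolding int_span_def by (rule rangeI)

lemma int_span_uminus: "x \<in> int_span ch A \<Longrightarrow> - x \<in> int_span ch A"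
proof -
  assume "x \<in> int_span ch A"
  then obtain k where "x = (\<Sum>i\<in>A. k i *s ch i)" by (auto simp: int_span_def)
  then have "- x = (\<Sum>i\<in>A. (- k i) *s ch i)" by (simp add: sum_negf smult_minus_left)
  then show ?thesis by (simp only: int_spanI)
qed

lemma int_span_add: "x \<in> int_span ch A \<Longrightarrow> y \<in> int_span ch A \<Longrightarrow> x + y \<in> int_span ch A"
proof -
  assume "x \<in> int_span ch A" "y \<in> int_span ch A"
  then obtain k l where "x = (\<Sum>i\<in>A. k i *s ch i)" "y = (\<Sum>i\<in>A. l i *s ch i)" by (auto simp: int_span_def)
  then have "x + y = (\<Sum>i\<in>A. (k i + l i) *s ch i)" by (simp add: sum.distrib vector_sadd_rdistrib)
  then show ?thesis by (simp only: int_spanI)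
qed

lemma generate_char_group:
  fixes ch :: "nat \<Rightarrow> int^'d"
  assumes "finite A"
  shows "generate char_group (ch ` A) = int_span ch A"
proof
  interpret comm_group "char_group :: (int^'d) monoid" by (rule comm_group_char_group)
  have inc: "ch i \<in> int_span ch A" if "i \<in> A" for i
  proof -
    have "ch i = (\<Sum>l\<in>A. (if l = i then 1 else 0) *s ch l)"
      using that assms by (simp add: if_distrib[of "\<lambda>c. c *s _"] cong: if_cong)
    then show ?thesis unfolding int_span_def by (rule range_eqI[where x = "\<lambda>l. if l = i then 1 else 0"])
  qed
  show "generate char_group (ch ` A) \<subseteq> int_span ch A"
  proof
    fix x assume "x \<in> generate char_group (ch ` A)"
    then show "x \<in> int_span ch A"
    proof (induction rule: generate.induct)
      case one
      show ?case using int_spanI[of "\<lambda>_. 0" ch A] by simp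
    qed (auto simp: inc inv_char_group int_span_uminus int_span_add)
  qed
  let ?H = "generate char_group (ch ` A)"
  have sub: "subgroup ?H char_group" by (rule generate_is_subgroup) simp
  have add: "x + y \<in> ?H" if "x \<in> ?H" "y \<in> ?H" for x y using subgroup.m_closed[OF sub that] by simp
  have um: "- x \<in> ?H" if "x \<in> ?H" for x using subgroup.m_inv_closed[OF sub that] by (simp add: inv_char_group)
  have z: "0 \<in> ?H" using subgroup.one_closed[OF sub] by simp
  have n: "int n *s x \<in> ?H" if "x \<in> ?H" for x n
    by (induction n) (auto simp: z vector_sadd_rdistrib add that)
  have s: "c *s x \<in> ?H" if "x \<in> ?H" for x c
  proof (cases "c \<ge> 0")
    case True then show ?thesis using n[OF that, of "nat c"] by simp
  next
    case False then show ?thesis using um[OF n[OF that, of "nat (- c)"]] by (simp add: smult_minus_left)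
  qed
  have "(\<Sum>i\<in>I. k i *s ch i) \<in> ?H" if "I \<subseteq> A" for I k
    using finite_subset[OF that assms] that
    by (induction I rule: finite_induct) (auto intro!: z add intro: s[OF generate.incl])
  then show "int_span ch A \<subseteq> ?H" by (auto simp: int_span_def)
qed

text \<open>A torsion class of \<open>\<Lambda>\<close> modulo the span is represented by some \<open>\<Sum>\<^sub>i (n\<^sub>i / a\<^sub>i) \<chi>\<^sub>i \<in> \<Lambda>\<close>,
and its coefficients modulo \<open>a\<^sub>i\<close> are unique: pairing with the integer dual vectors supplied by
\<open>attains\<close> shows that they are integers and recovers them. Multiplying by \<open>N\<close> avoids
fractions.\<close>

lemma arith_mult_card:
  fixes ch :: "nat \<Rightarrow> int^'d::finite"
  assumes A: "finite A" and att: "attains ch A a" and N: "N > 0" and a: "\<And>i. i \<in> A \<Longrightarrow> a i dvd N"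
  shows "arith_mult ch A =
    card {n \<in> PiE A (\<lambda>i. {..<a i}). \<exists>x. int N *s x = (\<Sum>i\<in>A. int (n i * (N div a i)) *s ch i)}"
proof -
  let ?H = "int_span ch A"
  interpret comm_group "char_group :: (int^'d) monoid" by (rule comm_group_char_group)
  have sub: "subgroup ?H char_group"
    unfolding generate_char_group[OF A, symmetric] by (rule generate_is_subgroup) simp
  then have normal: "normal ?H char_group" by (rule normal_invI) (auto simp: inv_char_group)
  let ?cos = "\<lambda>x. ?H #>\<^bsub>char_group\<^esub> x"
  have coset_eq: "?cos x = ?cos y \<longleftrightarrow> x - y \<in> ?H" for x y
  proof
    assume "?cos x = ?cos y"
    then have "x \<in> ?cos y" using rcos_self[OF _ sub, of x] by simp
    then show "x - y \<in> ?H" by (auto simp: r_coset_def)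
  next
    assume "x - y \<in> ?H"
    then have "x \<in> ?cos y" by (auto simp: r_coset_def intro!: bexI[of _ "x - y"])
    then show "?cos x = ?cos y" using repr_independence[OF _ _ sub] by simp
  qed
  have tors: "torsion (char_group Mod ?H) = ?cos ` {x. \<exists>r>0. int r *s x \<in> ?H}"
  proof -
    have "?cos x [^]\<^bsub>char_group Mod ?H\<^esub> r = ?H \<longleftrightarrow> int r *s x \<in> ?H" for x and r :: nat
    proof -
      have "?cos x [^]\<^bsub>char_group Mod ?H\<^esub> r = ?cos (int r *s x)"
        using normal.FactGroup_pow[OF normal, of x r] by (simp add: pow_char_group)
      moreover have "?H = ?cos 0" using coset_mult_one[of ?H] by simp
      ultimately show ?thesis using coset_eq[of "int r *s x" 0] by simp
    qed
    then show ?thesis unfolding torsion_def carrier_FactGroup one_FactGroup by auto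
  qed
  have "\<exists>B. \<forall>l\<in>A. pairing (ch l) B = (if l = i then int (a i) else 0)" for i
  proof -
    obtain b where "\<forall>l\<in>A. pairing (ch l) b = int (a l) * (if l = i then 1 else 0)"
      using att[unfolded attains_def, rule_format, of "\<lambda>l. if l = i then 1 else 0"] by blast
    then show ?thesis by (intro exI[of _ b]) auto
  qed
  then obtain B where B: "\<And>i l. l \<in> A \<Longrightarrow> pairing (ch l) (B i) = (if l = i then int (a i) else 0)" by metis
  have Na: "int (N div a i) * int (a i) = int N" if "i \<in> A" for i
    using a[OF that] by (metis dvd_div_mult_self of_nat_mult)
  have PB: "pairing (\<Sum>l\<in>A. c l *s ch l) (B i) = c i * int (a i)" if "i \<in> A" for i c
    unfolding pairing_sum_left pairing_scale_left using that A
    by (simp add: B if_distrib cong: if_cong)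
  have coef: "pairing x (B i) = c i" if "int N *s x = (\<Sum>l\<in>A. (c l * int (N div a l)) *s ch l)" "i \<in> A" for x c i
  proof -
    have "int N * pairing x (B i) = c i * int (N div a i) * int (a i)"
      using PB[OF that(2), of "\<lambda>l. c l * int (N div a l)"] by (simp add: that(1)[symmetric] pairing_scale_left)
    then have "int N * pairing x (B i) = int N * c i" using Na[OF that(2)] by (simp add: mult.assoc)
    then show ?thesis using N by simp
  qed
  have repr: "int N *s x = (\<Sum>l\<in>A. (pairing x (B l) * int (N div a l)) *s ch l)" if rx: "r > 0" "int r *s x \<in> ?H" for x r
  proof -
    obtain s where s: "int r *s x = (\<Sum>l\<in>A. s l *s ch l)" using rx(2) by (auto simp: int_span_def)
    have p: "int r * pairing x (B i) = s i * int (a i)" if "i \<in> A" for i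
      using PB[OF that, of s] by (simp add: s[symmetric] pairing_scale_left)
    have "int r *s (int N *s x) = int N *s (\<Sum>l\<in>A. s l *s ch l)" unfolding s[symmetric] by (simp add: mult.commute)
    also have "\<dots> = (\<Sum>l\<in>A. (int r * (pairing x (B l) * int (N div a l))) *s ch l)"
      unfolding smult_sum_right vector_smult_assoc
    proof (intro sum.cong refl arg_cong2[of _ _ _ _ "(*s)"])
      fix l assume l: "l \<in> A"
      have "int N * s l = int (N div a l) * (s l * int (a l))" using Na[OF l] by (simp add: mult_ac)
      then show "int N * s l = int r * (pairing x (B l) * int (N div a l))" by (simp add: p[OF l, symmetric] mult_ac)
    qed
    also have "\<dots> = int r *s (\<Sum>l\<in>A. (pairing x (B l) * int (N div a l)) *s ch l)"
      by (simp add: smult_sum_right vector_smult_assoc)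
    finally show ?thesis using rx(1) by (rule scale_cancel_int)
  qed
  let ?S = "{n \<in> PiE A (\<lambda>i. {..<a i}). \<exists>x. int N *s x = (\<Sum>i\<in>A. int (n i * (N div a i)) *s ch i)}"
  define lam where "lam n = (SOME x. int N *s x = (\<Sum>i\<in>A. int (n i * (N div a i)) *s ch i))" for n
  have lam: "int N *s lam n = (\<Sum>i\<in>A. (int (n i) * int (N div a i)) *s ch i)" if "n \<in> ?S" for n
  proof -
    have "\<exists>x. int N *s x = (\<Sum>i\<in>A. int (n i * (N div a i)) *s ch i)" using that by blast
    then have "int N *s lam n = (\<Sum>i\<in>A. int (n i * (N div a i)) *s ch i)" unfolding lam_def by (rule someI_ex)
    then show ?thesis by simp
  qed
  have "bij_betw (\<lambda>n. ?cos (lam n)) ?S (torsion (char_group Mod ?H))"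
  proof (rule bij_betw_imageI)
    show "inj_on (\<lambda>n. ?cos (lam n)) ?S"
    proof (rule inj_onI)
      fix n n' assume n: "n \<in> ?S" and n': "n' \<in> ?S" and "?cos (lam n) = ?cos (lam n')"
      then have "lam n - lam n' \<in> ?H" by (simp only: coset_eq)
      then obtain s where s: "lam n - lam n' = (\<Sum>l\<in>A. s l *s ch l)" by (auto simp: int_span_def)
      have "n i = n' i" if i: "i \<in> A" for i
      proof -
        have "int (n i) - int (n' i) = s i * int (a i)"
          using PB[OF i, of s] coef[OF lam[OF n] i] coef[OF lam[OF n'] i] by (simp add: s[symmetric] pairing_diff_left)
        then have "int (n i) mod int (a i) = int (n' i) mod int (a i)" by (simp add: mod_eq_dvd_iff)
        moreover have "n i < a i" "n' i < a i" using n n' i by (auto simp: PiE_iff)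
        ultimately show ?thesis by simp
      qed
      then show "n = n'" using n n' by (auto intro: PiE_ext)
    qed
    show "(\<lambda>n. ?cos (lam n)) ` ?S = torsion (char_group Mod ?H)"
      unfolding tors
    proof (intro equalityI subsetI)
      fix X assume "X \<in> (\<lambda>n. ?cos (lam n)) ` ?S"
      then obtain n where n: "n \<in> ?S" and X: "X = ?cos (lam n)" by blast
      have "int N *s lam n \<in> ?H" unfolding lam[OF n] int_span_def by (rule rangeI)
      then show "X \<in> ?cos ` {x. \<exists>r>0. int r *s x \<in> ?H}" using N X by blast
    next
      fix X assume "X \<in> ?cos ` {x. \<exists>r>0. int r *s x \<in> ?H}"
      then obtain x r where r: "r > 0" "int r *s x \<in> ?H" and X: "X = ?cos x" by blast
      let ?p = "\<lambda>l. pairing x (B l)"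
      define n where "n = (\<lambda>i\<in>A. nat (?p i mod int (a i)))"
      define y where "y = x - (\<Sum>l\<in>A. (?p l div int (a l)) *s ch l)"
      have apos: "a i > 0" if "i \<in> A" for i using a[OF that] N by (auto intro: Nat.gr0I)
      have ny: "int N *s y = (\<Sum>i\<in>A. int (n i * (N div a i)) *s ch i)"
      proof -
        have "int N *s y = (\<Sum>l\<in>A. (?p l * int (N div a l)) *s ch l) - (\<Sum>l\<in>A. (int N * (?p l div int (a l))) *s ch l)"
          unfolding y_def vector_ssub_ldistrib by (subst repr[OF r]) (simp add: smult_sum_right)
        also have "\<dots> = (\<Sum>l\<in>A. (?p l * int (N div a l) - int N * (?p l div int (a l))) *s ch l)"
          by (simp add: sum_subtractf smult_diff_left)
        also have "\<dots> = (\<Sum>i\<in>A. int (n i * (N div a i)) *s ch i)"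
        proof (intro sum.cong refl arg_cong2[of _ _ _ _ "(*s)"])
          fix l assume l: "l \<in> A"
          have "?p l * int (N div a l) - int N * (?p l div int (a l)) = (?p l - int (a l) * (?p l div int (a l))) * int (N div a l)"
            unfolding Na[OF l, symmetric] by (simp add: algebra_simps)
          also have "\<dots> = (?p l mod int (a l)) * int (N div a l)" by (simp add: minus_mult_div_eq_mod)
          finally show "?p l * int (N div a l) - int N * (?p l div int (a l)) = int (n l * (N div a l))"
            using l apos[OF l] by (simp add: n_def)
        qed
        finally show ?thesis .
      qed
      have "n \<in> PiE A (\<lambda>i. {..<a i})" using apos by (auto simp: n_def nat_less_iff)
      with ny have nS: "n \<in> ?S" by blast
      have "int N *s lam n = int N *s y" unfolding lam[OF nS] ny by simp
      then have "lam n = y" using N by (rule scale_cancel_int)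
      then have "lam n - x = - (\<Sum>l\<in>A. (?p l div int (a l)) *s ch l)" by (simp add: y_def)
      moreover have "- (\<Sum>l\<in>A. (?p l div int (a l)) *s ch l) \<in> ?H"
        by (intro int_span_uminus) (auto simp: int_span_def)
      ultimately have "?cos (lam n) = X" by (simp add: X coset_eq)
      then show "X \<in> (\<lambda>n. ?cos (lam n)) ` ?S" using nS by blast
    qed
  qed
  then have "card ?S = card (torsion (char_group Mod ?H))" by (rule bij_betw_same_card)
  then show ?thesis unfolding arith_mult_def generate_char_group[OF A] by simp
qed

section \<open>The multiplicity as a mean\<close>

lemma periodic_zeta_pairing:
  assumes "N > 0" shows "periodic N (\<lambda>b. zeta N (pairing s b))"
  unfolding periodic_def using zeta_eq_1[OF assms] by (simp add: pairing_add_right pairing_scale_right zeta_add)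

text \<open>Orthogonality of characters: translating by a basis vector multiplies the mean by a root of unity,
which is different from one for some basis vector unless \<open>s\<close> is divisible by \<open>N\<close>.\<close>

lemma mean_zeta:
  fixes s :: "int^'d::finite"
  assumes N: "N > 0"
  shows "mean N (\<lambda>b. zeta N (pairing s b)) = (if \<exists>x. int N *s x = s then 1 else 0)"
proof (cases "\<exists>x. int N *s x = s")
  case True
  then obtain x where "s = int N *s x" by auto
  then have "zeta N (pairing s b) = 1" for b using zeta_eq_1[OF N] by (simp add: pairing_scale_left)
  then show ?thesis using True by (simp add: mean_const[OF N])
next
  case False
  have "\<exists>j. \<not> int N dvd s $ j"
  proof (rule ccontr)
    assume "\<not> ?thesis"
    then have "int N *s (\<chi> j. s $ j div int N) = s" by (simp add: vec_eq_iff)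
    then show False using False by blast
  qed
  then obtain j where j: "\<not> int N dvd s $ j" by auto
  let ?H = "\<lambda>b. zeta N (pairing s b)"
  have "mean N (\<lambda>b. ?H (b + axis j 1)) = mean N ?H" by (rule mean_shift[OF N periodic_zeta_pairing[OF N]])
  moreover have "?H (b + axis j 1) = zeta N (s $ j) * ?H b" for b
    by (simp add: pairing_add_right pairing_axis zeta_add mult.commute)
  ultimately have "zeta N (s $ j) * mean N ?H = mean N ?H" by (simp add: mean_scale)
  moreover have "zeta N (s $ j) \<noteq> 1" using j zeta_eq_1[OF N] by simp
  ultimately show ?thesis using False by simp
qed

lemma zeta_mult_cancel: assumes "a dvd N" "N > 0" shows "zeta N (int (N div a) * k) = zeta a k"
proof -
  have "a > 0" using assms by (auto intro: Nat.gr0I)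
  moreover obtain c where c: "N = a * c" using assms by auto
  moreover have "c > 0" using assms c by (auto intro: Nat.gr0I)
  ultimately show ?thesis by (simp add: zeta_def field_simps)
qed

text \<open>Double counting of \<open>\<Prod>\<^sub>i exp (2 \<pi> \<i> n\<^sub>i (\<chi>\<^sub>i \<cdot> b) / a\<^sub>i)\<close> over tuples \<open>n\<close> and vectors \<open>b\<close>.
Averaging over \<open>b\<close> first detects the tuples with \<open>\<Sum>\<^sub>i (n\<^sub>i / a\<^sub>i) \<chi>\<^sub>i \<in> \<Lambda>\<close>, counted by \<open>m(A)\<close>;
summing over \<open>n\<close> first detects the \<open>b\<close> with \<open>a\<^sub>i dvd \<chi>\<^sub>i \<cdot> b\<close>. This is the duality between the
torsion of \<open>\<Lambda>\<close> modulo the span and the components of the intersection.\<close>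

lemma arith_mult_mean:
  fixes ch :: "nat \<Rightarrow> int^'d::finite"
  assumes A: "finite A" and att: "attains ch A a" and N: "N > 0" and a: "\<And>i. i \<in> A \<Longrightarrow> a i dvd N"
  shows "of_nat (arith_mult ch A) =
    (\<Prod>i\<in>A. of_nat (a i)) * mean N (\<lambda>b. if \<forall>i\<in>A. int (a i) dvd pairing (ch i) b then 1 else 0)"
proof -
  let ?P = "PiE A (\<lambda>i. {..<a i})"
  let ?s = "\<lambda>n. (\<Sum>i\<in>A. int (n i * (N div a i)) *s ch i)"
  have fin: "finite ?P" using A by (intro finite_PiE) auto
  have apos: "a i > 0" if "i \<in> A" for i using a[OF that] N by (auto intro: Nat.gr0I)
  have z: "zeta N (pairing (?s n) b) = (\<Prod>i\<in>A. zeta (a i) (int (n i) * pairing (ch i) b))" for n b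
  proof -
    have "zeta N (\<Sum>i\<in>A. f i) = (\<Prod>i\<in>A. zeta N (f i))" for f
      using A by (induction A rule: finite_induct) (auto simp: zeta_add, simp add: zeta_def)
    then have "zeta N (pairing (?s n) b) = (\<Prod>i\<in>A. zeta N (int (N div a i) * (int (n i) * pairing (ch i) b)))"
      by (simp add: pairing_sum_left pairing_scale_left mult_ac)
    then show ?thesis by (simp add: zeta_mult_cancel[OF a N] cong: prod.cong)
  qed
  have "of_nat (arith_mult ch A) = (\<Sum>n\<in>?P. if \<exists>x. int N *s x = ?s n then 1 else 0 :: complex)"
    using arith_mult_card[OF A att N a] fin by (simp add: sum.If_cases Int_def)
  also have "\<dots> = (\<Sum>n\<in>?P. mean N (\<lambda>b. zeta N (pairing (?s n) b)))" by (simp only: mean_zeta[OF N])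
  also have "\<dots> = mean N (\<lambda>b. \<Sum>n\<in>?P. zeta N (pairing (?s n) b))" by (rule mean_sum[symmetric])
  also have "\<dots> = mean N (\<lambda>b. (\<Prod>i\<in>A. of_nat (a i)) * (if \<forall>i\<in>A. int (a i) dvd pairing (ch i) b then 1 else 0))"
  proof (rule mean_cong)
    fix b
    have "(\<Sum>n\<in>?P. zeta N (pairing (?s n) b)) = (\<Prod>i\<in>A. \<Sum>n<a i. zeta (a i) (int n * pairing (ch i) b))"
      unfolding z by (rule prod_sum_PiE[symmetric]) (use A in auto)
    also have "\<dots> = (\<Prod>i\<in>A. if int (a i) dvd pairing (ch i) b then of_nat (a i) else 0)"
      by (intro prod.cong refl sum_zeta apos)
    also have "\<dots> = (\<Prod>i\<in>A. of_nat (a i)) * (if \<forall>i\<in>A. int (a i) dvd pairing (ch i) b then 1 else 0)"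
      using A by (auto simp: prod_zero_iff intro: prod.cong)
    finally show "(\<Sum>n\<in>?P. zeta N (pairing (?s n) b)) = \<dots>" .
  qed
  finally show ?thesis by (simp add: mean_scale)
qed

section \<open>Logarithmic coordinates on the torus\<close>

text \<open>The exponential map of the torus. All computations with characters, coverings and components
become linear in this coordinate.\<close>

definition vexp :: "complex^'d \<Rightarrow> complex^'d" where "vexp w = (\<chi> i. exp (w $ i))"

abbreviation two_pi_i :: complex where "two_pi_i \<equiv> 2 * of_real pi * \<i>"

lemma vexp_torus [simp]: "vexp w \<in> torus" by (simp add: vexp_def torus_def)

lemma vexp_0 [simp]: "vexp 0 = 1" by (simp add: vexp_def vec_eq_iff)

lemma vexp_add: "vexp (v + w) = vexp v * vexp w" by (simp add: vexp_def vec_eq_iff exp_add)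

lemma vexp_uminus_right: "vexp w * vexp (- w) = 1" by (simp add: vexp_add[symmetric])

lemma torus_mult [simp]: "u \<in> torus \<Longrightarrow> v \<in> torus \<Longrightarrow> u * v \<in> torus" by (simp add: torus_def)

lemma one_torus [simp]: "1 \<in> torus" by (simp add: torus_def)

lemma torus_vexp_quotient:
  assumes "z \<in> torus" "p \<in> torus"
  obtains w where "z = p * vexp w"
proof
  show "z = p * vexp (\<chi> i. Ln (z $ i / p $ i))" using assms by (simp add: vexp_def torus_def vec_eq_iff)
qed

lemma torus_vexp: assumes "z \<in> torus" obtains w where "z = vexp w"
  using torus_vexp_quotient[OF assms one_torus] by auto

lemma expchar_vexp: "expchar x (vexp w) = exp (pairing x w)"
  by (simp add: expchar_def vexp_def pairing_def exp_sum exp_power_int)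

lemma expchar_mult: "expchar x (u * v) = expchar x u * expchar x v"
  by (simp add: expchar_def power_int_mult_distrib prod.distrib)

lemma expchar_scale_nat: "u \<in> torus \<Longrightarrow> expchar (int n *s x) u = expchar x u ^ n"
  by (elim torus_vexp) (simp add: expchar_vexp pairing_scale_left exp_of_nat_mult)

lemma expchar_nonzero: "u \<in> torus \<Longrightarrow> expchar x u \<noteq> 0"
  by (elim torus_vexp) (simp add: expchar_vexp)

lemma expchar_one [simp]: "expchar x 1 = 1"
  using expchar_vexp[of x 0] by simp

lemma exp_eq_1_two_pi_i: "exp w = 1 \<longleftrightarrow> (\<exists>n::int. w = two_pi_i * of_int n)"
proof
  assume "exp w = 1"
  then obtain n :: int where "Re w = 0" "Im w = of_int (2 * n) * pi" unfolding exp_eq_1 by auto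
  then have "w = two_pi_i * of_int n" by (simp add: complex_eq_iff)
  then show "\<exists>n::int. w = two_pi_i * of_int n" ..
qed (auto simp: exp_eq_1)

lemma exp_tpi_int [simp]: "exp (two_pi_i * of_int n) = 1" by (auto simp: exp_eq_1_two_pi_i)

lemma vexp_eq_1: "vexp w = 1 \<longleftrightarrow> (\<exists>b. w = two_pi_i *s ivec b)"
proof
  assume "vexp w = 1"
  then have "\<forall>i. \<exists>n::int. w $ i = two_pi_i * of_int n" by (simp add: vexp_def vec_eq_iff exp_eq_1_two_pi_i)
  then obtain n :: "_ \<Rightarrow> int" where "\<And>i. w $ i = two_pi_i * of_int (n i)" by metis
  then have "w = two_pi_i *s ivec (\<chi> i. n i)" by (simp add: vec_eq_iff ivec_def)
  then show "\<exists>b. w = two_pi_i *s ivec b" ..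
next
  assume "\<exists>b. w = two_pi_i *s ivec b"
  then obtain b where "w = two_pi_i *s ivec b" ..
  then show "vexp w = 1" by (simp add: vexp_def vec_eq_iff ivec_def)
qed

lemma vexp_eq_iff: "vexp v = vexp w \<longleftrightarrow> (\<exists>b. v = w + two_pi_i *s ivec b)"
proof -
  have "vexp v = vexp w \<longleftrightarrow> vexp (v - w) = 1"
  proof
    assume "vexp v = vexp w"
    then show "vexp (v - w) = 1" using vexp_add[of v "- w"] vexp_uminus_right[of w] by simp
  next
    assume "vexp (v - w) = 1"
    then show "vexp v = vexp w" using vexp_add[of "v - w" w] by simp
  qed
  then show ?thesis unfolding vexp_eq_1 by (auto simp: algebra_simps)
qed

lemma torus_mult_left_cancel: "p \<in> torus \<Longrightarrow> p * u = p * v \<longleftrightarrow> u = v"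
  by (auto simp: torus_def vec_eq_iff)

section \<open>Logarithmic derivatives of characters\<close>

definition vdiv :: "complex^'d \<Rightarrow> complex^'d \<Rightarrow> complex^'d" where "vdiv v z = (\<chi> i. v $ i / z $ i)"

lemma has_derivative_vec_nth: "((\<lambda>z. z $ i) has_derivative (\<lambda>v. v $ i)) (at (z :: complex^'d))"
  by (rule bounded_linear_imp_has_derivative[OF bounded_linear_vec_nth])

lemma has_derivative_expchar:
  assumes "z \<in> torus"
  shows "(expchar x has_derivative (\<lambda>v. expchar x z * pairing x (vdiv v z))) (at z)"
proof -
  have z: "z $ i \<noteq> 0" for i using assms by (simp add: torus_def)
  have "((\<lambda>z. \<Prod>i\<in>UNIV. (z $ i) powi (x $ i)) has_derivative
     (\<lambda>v. \<Sum>i\<in>UNIV. v $ i * (of_int (x $ i) * (z $ i) powi (x $ i - 1)) * (\<Prod>j\<in>UNIV - {i}. (z $ j) powi (x $ j)))) (at z)"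
    by (intro has_derivative_prod has_derivative_power_int has_derivative_vec_nth z)
  moreover have "v $ i * (of_int (x $ i) * (z $ i) powi (x $ i - 1)) * (\<Prod>j\<in>UNIV - {i}. (z $ j) powi (x $ j))
     = expchar x z * (of_int (x $ i) * (v $ i / z $ i))" for v i
  proof -
    have "expchar x z = (z $ i) powi (x $ i) * (\<Prod>j\<in>UNIV - {i}. (z $ j) powi (x $ j))"
      unfolding expchar_def by (rule prod.remove) auto
    moreover have "(z $ i) powi (x $ i - 1) = (z $ i) powi (x $ i) / z $ i" by (simp add: power_int_diff z)
    ultimately show ?thesis by simp
  qed
  moreover have "expchar x = (\<lambda>z. \<Prod>i\<in>UNIV. (z $ i) powi (x $ i))" by (rule ext) (simp add: expchar_def)
  ultimately show ?thesis by (simp add: pairing_def vdiv_def sum_distrib_left)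
qed

lemma dlog_expchar:
  assumes "z \<in> torus" shows "dlog (expchar x) z vs = (case vs of [v] \<Rightarrow> pairing x (vdiv v z) | _ \<Rightarrow> 0)"
  using frechet_derivative_at[OF has_derivative_expchar[OF assms, of x], symmetric] expchar_nonzero[OF assms, of x]
  by (auto simp: dlog_def split: list.splits)

lemma psi_eq:
  assumes "z \<in> torus" shows "psi ch i z vs = (case vs of [v] \<Rightarrow> pairing (ch i) (vdiv v z) / two_pi_i | _ \<Rightarrow> 0)"
  by (simp add: psi_def dlog_expchar[OF assms] split: list.splits)

lemma one_form_psi: "z \<in> torus \<Longrightarrow> one_form (psi ch i z)"
  by (auto simp: one_form_def psi_eq split: list.splits)

text \<open>On lists of length different from one the form vanishes, so linearity in every slot is trivial
there.\<close>

lemma multilin_psi: assumes "z \<in> torus" shows "multilin (psi ch i z)"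
  unfolding multilin_def
proof (intro allI)
  fix xs ys
  have "psi ch i z (xs @ v # ys) = (if xs = [] \<and> ys = [] then pairing (ch i) (vdiv v z) / two_pi_i else 0)" for v
    by (cases xs; cases ys) (auto simp: psi_eq[OF assms] split: list.splits)
  moreover have "vdiv (v + w) z = vdiv v z + vdiv w z" "vdiv (c *s v) z = c *s vdiv v z" for v w c
    by (simp_all add: vdiv_def vec_eq_iff add_divide_distrib)
  ultimately show "Vector_Spaces.linear (*s) (*) (\<lambda>v. psi ch i z (xs @ v # ys))"
    by (cases "xs = [] \<and> ys = []")
      (auto simp: linear_scale_eq pairing_add_right pairing_scale_right add_divide_distrib)
qed

section \<open>Connected components of intersections\<close>

text \<open>The common kernel of a set of characters: intersections of hypersurfaces, on the torus and on its
coverings, are all of this shape.\<close>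

definition char_kernel :: "(int^'d) set \<Rightarrow> (complex^'d) set" where
  "char_kernel X = {z \<in> torus. \<forall>x\<in>X. expchar x z = 1}"

lemma hyp_inter_char_kernel: "hyp_inter ch A = char_kernel (ch ` A)"
  by (auto simp: hyp_inter_def hyp_def char_kernel_def)

lemma char_kernel_mult_vexp: "p \<in> char_kernel X \<Longrightarrow> (\<And>x. x \<in> X \<Longrightarrow> pairing x w = 0) \<Longrightarrow> p * vexp w \<in> char_kernel X"
  by (auto simp: char_kernel_def expchar_mult expchar_vexp)

text \<open>If \<open>z\<close> is near \<open>p\<close>, the principal logarithm \<open>w\<close> of \<open>z / p\<close> is small; since
\<open>exp (pairing x w) = 1\<close>, the number \<open>pairing x w\<close> is a multiple of \<open>2 \<pi> \<i>\<close> of norm less than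
one, so it is zero.\<close>

lemma char_kernel_locally:
  fixes X :: "(int^'d) set"
  assumes "finite X" "p \<in> char_kernel X"
  shows "\<exists>e>0. \<forall>z\<in>char_kernel X. dist z p < e \<longrightarrow> (\<exists>w. z = p * vexp w \<and> (\<forall>x\<in>X. pairing x w = 0))"
proof -
  have p: "p $ i \<noteq> 0" for i using assms(2) by (simp add: char_kernel_def torus_def)
  let ?L = "\<lambda>z. (\<chi> i. Ln (z $ i / p $ i)) :: complex^'d"
  have "isCont (\<lambda>z. pairing x (?L z)) p" for x
    unfolding pairing_def vec_lambda_beta
    by (intro continuous_intros) (auto simp: p)
  moreover have "pairing x (?L p) = 0" for x using p by (simp add: pairing_def)
  ultimately have "((\<lambda>z. pairing x (?L z)) \<longlongrightarrow> 0) (at p)" for x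
    using isContD[of p "\<lambda>z. pairing x (?L z)"] by simp
  then have "eventually (\<lambda>z. norm (pairing x (?L z)) < 1) (at p)" for x
    using tendstoD[of "\<lambda>z. pairing x (?L z)" 0 "at p" 1] by simp
  then have "eventually (\<lambda>z. \<forall>x\<in>X. norm (pairing x (?L z)) < 1) (at p)"
    using assms(1) by (simp add: eventually_ball_finite)
  then obtain e where e: "e > 0" "\<And>z. z \<noteq> p \<Longrightarrow> dist z p < e \<Longrightarrow> \<forall>x\<in>X. norm (pairing x (?L z)) < 1"
    unfolding eventually_at by auto
  have "\<exists>w. z = p * vexp w \<and> (\<forall>x\<in>X. pairing x w = 0)" if z: "z \<in> char_kernel X" "dist z p < e" for z
  proof (cases "z = p")
    case True then show ?thesis by (intro exI[of _ 0]) simp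
  next
    case False
    have eq: "z = p * vexp (?L z)" using z(1) p by (simp add: char_kernel_def torus_def vexp_def vec_eq_iff)
    have "pairing x (?L z) = 0" if x: "x \<in> X" for x
    proof -
      have "expchar x z = 1" "expchar x p = 1" using z(1) assms(2) x by (auto simp: char_kernel_def)
      then have "exp (pairing x (?L z)) = 1" using eq by (metis expchar_mult expchar_vexp mult_1)
      then obtain n :: int where n: "pairing x (?L z) = two_pi_i * of_int n" unfolding exp_eq_1_two_pi_i by auto
      have "norm (pairing x (?L z)) < 1" using e(2)[OF False z(2)] x by auto
      then have "2 * pi * \<bar>of_int n\<bar> < 1" by (simp add: n norm_mult)
      moreover have "2 * pi * \<bar>of_int n :: real\<bar> \<ge> 1" if "n \<noteq> 0"
      proof -
        have "\<bar>of_int n :: real\<bar> \<ge> 1" using that by linarith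
        then show ?thesis using pi_ge_two mult_mono[of 1 "2 * pi" 1 "\<bar>of_int n :: real\<bar>"] by simp
      qed
      ultimately have "n = 0" by fastforce
      then show ?thesis using n by simp
    qed
    then show ?thesis using eq by blast
  qed
  then show ?thesis using e(1) by blast
qed

text \<open>Differing by the exponential of a vector orthogonal to \<open>X\<close> is an equivalence relation, and by
\<open>char_kernel_locally\<close> its classes are open.\<close>

lemma char_kernel_connected_subset:
  fixes X :: "(int^'d) set"
  assumes "finite X" "connected W" "W \<subseteq> char_kernel X" "p \<in> W" "z \<in> W"
  shows "\<exists>w. z = p * vexp w \<and> (\<forall>x\<in>X. pairing x w = 0)"
proof -
  let ?R = "\<lambda>p z. \<exists>w. z = p * vexp w \<and> (\<forall>x\<in>X. pairing x w = 0)"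
  show ?thesis
  proof (rule connected_equivalence_relation[OF assms(2,4,5), of ?R])
    fix x y assume "?R x y"
    then obtain w where w: "y = x * vexp w" "\<forall>x\<in>X. pairing x w = 0" by blast
    then have "x = y * vexp (- w)" using vexp_uminus_right[of w] by (simp add: mult.assoc)
    then show "?R y x" using w(2) by (intro exI[of _ "- w"]) (simp add: pairing_uminus_right)
  next
    fix x y z assume "?R x y" "?R y z"
    then obtain v w where "y = x * vexp v" "\<forall>x\<in>X. pairing x v = 0" "z = y * vexp w" "\<forall>x\<in>X. pairing x w = 0" by blast
    then show "?R x z" by (intro exI[of _ "v + w"]) (simp add: pairing_add_right vexp_add mult.assoc)
  next
    fix a assume a: "a \<in> W"
    then obtain e where e: "e > 0" "\<forall>z\<in>char_kernel X. dist z a < e \<longrightarrow> ?R a z"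
      using char_kernel_locally[OF assms(1), of a] assms(3) by blast
    show "\<exists>T. openin (top_of_set W) T \<and> a \<in> T \<and> (\<forall>x\<in>T. ?R a x)"
    proof (rule exI[of _ "W \<inter> ball a e"], intro conjI ballI)
      show "openin (top_of_set W) (W \<inter> ball a e)" by (rule openin_open_Int) simp
      show "a \<in> W \<inter> ball a e" using a e(1) by simp
      fix x assume "x \<in> W \<inter> ball a e"
      then show "?R a x" using e(2) assms(3) by (auto simp: dist_commute)
    qed
  qed
qed

text \<open>One inclusion is \<open>char_kernel_connected_subset\<close>; for the other, scaling \<open>w\<close> down to zero gives a
path inside the kernel.\<close>

lemma char_kernel_component:
  fixes X :: "(int^'d) set"
  assumes X: "finite X" and p: "p \<in> char_kernel X"
  shows "connected_component_set (char_kernel X) p = {p * vexp w | w. \<forall>x\<in>X. pairing x w = 0}"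
proof (intro equalityI subsetI)
  fix z assume z: "z \<in> connected_component_set (char_kernel X) p"
  show "z \<in> {p * vexp w | w. \<forall>x\<in>X. pairing x w = 0}"
    using char_kernel_connected_subset[OF X connected_connected_component connected_component_subset _ z] p by auto
next
  fix z assume "z \<in> {p * vexp w | w. \<forall>x\<in>X. pairing x w = 0}"
  then obtain w where w: "z = p * vexp w" "\<forall>x\<in>X. pairing x w = 0" by blast
  let ?g = "\<lambda>s::real. p * vexp (of_real s *s w)"
  have "?g = (\<lambda>s. \<chi> i. p $ i * exp (of_real s * w $ i))" by (simp add: vexp_def vec_eq_iff fun_eq_iff)
  moreover have "continuous_on {0..1} (\<lambda>s::real. \<chi> i. p $ i * exp (of_real s * w $ i))"
    by (intro continuous_intros)
  ultimately have "continuous_on {0..1} ?g" by (simp only:)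
  then have "connected (?g ` {0..1})" by (rule connected_continuous_image) simp
  moreover have "?g ` {0..1} \<subseteq> char_kernel X"
    using char_kernel_mult_vexp[OF p] w(2) by (auto simp: pairing_scale_right)
  moreover have "p \<in> ?g ` {0..1}" by (rule image_eqI[of _ _ 0]) simp_all
  moreover have "z \<in> ?g ` {0..1}" by (rule image_eqI[of _ _ 1]) (simp_all add: w(1))
  ultimately have "connected_component (char_kernel X) p z" by (rule connected_componentI)
  then show "z \<in> connected_component_set (char_kernel X) p" by simp
qed

lemma char_kernel_components:
  assumes "finite X" "W \<in> components (char_kernel X)" "p \<in> W"
  shows "W = {p * vexp w | w. \<forall>x\<in>X. pairing x w = 0}"
proof -
  have "p \<in> char_kernel X" using assms(2,3) in_components_subset by blast
  moreover have "W = connected_component_set (char_kernel X) p"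
    using assms(2,3) by (metis components_iff connected_component_eq)
  ultimately show ?thesis using char_kernel_component[OF assms(1)] by simp
qed

section \<open>Content of an integer vector\<close>

text \<open>Take for \<open>a\<close> the least positive value of the pairing with \<open>x\<close>. Having a vector \<open>b\<close> with
\<open>pairing y b = 1\<close> is the form of primitivity that is used everywhere below.\<close>

lemma int_vector_content:
  fixes x :: "int^'d"
  assumes "x \<noteq> 0"
  obtains a :: nat and y b :: "int^'d" where "a > 0" "x = int a *s y" "pairing y b = 1"
proof -
  have sq: "pairing x x > 0"
  proof -
    obtain i where "x $ i \<noteq> 0" using assms by (auto simp: vec_eq_iff)
    then have "0 < x $ i * x $ i" by (auto simp: zero_less_mult_iff linorder_neq_iff)
    also have "\<dots> \<le> (\<Sum>i\<in>UNIV. x $ i * x $ i)" by (intro member_le_sum) auto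
    finally show ?thesis by (simp add: pairing_def)
  qed
  define a where "a = (LEAST n::nat. n > 0 \<and> (\<exists>b. pairing x b = int n))"
  have "\<exists>n::nat. n > 0 \<and> (\<exists>b. pairing x b = int n)"
    using sq by (intro exI[of _ "nat (pairing x x)"]) auto
  then have a: "a > 0 \<and> (\<exists>b. pairing x b = int a)" unfolding a_def by (rule LeastI_ex)
  then obtain b where b: "pairing x b = int a" by blast
  have dvd: "int a dvd x $ i" for i
  proof (rule ccontr)
    assume "\<not> int a dvd x $ i"
    then have r: "x $ i mod int a > 0" using a by (metis mod_0_imp_dvd of_nat_0_less_iff order_le_less pos_mod_sign)
    have "pairing x (axis i 1 - (x $ i div int a) *s b) = x $ i mod int a"
      by (simp add: pairing_diff_right pairing_axis pairing_scale_right b minus_div_mult_eq_mod)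
    then have "nat (x $ i mod int a) > 0 \<and> (\<exists>b. pairing x b = int (nat (x $ i mod int a)))" using r by auto
    then have "a \<le> nat (x $ i mod int a)" by (subst a_def) (rule Least_le)
    moreover have "x $ i mod int a < int a" using a by simp
    ultimately show False using r by linarith
  qed
  define y where "y = (\<chi> i. x $ i div int a)"
  have x: "x = int a *s y" using dvd by (simp add: y_def vec_eq_iff)
  have "int a * pairing y b = int a" using b by (simp add: x pairing_scale_left)
  then have "pairing y b = 1" using a by simp
  with a x that show thesis by blast
qed

lemma primitive_char_pairing:
  fixes x :: "int^'d"
  assumes "primitive_char x" obtains b :: "int^'d" where "pairing x b = 1"
proof -
  have "x \<noteq> 0" using assms by (simp add: primitive_char_def)
  then obtain a :: nat and y b :: "int^'d" where *: "a > 0" "x = int a *s y" "pairing y b = 1"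
    by (rule int_vector_content)
  then have "\<bar>int a\<bar> = 1" using assms unfolding primitive_char_def by blast
  then have "x = y" using * by simp
  then have "pairing x b = 1" using *(3) by simp
  then show thesis by (rule that)
qed

lemma content_unique:
  fixes y y' b b' :: "int^'d"
  assumes "int a *s y = int a' *s y'" "pairing y b = 1" "pairing y' b' = (1::int)"
  shows "a = a'"
proof -
  have "int a * pairing y b' = int a'" "int a' * pairing y' b = int a"
    using arg_cong[OF assms(1), of "\<lambda>x. pairing x b'"] arg_cong[OF assms(1), of "\<lambda>x. pairing x b"] assms(2,3)
    by (simp_all add: pairing_scale_left)
  then have "int a dvd int a'" "int a' dvd int a" by (metis dvd_triv_left)+
  then show ?thesis by (simp add: dvd_antisym)
qed

text \<open>If \<open>expchar y\<close> takes the same value at two points, the logarithm \<open>w\<close> of their quotient has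
\<open>pairing y w\<close> in \<open>2 \<pi> \<i> \<int>\<close>, and subtracting a multiple of \<open>2 \<pi> \<i> b\<close> makes it orthogonal
to \<open>y\<close> without changing the point.\<close>

lemma char_kernel_single_component:
  fixes y b :: "int^'d"
  assumes a: "a > 0" and y: "pairing y b = 1" and u: "u \<in> char_kernel {int a *s y}"
  shows "connected_component_set (char_kernel {int a *s y}) u = {v \<in> torus. expchar y v = expchar y u}"
proof -
  have ut: "u \<in> torus" using u by (simp add: char_kernel_def)
  have "connected_component_set (char_kernel {int a *s y}) u = {u * vexp w | w. pairing y w = 0}"
    using char_kernel_component[OF _ u] a by (simp add: pairing_scale_left)
  also have "\<dots> = {v \<in> torus. expchar y v = expchar y u}"
  proof (intro equalityI subsetI)
    fix v assume "v \<in> {u * vexp w | w. pairing y w = 0}"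
    then show "v \<in> {v \<in> torus. expchar y v = expchar y u}" using ut by (auto simp: expchar_mult expchar_vexp)
  next
    fix v assume v: "v \<in> {v \<in> torus. expchar y v = expchar y u}"
    then obtain w where w: "v = u * vexp w" using torus_vexp_quotient[OF _ ut] by blast
    then have "exp (pairing y w) = 1" using v expchar_nonzero[OF ut, of y] by (simp add: expchar_mult expchar_vexp)
    then obtain n :: int where n: "pairing y w = two_pi_i * of_int n" unfolding exp_eq_1_two_pi_i by auto
    have "vexp w = vexp (w + two_pi_i *s ivec ((- n) *s b))" unfolding vexp_eq_iff
      by (intro exI[of _ "n *s b"]) (simp add: ivec_scale vec_eq_iff)
    moreover have "pairing y ((- n) *s b) = - n" by (simp only: pairing_scale_right y mult_1_right)
    then have "pairing y (w + two_pi_i *s ivec ((- n) *s b)) = 0"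
      by (simp only: pairing_add_right pairing_scale_right pairing_ivec n) simp
    moreover have "v = u * vexp (w + two_pi_i *s ivec ((- n) *s b))" using w calculation(1) by (simp only:)
    ultimately show "v \<in> {u * vexp w | w. pairing y w = 0}"
      by (intro CollectI exI[of _ "w + two_pi_i *s ivec ((- n) *s b)"] conjI)
  qed
  finally show ?thesis .
qed

text \<open>The components are the fibres of \<open>expchar y\<close> over the \<open>a\<close>-th roots of unity.\<close>

lemma card_components_char_kernel_single:
  fixes y b :: "int^'d"
  assumes a: "a > 0" and y: "pairing y b = 1"
  shows "card (components (char_kernel {int a *s y})) = a"
proof -
  let ?X = "char_kernel {int a *s y}"
  let ?c = "\<lambda>k::nat. vexp ((two_pi_i * of_nat k / of_nat a) *s ivec b)"
  have ec: "expchar y (?c k) = zeta a (int k)" for k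
    by (simp add: expchar_vexp pairing_scale_right pairing_ivec y zeta_def)
  have c: "?c k \<in> ?X" for k
    using zeta_eq_1[OF a] by (simp add: char_kernel_def expchar_scale_nat ec zeta_power)
  let ?F = "\<lambda>k. connected_component_set ?X (?c k)"
  have F: "?F k = {v \<in> torus. expchar y v = zeta a (int k)}" for k
    using char_kernel_single_component[OF a y c] by (simp add: ec)
  have "bij_betw ?F {..<a} (components ?X)"
  proof (rule bij_betw_imageI)
    show "inj_on ?F {..<a}"
    proof (rule inj_onI)
      fix k l assume kl: "k \<in> {..<a}" "l \<in> {..<a}" "?F k = ?F l"
      have "?c k \<in> ?F k" unfolding F by (simp add: ec)
      then have "?c k \<in> ?F l" by (simp only: kl(3))
      then have "zeta a (int k) = zeta a (int l)" unfolding F by (simp add: ec)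
      then have "zeta a (int k - int l) = 1"
        using zeta_add[of a "int k - int l" "int l"] by simp
      then have "int k mod int a = int l mod int a" using zeta_eq_1[OF a] by (simp add: mod_eq_dvd_iff)
      then show "k = l" using kl by simp
    qed
    show "?F ` {..<a} = components ?X"
    proof (intro equalityI subsetI)
      fix W assume "W \<in> ?F ` {..<a}"
      then show "W \<in> components ?X" using c by (auto simp: components_def)
    next
      fix W assume "W \<in> components ?X"
      then obtain u where u: "u \<in> ?X" and W: "W = connected_component_set ?X u" by (auto simp: components_def)
      then obtain w where w: "u = vexp w" using torus_vexp by (auto simp: char_kernel_def)
      have "exp (of_nat a * pairing y w) = 1"
        using u by (simp add: char_kernel_def w expchar_vexp pairing_scale_left)
      then obtain n :: int where n: "of_nat a * pairing y w = two_pi_i * of_int n" unfolding exp_eq_1_two_pi_i by auto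
      then have "pairing y w = two_pi_i * of_int n / of_nat a" using a by (simp add: field_simps)
      then have "expchar y u = zeta a n" by (simp add: w expchar_vexp zeta_def)
      also have "n = int (nat (n mod int a)) + int a * (n div int a)" using a by simp
      also have "zeta a \<dots> = zeta a (int (nat (n mod int a)))"
        unfolding zeta_add using zeta_eq_1[OF a] by simp
      finally have "W = ?F (nat (n mod int a))"
        unfolding W F char_kernel_single_component[OF a y u] by simp
      moreover have "nat (n mod int a) < a" using a by (simp add: nat_less_iff)
      ultimately show "W \<in> ?F ` {..<a}" by blast
    qed
  qed
  then show ?thesis using bij_betw_same_card by fastforce
qed

section \<open>Coverings as integer matrices\<close>

text \<open>The inverse of \<open>P\<close>, which has integer entries: its rows are the coordinates of the standard
characters in the basis of the larger lattice. In logarithmic coordinates \<open>cov_map P\<close> is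
multiplication by this matrix.\<close>

definition covmat :: "rat^'d^'d \<Rightarrow> int^'d^'d::finite" where
  "covmat P = (\<chi> i. THE n. ratvec n v* P = axis i 1)"

definition cmul :: "int^'d^'d \<Rightarrow> complex^'d \<Rightarrow> complex^'d::finite" where
  "cmul N w = (\<chi> i. pairing (N $ i) w)"

text \<open>The action of \<open>P\<close> on complex vectors, inverse to \<open>cmul (covmat P)\<close>.\<close>

definition rmul :: "rat^'d^'d \<Rightarrow> complex^'d \<Rightarrow> complex^'d::finite" where
  "rmul P w = (\<chi> i. \<Sum>j\<in>UNIV. of_rat (P $ i $ j) * w $ j)"

lemma ratvec_inject: "ratvec m = ratvec n \<longleftrightarrow> m = n"
  by (auto simp: ratvec_def vec_eq_iff)

lemma ratvec_scale: "ratvec (c *s x) = of_int c *s ratvec x" by (simp add: ratvec_def vec_eq_iff)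

lemma vector_matrix_mult_inject:
  fixes P :: "rat^'d^'d"
  assumes "invertible P" "v v* P = w v* P" shows "v = w"
proof -
  obtain Q where Q: "P ** Q = mat 1" using assms(1) unfolding invertible_def by blast
  have "(v v* P) v* Q = (w v* P) v* Q" using assms(2) by simp
  then show ?thesis unfolding vector_matrix_mul_assoc Q by simp
qed

lemma the_coordinates:
  assumes "is_covering P" "ratvec n v* P = l" shows "(THE n. ratvec n v* P = l) = n"
proof (rule the_equality)
  show "ratvec n v* P = l" by (rule assms(2))
  fix m assume "ratvec m v* P = l"
  then have "ratvec m v* P = ratvec n v* P" using assms(2) by simp
  then show "m = n"
    using vector_matrix_mult_inject[of P "ratvec m" "ratvec n"] assms(1) by (simp add: is_covering_def ratvec_inject)
qed

lemma cov_char_eq: "is_covering P \<Longrightarrow> ratvec n v* P = l \<Longrightarrow> cov_char P l u = expchar n u"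
  by (simp add: cov_char_def the_coordinates)

lemma covmat_row:
  assumes "is_covering P" shows "ratvec (covmat P $ i) v* P = axis i 1"
proof -
  have "axis i 1 = ratvec (axis i 1)" by (simp add: ratvec_def vec_eq_iff axis_def)
  then have "axis i 1 \<in> lattice_of P" using assms unfolding is_covering_def by auto
  then obtain n where n: "ratvec n v* P = axis i 1" by (auto simp: lattice_of_def)
  then show ?thesis by (simp add: covmat_def the_coordinates[OF assms n])
qed

lemma covmat_inverse:
  assumes "is_covering P"
  shows "(\<chi> i. ratvec (covmat P $ i)) ** P = mat 1" "P ** (\<chi> i. ratvec (covmat P $ i)) = mat 1"
proof -
  show 1: "(\<chi> i. ratvec (covmat P $ i)) ** P = mat 1"
  proof -
    have "((\<chi> i. ratvec (covmat P $ i)) ** P) $ i $ j = (ratvec (covmat P $ i) v* P) $ j" for i j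
      by (simp add: matrix_matrix_mult_def vector_matrix_mult_def)
    then show ?thesis by (simp add: covmat_row[OF assms] vec_eq_iff axis_def mat_def)
  qed
  then show "P ** (\<chi> i. ratvec (covmat P $ i)) = mat 1" by (simp add: matrix_left_right_inverse)
qed

lemma ratvec_covmat:
  assumes "is_covering P" shows "ratvec (x v* covmat P) v* P = ratvec x"
proof -
  have "ratvec (x v* covmat P) = ratvec x v* (\<chi> i. ratvec (covmat P $ i))"
    by (simp add: ratvec_def vec_eq_iff vector_matrix_mult_def)
  then show ?thesis by (simp only: vector_matrix_mul_assoc covmat_inverse(1)[OF assms] vector_matrix_mul_rid)
qed

lemma of_rat_matrix_action:
  fixes B :: "rat^'d^'d" and w :: "complex^'d"
  shows "(\<Sum>k\<in>UNIV. of_rat (a k) * (\<Sum>j\<in>UNIV. of_rat (B $ k $ j) * w $ j))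
    = (\<Sum>j\<in>UNIV. of_rat (\<Sum>k\<in>UNIV. a k * B $ k $ j) * w $ j)"
proof -
  have "(\<Sum>k\<in>UNIV. of_rat (a k) * (\<Sum>j\<in>UNIV. of_rat (B $ k $ j) * w $ j))
      = (\<Sum>k\<in>UNIV. \<Sum>j\<in>UNIV. of_rat (a k * B $ k $ j) * w $ j)"
    by (simp add: sum_distrib_left of_rat_mult mult.assoc)
  then show ?thesis by (subst (asm) sum.swap) (simp add: of_rat_sum sum_distrib_right)
qed

lemma of_rat_identity_action:
  "(\<Sum>j\<in>UNIV. of_rat ((mat 1 :: rat^'d^'d) $ i $ j) * w $ j) = (w :: complex^'d) $ i"
proof -
  have "(\<Sum>j\<in>UNIV. of_rat ((mat 1 :: rat^'d^'d) $ i $ j) * w $ j) = (\<Sum>j\<in>UNIV. if i = j then w $ j else 0)"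
    by (intro sum.cong refl) (auto simp: mat_def)
  then show ?thesis by simp
qed

lemma cmul_rmul: assumes "is_covering P" shows "cmul (covmat P) (rmul P w) = w"
proof -
  have "cmul (covmat P) (rmul P w) $ i = (\<Sum>j\<in>UNIV. of_rat (((\<chi> i. ratvec (covmat P $ i)) ** P) $ i $ j) * w $ j)" for i
    using of_rat_matrix_action[of "\<lambda>k. of_int (covmat P $ i $ k)" P w]
    by (simp add: cmul_def rmul_def pairing_def matrix_matrix_mult_def ratvec_def)
  then show ?thesis by (simp only: covmat_inverse(1)[OF assms] of_rat_identity_action vec_eq_iff simp_thms)
qed

lemma rmul_cmul: assumes "is_covering P" shows "rmul P (cmul (covmat P) w) = w"
proof -
  have "rmul P (cmul (covmat P) w) $ i = (\<Sum>j\<in>UNIV. of_rat ((P ** (\<chi> i. ratvec (covmat P $ i))) $ i $ j) * w $ j)" for i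
    using of_rat_matrix_action[of "\<lambda>k. P $ i $ k" "\<chi> i. ratvec (covmat P $ i)" w]
    by (simp add: cmul_def rmul_def pairing_def matrix_matrix_mult_def ratvec_def)
  then show ?thesis by (simp only: covmat_inverse(2)[OF assms] of_rat_identity_action vec_eq_iff simp_thms)
qed

lemma pairing_cmul: "pairing x (cmul N w) = pairing (x v* N) w"
  unfolding pairing_def cmul_def vector_matrix_mult_def vec_lambda_beta of_int_sum sum_distrib_left sum_distrib_right
  by (subst sum.swap) (simp add: mult_ac)

lemma rmul_scale: "rmul P (c *s w) = c *s rmul P w"
  by (simp add: rmul_def vec_eq_iff sum_distrib_left mult_ac)

lemma rmul_add: "rmul P (v + w) = rmul P v + rmul P w"
  by (simp add: rmul_def vec_eq_iff sum.distrib algebra_simps)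

lemma cmul_scale: "cmul N (c *s w) = c *s cmul N w"
  by (simp add: cmul_def vec_eq_iff pairing_scale_right)

lemma cov_map_eq:
  assumes "is_covering P" shows "cov_map P u = (\<chi> i. expchar (covmat P $ i) u)"
  by (simp add: cov_map_def vec_eq_iff cov_char_eq[OF assms covmat_row[OF assms]])

lemma vexp_nth: "vexp w $ i = exp (w $ i)" by (simp add: vexp_def)

lemma cov_map_vexp: assumes "is_covering P" shows "cov_map P (vexp w) = vexp (cmul (covmat P) w)"
  by (simp add: cov_map_eq[OF assms] vec_eq_iff expchar_vexp cmul_def vexp_nth)

lemma cov_map_mult: assumes "is_covering P" shows "cov_map P (u * v) = cov_map P u * cov_map P v"
  by (simp add: cov_map_eq[OF assms] vec_eq_iff expchar_mult)

lemma cov_map_torus: "is_covering P \<Longrightarrow> u \<in> torus \<Longrightarrow> cov_map P u \<in> torus"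
  using cov_map_vexp[of P] by (elim torus_vexp) simp

lemma expchar_cov_map: "is_covering P \<Longrightarrow> u \<in> torus \<Longrightarrow> expchar x (cov_map P u) = expchar (x v* covmat P) u"
  by (elim torus_vexp) (simp add: cov_map_vexp expchar_vexp pairing_cmul)

lemma cov_map_surj:
  assumes "is_covering P" "p \<in> torus" obtains q where "q \<in> torus" "cov_map P q = p"
proof -
  obtain w where "p = vexp w" using torus_vexp[OF assms(2)] .
  then have "cov_map P (vexp (rmul P w)) = p" by (simp add: cov_map_vexp[OF assms(1)] cmul_rmul[OF assms(1)])
  then show thesis using that[of "vexp (rmul P w)"] by simp
qed

section \<open>Roots of characters on a covering\<close>

text \<open>The primitive character \<open>\<chi> / a\<close> of the covering torus, in coordinates; \<open>theta P x\<close> is its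
exponential.\<close>

definition cov_root :: "rat^'d^'d \<Rightarrow> int^'d \<Rightarrow> int^'d::finite" where
  "cov_root P x = (SOME y. x v* covmat P = int (num_comp P x) *s y)"

lemma cov_fibre_hyp: "is_covering P \<Longrightarrow> cov_fibre P (hyp x) = char_kernel {x v* covmat P}"
  by (auto simp: cov_fibre_def hyp_def char_kernel_def cov_map_torus expchar_cov_map)

lemma cov_root:
  fixes x :: "int^'d::finite"
  assumes P: "is_covering P" and x: "x \<noteq> 0"
  shows "num_comp P x > 0" "x v* covmat P = int (num_comp P x) *s cov_root P x"
    "\<exists>b::int^'d. pairing (cov_root P x) b = 1"
proof -
  have "x v* covmat P \<noteq> 0"
  proof
    assume "x v* covmat P = 0"
    then have "ratvec x = 0" using ratvec_covmat[OF P, of x] by (simp add: ratvec_def vec_eq_iff vector_matrix_mult_def)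
    then show False using x by (simp add: ratvec_def vec_eq_iff)
  qed
  then obtain a :: nat and y b :: "int^'d" where a: "a > 0" and ay: "x v* covmat P = int a *s y" and y: "pairing y b = 1"
    by (rule int_vector_content)
  have "num_comp P x = a"
    unfolding num_comp_def cov_fibre_hyp[OF P] ay by (rule card_components_char_kernel_single[OF a y])
  then show "num_comp P x > 0" using a by simp
  have "\<exists>y. x v* covmat P = int (num_comp P x) *s y" using ay \<open>num_comp P x = a\<close> by blast
  then show r: "x v* covmat P = int (num_comp P x) *s cov_root P x"
    unfolding cov_root_def by (rule someI_ex)
  have "int a *s cov_root P x = int a *s y" using r ay \<open>num_comp P x = a\<close> by simp
  then have "cov_root P x = y" using a by (rule scale_cancel_int)
  then show "\<exists>b::int^'d. pairing (cov_root P x) b = 1" using y by blast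
qed

lemma theta_eq:
  fixes x :: "int^'d::finite"
  assumes P: "is_covering P" and x: "x \<noteq> 0"
  shows "theta P x = expchar (cov_root P x)"
proof -
  let ?a = "num_comp P x"
  have "ratvec x = of_nat ?a *s (ratvec (cov_root P x) v* P)"
    using ratvec_covmat[OF P, of x] unfolding cov_root(2)[OF P x] ratvec_scale by (simp add: scaleR_vector_matrix_assoc vector_matrix_mult_def vec_eq_iff sum_distrib_left mult_ac)
  then have "ratvec (cov_root P x) v* P = (1 / of_nat ?a) *s ratvec x"
    using cov_root(1)[OF P x] by (simp add: vec_eq_iff)
  then show ?thesis unfolding theta_def using cov_char_eq[OF P] by (intro ext) blast
qed

lemma cov_hyp_eq:
  fixes x :: "int^'d::finite"
  assumes P: "is_covering P" and x: "x \<noteq> 0" and q: "q \<in> cov_fibre P (hyp x)"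
  shows "cov_hyp P x q = {u \<in> torus. expchar (cov_root P x) u = expchar (cov_root P x) q}"
proof -
  obtain b :: "int^'d" where b: "pairing (cov_root P x) b = 1" using cov_root(3)[OF P x] by blast
  show ?thesis
    using char_kernel_single_component[OF cov_root(1)[OF P x] b] q
    unfolding cov_hyp_def cov_fibre_hyp[OF P] cov_root(2)[OF P x] by simp
qed

lemma pairing_cov_root:
  assumes P: "is_covering P" and x: "x \<noteq> 0"
  shows "of_nat (num_comp P x) * pairing (cov_root P x) w = pairing x (cmul (covmat P) w)"
  unfolding pairing_cmul cov_root(2)[OF P x] by (simp add: pairing_scale_left)

lemma pairing_cov_root_rmul:
  assumes P: "is_covering P" and x: "x \<noteq> 0"
  shows "pairing (cov_root P x) (rmul P w) = pairing x w / of_nat (num_comp P x)"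
  using pairing_cov_root[OF P x, of "rmul P w"] cov_root(1)[OF P x] by (simp add: cmul_rmul[OF P] field_simps)

lemma cov_hyp_inter_eq:
  assumes P: "is_covering P" and ne: "\<And>i. i \<in> A \<Longrightarrow> ch i \<noteq> 0"
    and q: "\<And>i. i \<in> A \<Longrightarrow> q i \<in> cov_fibre P (hyp (ch i))"
  shows "cov_hyp_inter P ch A q = {u \<in> torus. \<forall>i\<in>A. expchar (cov_root P (ch i)) u = expchar (cov_root P (ch i)) (q i)}"
  unfolding cov_hyp_inter_def using cov_hyp_eq[OF P ne q] by auto

text \<open>Choose \<open>q\<close> constant, over a point of the component. A point where all \<open>\<theta>\<^sub>i\<close> agree with their
values at \<open>q\<close> differs from \<open>q\<close> by the exponential of a vector \<open>w\<close> whose image pairs with \<open>\<chi>\<^sub>i\<close> to a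
value in \<open>2 \<pi> \<i> a\<^sub>i \<int>\<close>; an integer vector with the same pairings corrects it to be orthogonal to
all \<open>\<chi>\<^sub>i\<close>.\<close>

lemma attains_imp_separates:
  fixes ch :: "nat \<Rightarrow> int^'d::finite"
  assumes P: "is_covering P" and A: "finite A" and ne: "\<And>i. i \<in> A \<Longrightarrow> ch i \<noteq> 0"
    and att: "attains ch A (\<lambda>i. num_comp P (ch i))"
  shows "separates P ch A"
  unfolding separates_def hyp_inter_char_kernel
proof
  let ?y = "\<lambda>i. cov_root P (ch i)"
  fix W assume W: "W \<in> components (char_kernel (ch ` A))"
  obtain p where p: "p \<in> W" using in_components_nonempty[OF W] by blast
  have Weq: "W = {p * vexp w | w. \<forall>x\<in>ch ` A. pairing x w = 0}"
    by (rule char_kernel_components[OF _ W p]) (use A in simp)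
  have pc: "p \<in> char_kernel (ch ` A)" using in_components_subset[OF W] p by blast
  then have pt: "p \<in> torus" by (simp add: char_kernel_def)
  obtain q0 where q0: "q0 \<in> torus" "cov_map P q0 = p" using cov_map_surj[OF P pt] .
  have qf: "q0 \<in> cov_fibre P (hyp (ch i))" if "i \<in> A" for i
    using pc that q0 by (auto simp: cov_fibre_def hyp_def char_kernel_def)
  have I: "cov_hyp_inter P ch A (\<lambda>_. q0) = {u \<in> torus. \<forall>i\<in>A. expchar (?y i) u = expchar (?y i) q0}"
    by (rule cov_hyp_inter_eq[OF P ne qf])
  have "cov_map P ` {u \<in> torus. \<forall>i\<in>A. expchar (?y i) u = expchar (?y i) q0} = W"
  proof (intro equalityI subsetI)
    fix z assume "z \<in> cov_map P ` {u \<in> torus. \<forall>i\<in>A. expchar (?y i) u = expchar (?y i) q0}"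
    then obtain u where u: "z = cov_map P u" "u \<in> torus" "\<And>i. i \<in> A \<Longrightarrow> expchar (?y i) u = expchar (?y i) q0" by blast
    obtain w where w: "u = q0 * vexp w" using torus_vexp_quotient[OF u(2) q0(1)] .
    have "\<exists>n::int. pairing (?y i) w = two_pi_i * of_int n" if "i \<in> A" for i
    proof -
      have "expchar (?y i) q0 * exp (pairing (?y i) w) = expchar (?y i) q0"
        using u(3)[OF that] by (simp add: w expchar_mult expchar_vexp)
      then show ?thesis using expchar_nonzero[OF q0(1), of "?y i"] by (simp add: exp_eq_1_two_pi_i)
    qed
    then obtain n :: "nat \<Rightarrow> int" where n: "\<And>i. i \<in> A \<Longrightarrow> pairing (?y i) w = two_pi_i * of_int (n i)" by metis
    obtain b where b: "\<forall>i\<in>A. pairing (ch i) b = int (num_comp P (ch i)) * n i"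
      using att[unfolded attains_def, rule_format, of n] by blast
    let ?w = "cmul (covmat P) w + two_pi_i *s ivec (- b)"
    have "pairing (ch i) ?w = 0" if i: "i \<in> A" for i
    proof -
      have "pairing (ch i) (cmul (covmat P) w) = of_nat (num_comp P (ch i)) * (two_pi_i * of_int (n i))"
        using pairing_cov_root[OF P ne[OF i], of w] n[OF i] by simp
      moreover have "pairing (ch i) (two_pi_i *s ivec (- b) :: complex^'d) = - (two_pi_i * (of_nat (num_comp P (ch i)) * of_int (n i)))"
        using b i by (simp only: pairing_scale_right pairing_ivec pairing_uminus_right) simp
      ultimately show ?thesis by (simp only: pairing_add_right) simp
    qed
    moreover have "vexp ?w = vexp (cmul (covmat P) w)" unfolding vexp_eq_iff by blast
    then have "z = p * vexp ?w" using u(1) by (simp only: w cov_map_mult[OF P] cov_map_vexp[OF P] q0(2))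
    ultimately show "z \<in> W" unfolding Weq by (intro CollectI exI[of _ ?w]) simp
  next
    fix z assume "z \<in> W"
    then obtain w where w: "z = p * vexp w" "\<And>i. i \<in> A \<Longrightarrow> pairing (ch i) w = 0" unfolding Weq by auto
    have "z = cov_map P (q0 * vexp (rmul P w))"
      by (simp add: w(1) cov_map_mult[OF P] cov_map_vexp[OF P] cmul_rmul[OF P] q0(2))
    moreover have "q0 * vexp (rmul P w) \<in> {u \<in> torus. \<forall>i\<in>A. expchar (?y i) u = expchar (?y i) q0}"
      using q0(1) by (simp add: expchar_mult expchar_vexp pairing_cov_root_rmul[OF P ne] w(2))
    ultimately show "z \<in> cov_map P ` {u \<in> torus. \<forall>i\<in>A. expchar (?y i) u = expchar (?y i) q0}" by blast
  qed
  then show "\<exists>q. (\<forall>i\<in>A. q i \<in> cov_fibre P (hyp (ch i))) \<and> cov_map P ` cov_hyp_inter P ch A q = W"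
    using qf I by (intro exI[of _ "\<lambda>_. q0"]) simp
qed

text \<open>Use only the component of the identity. Given \<open>k\<close>, independence yields a complex vector \<open>w\<close> with
\<open>\<chi>\<^sub>i \<cdot> w = 2 \<pi> \<i> a\<^sub>i k\<^sub>i\<close>. On the covering all \<open>\<theta>\<^sub>i\<close> are one at its preimage, so
separation puts \<open>vexp w\<close> into that component: \<open>w\<close> differs from a vector orthogonal to the \<open>\<chi>\<^sub>i\<close> by
\<open>2 \<pi> \<i> b\<close>, and \<open>b\<close> is the required integer vector.\<close>

lemma separates_imp_attains:
  fixes ch :: "nat \<Rightarrow> int^'d::finite"
  assumes P: "is_covering P" and A: "finite A" and ind: "indep ch A" and ne: "\<And>i. i \<in> A \<Longrightarrow> ch i \<noteq> 0"
    and sep: "separates P ch A"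
  shows "attains ch A (\<lambda>i. num_comp P (ch i))"
  unfolding attains_def
proof
  fix k :: "nat \<Rightarrow> int"
  let ?y = "\<lambda>i. cov_root P (ch i)" and ?a = "\<lambda>i. num_comp P (ch i)"
  obtain N where N: "N > 0" "attains ch A (\<lambda>_. N)" using indep_attains[OF A ind] by blast
  have one: "1 \<in> char_kernel (ch ` A)" by (simp add: char_kernel_def)
  let ?W = "connected_component_set (char_kernel (ch ` A)) 1"
  have "?W \<in> components (hyp_inter ch A)" using one by (simp add: hyp_inter_char_kernel components_def)
  from sep[unfolded separates_def, THEN bspec, OF this]
  obtain q where qq: "(\<forall>i\<in>A. q i \<in> cov_fibre P (hyp (ch i))) \<and> cov_map P ` cov_hyp_inter P ch A q = ?W" ..
  have q: "q i \<in> cov_fibre P (hyp (ch i))" if "i \<in> A" for i using conjunct1[OF qq] that by (rule bspec)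
  note qW = conjunct2[OF qq]
  have Weq: "?W = {1 * vexp w | w. \<forall>x\<in>ch ` A. pairing x w = 0}"
    by (rule char_kernel_component[OF _ one]) (use A in simp)
  have I: "cov_hyp_inter P ch A q = {u \<in> torus. \<forall>i\<in>A. expchar (?y i) u = expchar (?y i) (q i)}"
    by (rule cov_hyp_inter_eq[OF P ne q])
  have "1 \<in> ?W" by (rule CollectI) (rule connected_component_refl[OF one])
  then have "1 \<in> cov_map P ` cov_hyp_inter P ch A q" by (simp only: qW)
  then obtain u where u: "cov_map P u = 1" "u \<in> cov_hyp_inter P ch A q" by (elim imageE) simp
  obtain b0 where b0: "\<forall>i\<in>A. pairing (ch i) b0 = int N * (int (?a i) * k i)"
    using N(2)[unfolded attains_def, rule_format, of "\<lambda>i. int (?a i) * k i"] by blast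
  define w :: "complex^'d" where "w = (two_pi_i / of_nat N) *s ivec b0"
  have pw: "pairing (ch i) w = two_pi_i * (of_nat (?a i) * of_int (k i))" if "i \<in> A" for i
    using b0 that N(1) by (simp add: w_def pairing_scale_right pairing_ivec)
  have "pairing (?y i) (rmul P w) = two_pi_i * of_int (k i)" if "i \<in> A" for i
    using pairing_cov_root_rmul[OF P ne[OF that], of w] cov_root(1)[OF P ne[OF that]] by (simp add: pw[OF that])
  then have "u * vexp (rmul P w) \<in> cov_hyp_inter P ch A q"
    using u(2) by (simp add: I expchar_mult expchar_vexp)
  then have "cov_map P (u * vexp (rmul P w)) \<in> ?W" using qW by blast
  then have "vexp w \<in> ?W" by (simp add: cov_map_mult[OF P] cov_map_vexp[OF P] cmul_rmul[OF P] u(1))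
  then obtain w0 where w0: "vexp w = vexp w0" "\<And>i. i \<in> A \<Longrightarrow> pairing (ch i) w0 = 0" unfolding Weq by auto
  then obtain b where b: "w = w0 + two_pi_i *s ivec b" unfolding vexp_eq_iff by blast
  have "pairing (ch i) b = int (?a i) * k i" if i: "i \<in> A" for i
  proof -
    have "two_pi_i * (of_nat (?a i) * of_int (k i)) = pairing (ch i) (w0 + two_pi_i *s ivec b)"
      using pw[OF i] b by simp
    also have "\<dots> = two_pi_i * of_int (pairing (ch i) b)"
      by (simp only: pairing_add_right w0(2)[OF i] pairing_scale_right pairing_ivec add_0_left)
    finally have "(of_int (pairing (ch i) b) :: complex) = of_int (int (?a i) * k i)" by simp
    then show ?thesis by (simp only: of_int_eq_iff)
  qed
  then show "\<exists>b. \<forall>i\<in>A. pairing (ch i) b = int (?a i) * k i" by blast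
qed

section \<open>Sums over fibres of a covering\<close>

text \<open>A parametrisation of the kernel of the covering map by integer vectors. With the minus sign,
dividing by a point of the kernel turns into multiplication by \<open>zeta\<close> in \<open>averaged_form\<close>.\<close>

definition deck :: "rat^'d^'d \<Rightarrow> int^'d \<Rightarrow> complex^'d::finite" where
  "deck P b = vexp (- two_pi_i *s rmul P (ivec b))"

lemma deck_add: "deck P (b + c) = deck P b * deck P c"
  by (simp add: deck_def ivec_add rmul_add vexp_add[symmetric] algebra_simps vector_add_ldistrib)

lemma deck_torus [simp]: "deck P b \<in> torus" by (simp add: deck_def)

lemma deck_0 [simp]: "deck P 0 = 1" by (simp add: deck_def rmul_def vexp_def vec_eq_iff)

lemma cov_map_deck: assumes P: "is_covering P" shows "cov_map P (deck P b) = 1"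
proof -
  have "cov_map P (deck P b) = vexp (- two_pi_i *s ivec b)"
    by (simp only: deck_def cov_map_vexp[OF P] cmul_scale cmul_rmul[OF P])
  also have "- two_pi_i *s ivec b = two_pi_i *s (ivec (- b) :: complex^'a)" by (simp add: ivec_uminus vec_eq_iff)
  also have "vexp \<dots> = 1" unfolding vexp_eq_1 by blast
  finally show ?thesis .
qed

lemma cov_fibre_deck:
  assumes P: "is_covering P" and q0: "q0 \<in> cov_fibre P {p}"
  shows "cov_fibre P {p} = range (\<lambda>b. q0 * deck P b)"
proof (intro equalityI subsetI)
  fix q assume q: "q \<in> cov_fibre P {p}"
  then obtain w where w: "q = q0 * vexp w" using torus_vexp_quotient q0 by (metis (no_types, lifting) cov_fibre_def mem_Collect_eq)
  have "cov_map P q0 * vexp (cmul (covmat P) w) = cov_map P q0 * 1"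
    using q q0 by (simp add: w cov_fibre_def cov_map_mult[OF P] cov_map_vexp[OF P])
  moreover have "cov_map P q0 \<in> torus" using q0 cov_map_torus[OF P, of q0] by (auto simp: cov_fibre_def)
  ultimately have "vexp (cmul (covmat P) w) = 1" using torus_mult_left_cancel by blast
  then obtain b where b: "cmul (covmat P) w = two_pi_i *s ivec b" unfolding vexp_eq_1 by blast
  have "w = rmul P (cmul (covmat P) w)" by (simp add: rmul_cmul[OF P])
  also have "\<dots> = - two_pi_i *s rmul P (ivec (- b))" unfolding b rmul_scale ivec_uminus
    by (simp add: vec_eq_iff rmul_def sum_negf)
  finally have "q = q0 * deck P (- b)" by (simp add: w deck_def)
  then show "q \<in> range (\<lambda>b. q0 * deck P b)" by blast
next
  fix q assume "q \<in> range (\<lambda>b. q0 * deck P b)"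
  then show "q \<in> cov_fibre P {p}" using q0 cov_map_deck[OF P] by (auto simp: cov_fibre_def cov_map_mult[OF P])
qed

lemma deck_periodic: "\<exists>M>0. periodic M (deck P)"
proof -
  have "finite (range (\<lambda>(i, j). P $ i $ j))" by simp
  from common_denominator[OF this] obtain M where M: "M > 0" "\<And>i j. \<exists>z. of_nat M * P $ i $ j = of_int z" by auto
  then obtain Z :: "'a \<Rightarrow> 'a \<Rightarrow> int" where Z: "\<And>i j. of_nat M * P $ i $ j = of_int (Z i j)" by metis
  have "deck P (int M *s c) = 1" for c
  proof -
    have "of_nat M * of_rat (P $ i $ j) = (of_int (Z i j) :: complex)" for i j
      using arg_cong[OF Z[of i j], of "of_rat :: rat \<Rightarrow> complex"] by (simp add: of_rat_mult)
    then have "of_rat (P $ i $ j) * (ivec (int M *s c) :: complex^'a) $ j = of_int (Z i j * c $ j)" for i j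
      by (simp add: ivec_def mult.assoc[symmetric] mult.commute[of "of_rat _" "of_nat M"])
    then have "rmul P (ivec (int M *s c)) = ivec (\<chi> i. \<Sum>j\<in>UNIV. Z i j * c $ j)"
      by (simp add: vec_eq_iff rmul_def) (simp add: ivec_def)
    then have "- two_pi_i *s rmul P (ivec (int M *s c)) = two_pi_i *s ivec (- (\<chi> i. \<Sum>j\<in>UNIV. Z i j * c $ j))"
      by (simp add: vec_eq_iff ivec_def)
    then show ?thesis unfolding deck_def vexp_eq_1 by blast
  qed
  then have "periodic M (deck P)" by (simp add: periodic_def deck_add)
  then show ?thesis using M(1) by blast
qed

text \<open>Average \<open>h (q * deck P b)\<close> over the fibre and over \<open>b\<close>: in either order the inner sum is
invariant under translation by the other variable. The number of vectors
\<open>b\<close> that give the same point cancels.\<close>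

lemma sum_cov_fibre:
  fixes h :: "complex^'d::finite \<Rightarrow> complex"
  assumes P: "is_covering P" and q0: "q0 \<in> cov_fibre P {p}" and M: "M > 0" "periodic M (deck P)"
  shows "finite (cov_fibre P {p})"
    and "(\<Sum>q\<in>cov_fibre P {p}. h q) = of_nat (card (cov_fibre P {p})) * mean M (\<lambda>b. h (q0 * deck P b))"
proof -
  let ?F = "cov_fibre P {p}"
  have F: "?F = range (\<lambda>b. q0 * deck P b)" by (rule cov_fibre_deck[OF P q0])
  have "?F \<subseteq> (\<lambda>b. q0 * deck P b) ` cube M"
  proof
    fix q assume "q \<in> ?F"
    then obtain b where b: "q = q0 * deck P b" unfolding F by blast
    have "q = q0 * deck P (\<chi> i. b $ i mod int M)" unfolding b periodic_mod[OF M(2)] ..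
    moreover have "(\<chi> i. b $ i mod int M) \<in> cube M" using M(1) by (simp add: cube_def)
    ultimately show "q \<in> (\<lambda>b. q0 * deck P b) ` cube M" by blast
  qed
  then show fin: "finite ?F" by (rule finite_subset) simp
  have 1: "(\<Sum>q\<in>?F. h (q * deck P b)) = (\<Sum>q\<in>?F. h q)" for b
  proof (rule sum.reindex_bij_witness[of _ "\<lambda>q. q * deck P (- b)" "\<lambda>q. q * deck P b"])
    have inv: "deck P b * deck P (- b) = 1" "deck P (- b) * deck P b = 1"
      unfolding deck_add[symmetric] by simp_all
    show "q * deck P b * deck P (- b) = q" "q * deck P (- b) * deck P b = q" for q by (simp_all add: mult.assoc inv)
    show "q * deck P c \<in> ?F" if "q \<in> ?F" for q c
      using that unfolding F by (auto simp: mult.assoc deck_add[symmetric])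
    then show "q * deck P (- b) \<in> ?F" if "q \<in> ?F" for q using that by blast
  qed simp
  have 2: "(\<Sum>b\<in>cube M. h (q * deck P b)) = (\<Sum>b\<in>cube M. h (q0 * deck P b))" if qF: "q \<in> ?F" for q
  proof -
    obtain c where c: "q = q0 * deck P c" using qF unfolding F by blast
    have "periodic M (\<lambda>b. h (q0 * deck P b))" using M(2) by (simp add: periodic_def)
    from sum_cube_shift[OF M(1) this, of c] show ?thesis by (simp add: c deck_add mult_ac)
  qed
  have "of_nat (card (cube M :: (int^'d) set)) * (\<Sum>q\<in>?F. h q) = (\<Sum>b\<in>cube M. \<Sum>q\<in>?F. h (q * deck P b))"
    by (simp add: 1)
  also have "\<dots> = (\<Sum>q\<in>?F. \<Sum>b\<in>cube M. h (q * deck P b))" by (rule sum.swap)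
  also have "\<dots> = of_nat (card ?F) * (\<Sum>b\<in>cube M. h (q0 * deck P b))" by (simp add: 2)
  finally show "(\<Sum>q\<in>?F. h q) = of_nat (card ?F) * mean M (\<lambda>b. h (q0 * deck P b))"
    using card_cube_pos[OF M(1), where 'd='d] by (auto simp: mean_def eq_divide_eq mult_ac card_gt_0_iff)
qed

lemma expchar_deck:
  assumes P: "is_covering P" and x: "x \<noteq> 0"
  shows "expchar (cov_root P x) (deck P b) = zeta (num_comp P x) (- pairing x b)"
proof -
  have "pairing (cov_root P x) (- two_pi_i *s rmul P (ivec b)) = - two_pi_i * (of_int (pairing x b) / of_nat (num_comp P x))"
    by (simp only: pairing_scale_right pairing_cov_root_rmul[OF P x] pairing_ivec)
  then show ?thesis by (simp add: deck_def expchar_vexp zeta_def)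
qed

section \<open>Means attached to a layer\<close>

text \<open>The factor \<open>exp (\<chi>\<^sub>i \<cdot> (w + 2 \<pi> \<i> b) / a\<^sub>i)\<close> is written as a product with a root of unity
to make the periodicity in \<open>b\<close> visible.\<close>

definition layer_mean :: "(nat \<Rightarrow> int^'d) \<Rightarrow> nat set \<Rightarrow> (nat \<Rightarrow> nat) \<Rightarrow> nat \<Rightarrow> complex^'d::finite \<Rightarrow> complex" where
  "layer_mean ch A a M w =
    mean M (\<lambda>b. \<Prod>i\<in>A. kappa (exp (pairing (ch i) w / of_nat (a i)) * zeta (a i) (pairing (ch i) b)))"

lemma zeta_periodic: assumes "m dvd M" "M > 0" shows "zeta m (k + int M * l) = zeta m k"
proof -
  have "m > 0" using assms by (auto intro: Nat.gr0I)
  moreover have "int m dvd int M * l" using assms(1) by simp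
  ultimately show ?thesis by (simp add: zeta_add zeta_eq_1)
qed

lemma periodic_layer:
  assumes "M > 0" "\<And>i. i \<in> A \<Longrightarrow> a i dvd M"
  shows "periodic M (\<lambda>b. \<Prod>i\<in>A. kappa (s i * zeta (a i) (pairing (ch i) b)))"
  unfolding periodic_def
  by (intro allI prod.cong refl) (simp add: pairing_add_right pairing_scale_right zeta_periodic[OF assms(2,1)])

lemma layer_mean_dvd:
  assumes "M > 0" "\<And>i. i \<in> A \<Longrightarrow> a i dvd M" "M dvd M'" "M' > 0"
  shows "layer_mean ch A a M' w = layer_mean ch A a M w"
  unfolding layer_mean_def by (rule mean_dvd[OF periodic_layer[OF assms(1,2)] assms(3,4)])

lemma layer_mean_cong:
  assumes "\<And>i. i \<in> A \<Longrightarrow> pairing (ch i) v = pairing (ch i) w"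
  shows "layer_mean ch A a M v = layer_mean ch A a M w"
  unfolding layer_mean_def by (intro mean_cong prod.cong refl) (simp add: assms)

text \<open>Another logarithm of the same point translates \<open>b\<close>.\<close>

lemma layer_mean_shift:
  assumes "M > 0" "\<And>i. i \<in> A \<Longrightarrow> a i dvd M"
  shows "layer_mean ch A a M (w + two_pi_i *s ivec c) = layer_mean ch A a M w"
proof -
  have "exp (pairing (ch i) (w + two_pi_i *s ivec c) / of_nat (a i)) = exp (pairing (ch i) w / of_nat (a i)) * zeta (a i) (pairing (ch i) c)" for i
    unfolding pairing_add_right pairing_scale_right pairing_ivec add_divide_distrib exp_add zeta_def by simp
  then have "layer_mean ch A a M (w + two_pi_i *s ivec c) =
    mean M (\<lambda>b. \<Prod>i\<in>A. kappa (exp (pairing (ch i) w / of_nat (a i)) * zeta (a i) (pairing (ch i) (b + c))))"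
    unfolding layer_mean_def by (simp add: pairing_add_right zeta_add mult_ac)
  also have "\<dots> = layer_mean ch A a M w"
    unfolding layer_mean_def by (rule mean_shift[OF assms(1) periodic_layer[OF assms]])
  finally show ?thesis .
qed

text \<open>By \<open>attains\<close>, translations of \<open>b\<close> multiply the \<open>i\<close>-th argument of \<open>\<kappa>\<close> by
arbitrary \<open>M / a\<^sub>i\<close>-th roots of unity, independently in each factor. Averaging over these
translations and applying the distribution relation of \<open>\<kappa>\<close> in each factor raises the argument
to the power \<open>M / a\<^sub>i\<close>.\<close>

lemma layer_mean_const:
  fixes ch :: "nat \<Rightarrow> int^'d::finite"
  assumes A: "finite A" and att: "attains ch A a" and M: "M > 0" and a: "\<And>i. i \<in> A \<Longrightarrow> a i dvd M"
    and ne: "\<And>i. i \<in> A \<Longrightarrow> exp (pairing (ch i) w) \<noteq> 1"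
  shows "layer_mean ch A (\<lambda>_. M) M w = layer_mean ch A a M w"
proof -
  let ?m = "\<lambda>i. M div a i"
  let ?s = "\<lambda>i b. exp (pairing (ch i) w / of_nat M) * zeta M (pairing (ch i) b)"
  let ?G = "\<lambda>b. \<Prod>i\<in>A. kappa (?s i b)"
  let ?I = "PiE A (\<lambda>i. {..<?m i})"
  have apos: "a i > 0" if "i \<in> A" for i using a[OF that] M by (auto intro: Nat.gr0I)
  have am: "a i * ?m i = M" if "i \<in> A" for i using a[OF that] by simp
  have mpos: "?m i > 0" if "i \<in> A" for i using am[OF that] M by (auto intro: Nat.gr0I)
  have "\<exists>b. \<forall>i\<in>A. pairing (ch i) b = int (a i) * int (n i)" for n :: "nat \<Rightarrow> nat"
    using att[unfolded attains_def, rule_format, of "\<lambda>i. int (n i)"] .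
  then obtain B where B: "\<And>n i. i \<in> A \<Longrightarrow> pairing (ch i) (B n) = int (a i) * int (n i)" by metis
  have pow: "?s i b ^ ?m i = exp (pairing (ch i) w / of_nat (a i)) * zeta (a i) (pairing (ch i) b)" if i: "i \<in> A" for i b
  proof -
    have "of_nat (?m i) * (pairing (ch i) w / of_nat M) = pairing (ch i) w / of_nat (a i)"
    proof -
      have "(of_nat M :: complex) = of_nat (a i) * of_nat (?m i)" using am[OF i] by (metis of_nat_mult)
      then show ?thesis using mpos[OF i] apos[OF i] by simp
    qed
    then have "exp (pairing (ch i) w / of_nat M) ^ ?m i = exp (pairing (ch i) w / of_nat (a i))"
      by (metis exp_of_nat_mult)
    moreover have "zeta M (pairing (ch i) b) ^ ?m i = zeta (a i) (pairing (ch i) b)"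
      by (simp only: zeta_power zeta_mult_cancel[OF a[OF i] M])
    ultimately show ?thesis by (simp only: power_mult_distrib)
  qed
  have ne1: "?s i b ^ ?m i \<noteq> 1" if i: "i \<in> A" for i b
  proof
    assume "?s i b ^ ?m i = 1"
    then have "(exp (pairing (ch i) w / of_nat (a i)) * zeta (a i) (pairing (ch i) b)) ^ a i = 1" by (simp only: pow[OF i] power_one)
    then show False using ne[OF i] by (simp only: exp_zeta_power[OF apos[OF i]])
  qed
  have cardI: "(of_nat (card ?I) :: complex) = (\<Prod>i\<in>A. of_nat (?m i))" using A by (simp add: card_PiE)
  have nz: "(\<Prod>i\<in>A. of_nat (?m i) :: complex) \<noteq> 0" using A mpos by (simp add: prod_zero_iff)
  have per: "periodic M ?G" by (rule periodic_layer[OF M]) simp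
  \<comment> \<open>\<open>B n\<close> translates the \<open>i\<close>-th argument by the root of unity with index \<open>n i\<close>.\<close>
  have key: "(\<Sum>n\<in>?I. ?G (b + B n)) = (\<Prod>i\<in>A. of_nat (?m i)) *
      (\<Prod>i\<in>A. kappa (exp (pairing (ch i) w / of_nat (a i)) * zeta (a i) (pairing (ch i) b)))" for b
  proof -
    have "?s i (b + B n) = ?s i b * zeta (?m i) (int (n i))" if i: "i \<in> A" for i n
    proof -
      have "M div ?m i = a i" using am[OF i] mpos[OF i] by (metis div_mult_self_is_m)
      moreover have "?m i dvd M" by (rule dvdI[of _ _ "a i"]) (simp add: am[OF i] mult.commute)
      ultimately have "zeta M (int (a i) * int (n i)) = zeta (?m i) (int (n i))"
        using zeta_mult_cancel[of "?m i" M "int (n i)"] M by simp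
      then show ?thesis by (simp add: pairing_add_right B[OF i] zeta_add)
    qed
    then have "(\<Sum>n\<in>?I. ?G (b + B n)) = (\<Sum>n\<in>?I. \<Prod>i\<in>A. kappa (?s i b * zeta (?m i) (int (n i))))"
      by (intro sum.cong prod.cong refl) (simp add: mult.assoc)
    also have "\<dots> = (\<Prod>i\<in>A. \<Sum>n<?m i. kappa (?s i b * zeta (?m i) (int n)))"
      by (rule prod_sum_PiE[symmetric]) (use A in auto)
    also have "\<dots> = (\<Prod>i\<in>A. of_nat (?m i) * kappa (?s i b ^ ?m i))"
      by (intro prod.cong refl kappa_distribution mpos ne1)
    also have "\<dots> = (\<Prod>i\<in>A. of_nat (?m i)) * (\<Prod>i\<in>A. kappa (?s i b ^ ?m i))" by (rule prod.distrib)
    also have "(\<Prod>i\<in>A. kappa (?s i b ^ ?m i)) = (\<Prod>i\<in>A. kappa (exp (pairing (ch i) w / of_nat (a i)) * zeta (a i) (pairing (ch i) b)))"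
      by (intro prod.cong refl) (simp only: pow)
    finally show ?thesis .
  qed
  have "of_nat (card ?I) * mean M ?G = (\<Sum>n\<in>?I. mean M (\<lambda>b. ?G (b + B n)))"
    by (simp only: mean_shift[OF M per] sum_constant)
  also have "\<dots> = mean M (\<lambda>b. \<Sum>n\<in>?I. ?G (b + B n))" by (rule mean_sum[symmetric])
  also have "\<dots> = (\<Prod>i\<in>A. of_nat (?m i)) * layer_mean ch A a M w"
    unfolding key layer_mean_def by (rule mean_scale)
  finally have "(\<Prod>i\<in>A. of_nat (?m i)) * layer_mean ch A (\<lambda>_. M) M w = (\<Prod>i\<in>A. of_nat (?m i)) * layer_mean ch A a M w"
    unfolding cardI layer_mean_def .
  then show ?thesis by (rule mult_left_cancel[OF nz, THEN iffD1])
qed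

text \<open>Both sides equal the mean with the common denominator \<open>M * M'\<close>.\<close>

lemma layer_mean_unique:
  fixes ch :: "nat \<Rightarrow> int^'d::finite"
  assumes A: "finite A" and ne: "\<And>i. i \<in> A \<Longrightarrow> exp (pairing (ch i) w) \<noteq> 1"
    and a: "attains ch A a" "M > 0" "\<And>i. i \<in> A \<Longrightarrow> a i dvd M"
    and a': "attains ch A a'" "M' > 0" "\<And>i. i \<in> A \<Longrightarrow> a' i dvd M'"
  shows "layer_mean ch A a M w = layer_mean ch A a' M' w"
proof -
  have pos: "M * M' > 0" using a(2) a'(2) by simp
  have "layer_mean ch A a M w = layer_mean ch A a (M * M') w"
    by (rule layer_mean_dvd[symmetric, OF a(2,3)]) (use pos in simp_all)
  also have "\<dots> = layer_mean ch A (\<lambda>_. M * M') (M * M') w"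
    by (rule layer_mean_const[symmetric, OF A a(1) pos _ ne]) (use a(3) in \<open>auto intro: dvd_mult2\<close>)
  also have "\<dots> = layer_mean ch A a' (M * M') w"
    by (rule layer_mean_const[OF A a'(1) pos _ ne]) (use a'(3) in \<open>auto intro: dvd_mult\<close>)
  also have "\<dots> = layer_mean ch A a' M' w"
    by (rule layer_mean_dvd[OF a'(2,3)]) (use pos in simp_all)
  finally show ?thesis .
qed

section \<open>Forms on a covering and their averages\<close>

lemma has_derivative_cov_map:
  assumes P: "is_covering P" and u: "u \<in> torus"
  shows "(cov_map P has_derivative (\<lambda>v. cov_map P u * cmul (covmat P) (vdiv v u))) (at u)"
proof -
  have "(cov_map P has_derivative (\<lambda>v. cov_map P u * cmul (covmat P) (vdiv v u))) (at u within UNIV)"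
  proof (rule has_derivative_componentwise_within[THEN iffD2], rule ballI)
    fix b :: "complex^'a" assume "b \<in> Basis"
    then obtain i c where b: "b = axis i c" "c \<in> Basis" by (auto simp: Basis_vec_def)
    have "((\<lambda>u. expchar (covmat P $ i) u \<bullet> c) has_derivative (\<lambda>v. (expchar (covmat P $ i) u * pairing (covmat P $ i) (vdiv v u)) \<bullet> c)) (at u)"
      by (rule has_derivative_inner_left[OF has_derivative_expchar[OF u]])
    then show "((\<lambda>x. cov_map P x \<bullet> b) has_derivative (\<lambda>x. (cov_map P u * cmul (covmat P) (vdiv x u)) \<bullet> b)) (at u within UNIV)"
      by (simp add: b(1) inner_axis cov_map_eq[OF P] cmul_def)
  qed
  then show ?thesis by simp
qed

lemma frechet_derivative_cov_map:
  assumes P: "is_covering P" and u: "u \<in> torus"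
  shows "frechet_derivative (cov_map P) (at u) = (\<lambda>v. cov_map P u * cmul (covmat P) (vdiv v u))"
  by (rule frechet_derivative_at[OF has_derivative_cov_map[OF assms], symmetric])

lemma surj_frechet_derivative_cov_map:
  assumes P: "is_covering P" and u: "u \<in> torus"
  shows "surj (frechet_derivative (cov_map P) (at u))"
proof -
  have f: "cov_map P u \<in> torus" by (rule cov_map_torus[OF assms])
  have "t = frechet_derivative (cov_map P) (at u) (u * rmul P (vdiv t (cov_map P u)))" for t
  proof -
    have "vdiv (u * rmul P (vdiv t (cov_map P u))) u = rmul P (vdiv t (cov_map P u))"
      using u by (simp add: vdiv_def torus_def vec_eq_iff)
    moreover have "cov_map P u * vdiv t (cov_map P u) = t" using f by (simp add: vdiv_def torus_def vec_eq_iff)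
    ultimately show ?thesis by (simp add: frechet_derivative_cov_map[OF assms] cmul_rmul[OF P])
  qed
  then show ?thesis by (rule surjI[of _ "\<lambda>t. u * rmul P (vdiv t (cov_map P u))", OF sym])
qed

lemma pullback_psi:
  assumes P: "is_covering P" and u: "u \<in> torus"
  shows "pullback (cov_map P) (psi ch i) u vs = (case vs of [v] \<Rightarrow> pairing (ch i v* covmat P) (vdiv v u) / two_pi_i | _ \<Rightarrow> 0)"
proof -
  have f: "cov_map P u \<in> torus" by (rule cov_map_torus[OF assms])
  then have "vdiv (cov_map P u * w) (cov_map P u) = w" for w by (simp add: vdiv_def torus_def vec_eq_iff)
  then show ?thesis
    by (simp add: pullback_def psi_eq[OF f] frechet_derivative_cov_map[OF assms] pairing_cmul split: list.splits)
qed

text \<open>With \<open>t = \<theta>\<^sub>i / \<theta>\<^sub>i(q)\<close> this is \<open>2 dlog (1 - t) - dlog t = \<kappa>(t) dlog t\<close>, where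
\<open>dlog t\<close> is the pullback of \<open>dlog (expchar (ch i))\<close> divided by \<open>a\<^sub>i\<close>.\<close>

lemma omega_bar_cov_eq:
  fixes ch :: "nat \<Rightarrow> int^'d::finite"
  assumes P: "is_covering P" and ne: "ch i \<noteq> 0" and u: "u \<in> torus" and q: "q \<in> torus"
    and uq: "expchar (cov_root P (ch i)) u \<noteq> expchar (cov_root P (ch i)) q"
  shows "omega_bar_cov P ch i q u vs =
    kappa (expchar (cov_root P (ch i)) u / expchar (cov_root P (ch i)) q) / of_nat (num_comp P (ch i))
      * pullback (cov_map P) (psi ch i) u vs"
proof -
  let ?y = "cov_root P (ch i)" and ?a = "num_comp P (ch i)"
  let ?s = "expchar ?y q"
  let ?t = "expchar ?y u / ?s"
  have s: "?s \<noteq> 0" by (rule expchar_nonzero[OF q])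
  have t: "?t \<noteq> 1" using uq s by simp
  have a: "?a > 0" by (rule cov_root(1)[OF P ne])
  have d: "((\<lambda>w. 1 - inverse ?s * expchar ?y w) has_derivative (\<lambda>v. 0 - inverse ?s * (expchar ?y u * pairing ?y (vdiv v u)))) (at u)"
    by (intro has_derivative_diff has_derivative_const has_derivative_mult_right has_derivative_expchar[OF u])
  have fd: "frechet_derivative (\<lambda>w. 1 - inverse ?s * expchar ?y w) (at u) v = - ?t * pairing ?y (vdiv v u)" for v
    using fun_cong[OF frechet_derivative_at[OF d, symmetric], of v] by (simp add: divide_inverse mult_ac)
  have o: "omega_cov P ch i q u vs = (case vs of [v] \<Rightarrow> (?t / (?t - 1)) * (pairing ?y (vdiv v u) / two_pi_i) | _ \<Rightarrow> 0)"
  proof -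
    have e: "- ?t / (1 - inverse ?s * expchar ?y u) = ?t / (?t - 1)"
      by (simp add: divide_inverse[of "expchar ?y u"] mult.commute) (metis minus_diff_eq minus_divide_right)
    have "- ?t * p / (1 - inverse ?s * expchar ?y u) = (?t / (?t - 1)) * p" for p
      using e by (metis times_divide_eq_left mult.commute)
    then show ?thesis
      by (auto simp: omega_cov_def dlog_def theta_eq[OF P ne] fd split: list.splits)
  qed
  have p: "pullback (cov_map P) (psi ch i) u vs = (case vs of [v] \<Rightarrow> of_nat ?a * (pairing ?y (vdiv v u) / two_pi_i) | _ \<Rightarrow> 0)"
    unfolding pullback_psi[OF P u] cov_root(2)[OF P ne] by (auto simp: pairing_scale_left split: list.splits)
  have k: "kappa ?t = 2 * (?t / (?t - 1)) - 1" using t by (simp add: kappa_def field_simps)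
  have e: "2 * (x * p) - 1 / of_nat ?a * (of_nat ?a * p) = (2 * x - 1) / of_nat ?a * (of_nat ?a * p)" for x p :: complex
  proof -
    have "1 / of_nat ?a * (of_nat ?a * p) = p" "(2 * x - 1) / of_nat ?a * (of_nat ?a * p) = (2 * x - 1) * p"
      using a by simp_all
    then show ?thesis by (simp only: left_diff_distrib mult.assoc mult_1_left)
  qed
  show ?thesis
  proof (cases "\<exists>v. vs = [v]")
    case True
    then obtain v where v: "vs = [v]" ..
    show ?thesis unfolding omega_bar_cov_def psi_cov_def o p k unfolding v list.case by (rule e)
  next
    case False
    then show ?thesis unfolding omega_bar_cov_def psi_cov_def o p by (auto split: list.splits)
  qed
qed

lemma omega_bar_cov_set_eq:
  fixes ch :: "nat \<Rightarrow> int^'d::finite"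
  assumes P: "is_covering P" and A: "finite A" and ne: "\<And>i. i \<in> A \<Longrightarrow> ch i \<noteq> 0" and u: "u \<in> torus" and q: "q \<in> torus"
    and uq: "\<And>i. i \<in> A \<Longrightarrow> expchar (cov_root P (ch i)) u \<noteq> expchar (cov_root P (ch i)) q"
  shows "omega_bar_cov_set P ch A q u vs =
    (\<Prod>i\<in>A. kappa (expchar (cov_root P (ch i)) u / expchar (cov_root P (ch i)) q) / of_nat (num_comp P (ch i)))
      * pullback (cov_map P) (psi_set ch A) u vs"
proof -
  have "omega_bar_cov_set P ch A q u = (\<lambda>vs. (\<Prod>i\<in>A. kappa (expchar (cov_root P (ch i)) u / expchar (cov_root P (ch i)) q) / of_nat (num_comp P (ch i)))
      * ext_prod (\<lambda>i. pullback (cov_map P) (psi ch i) u) A vs)"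
    unfolding omega_bar_cov_set_def
    using omega_bar_cov_eq[OF P ne u q uq] by (intro ext_prod_scale[OF A] ext)
  moreover have "pullback (cov_map P) (psi_set ch A) u = ext_prod (\<lambda>i. pullback (cov_map P) (psi ch i) u) A"
    unfolding pullback_def[abs_def] psi_set_def by (intro ext ext_prod_map A)
  ultimately show ?thesis by simp
qed

text \<open>The sum over the fibre and the cardinality in front of it both become means over integer vectors:
the sum gives \<open>layer_mean\<close>, and the cardinality gives the density of \<open>{b. \<forall>i. a\<^sub>i dvd \<chi>\<^sub>i \<cdot> b}\<close>,
which is \<open>m(A) / \<Prod>\<^sub>i a\<^sub>i\<close> by \<open>arith_mult_mean\<close>. The size of the fibre and the product of the
\<open>a\<^sub>i\<close> cancel.\<close>

lemma averaged_form:
  fixes ch :: "nat \<Rightarrow> int^'d::finite"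
  assumes P: "is_covering P" and A: "finite A" and ne: "\<And>i. i \<in> A \<Longrightarrow> ch i \<noteq> 0"
    and att: "attains ch A (\<lambda>i. num_comp P (ch i))"
    and p: "p \<in> hyp_inter ch A" and q0: "q0 \<in> cov_fibre P {p}"
    and u: "u \<in> torus" and z: "cov_map P u = p * vexp w" "\<And>i. i \<in> A \<Longrightarrow> expchar (ch i) (cov_map P u) \<noteq> 1"
  obtains M where "M > 0" "\<And>i. i \<in> A \<Longrightarrow> num_comp P (ch i) dvd M"
    "\<And>vs. 1 / of_nat (card (cov_hyp_inter P ch A (\<lambda>_. q0) \<inter> cov_fibre P {p}))
            * (\<Sum>q\<in>cov_fibre P {p}. omega_bar_cov_set P ch A q u vs)
      = layer_mean ch A (\<lambda>i. num_comp P (ch i)) M w / of_nat (arith_mult ch A) * pullback (cov_map P) (psi_set ch A) u vs"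
proof -
  let ?y = "\<lambda>i. cov_root P (ch i)" and ?a = "\<lambda>i. num_comp P (ch i)"
  let ?F = "cov_fibre P {p}"
  obtain M0 where M0: "M0 > 0" "periodic M0 (deck P)" using deck_periodic by blast
  define M where "M = M0 * (\<Prod>i\<in>A. ?a i)"
  have apos: "?a i > 0" if "i \<in> A" for i by (rule cov_root(1)[OF P ne[OF that]])
  have M: "M > 0" using M0(1) A apos by (simp add: M_def)
  have aM: "?a i dvd M" if "i \<in> A" for i unfolding M_def using A that by (intro dvd_mult dvd_prodI)
  have per: "periodic M (deck P)" unfolding periodic_def
  proof (intro allI)
    fix b c show "deck P (b + int M *s c) = deck P b"
      using periodicD[OF M0(2), of b "int (\<Prod>i\<in>A. ?a i) *s c"] by (simp add: M_def vector_smult_assoc)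
  qed
  have q0t: "q0 \<in> torus" "cov_map P q0 = p" using q0 by (auto simp: cov_fibre_def)
  have pt: "p \<in> torus" using q0t cov_map_torus[OF P] by blast
  have fin: "finite ?F" by (rule sum_cov_fibre(1)[OF P q0 M per])
  have avg: "(\<Sum>q\<in>?F. h q) = of_nat (card ?F) * mean M (\<lambda>b. h (q0 * deck P b))" for h
    by (rule sum_cov_fibre(2)[OF P q0 M per])
  have Fne: "(of_nat (card ?F) :: complex) \<noteq> 0" using fin q0 by auto
  have qf: "q0 \<in> cov_fibre P (hyp (ch i))" if "i \<in> A" for i
    using p that q0t pt by (auto simp: cov_fibre_def hyp_inter_def)
  have I: "cov_hyp_inter P ch A (\<lambda>_. q0) = {u \<in> torus. \<forall>i\<in>A. expchar (?y i) u = expchar (?y i) q0}"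
    by (rule cov_hyp_inter_eq[OF P ne qf])
  have yk: "expchar (?y i) (q0 * deck P b) = expchar (?y i) q0 * zeta (?a i) (- pairing (ch i) b)" if "i \<in> A" for i b
    by (simp add: expchar_mult expchar_deck[OF P ne[OF that]])
  have card: "of_nat (card (cov_hyp_inter P ch A (\<lambda>_. q0) \<inter> ?F)) * (\<Prod>i\<in>A. of_nat (?a i)) = (of_nat (card ?F) * of_nat (arith_mult ch A) :: complex)"
  proof -
    let ?I = "\<lambda>b. if \<forall>i\<in>A. int (?a i) dvd pairing (ch i) b then 1 else 0 :: complex"
    have "(of_nat (card (cov_hyp_inter P ch A (\<lambda>_. q0) \<inter> ?F)) :: complex)
        = (\<Sum>q\<in>?F. if \<forall>i\<in>A. expchar (?y i) q = expchar (?y i) q0 then 1 else 0)"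
    proof -
      have "cov_hyp_inter P ch A (\<lambda>_. q0) \<inter> ?F = ?F \<inter> {q. \<forall>i\<in>A. expchar (?y i) q = expchar (?y i) q0}"
        unfolding I by (auto simp: cov_fibre_def)
      then show ?thesis using fin by (simp add: sum.If_cases)
    qed
    also have "\<dots> = of_nat (card ?F) * mean M (\<lambda>b. if \<forall>i\<in>A. expchar (?y i) (q0 * deck P b) = expchar (?y i) q0 then 1 else 0)"
      by (rule avg)
    also have "(\<lambda>b. if \<forall>i\<in>A. expchar (?y i) (q0 * deck P b) = expchar (?y i) q0 then 1 else 0 :: complex)
        = ?I"
    proof -
      have "expchar (?y i) (q0 * deck P b) = expchar (?y i) q0 \<longleftrightarrow> int (?a i) dvd pairing (ch i) b" if "i \<in> A" for i b
        unfolding yk[OF that] using expchar_nonzero[OF q0t(1), of "?y i"] zeta_eq_1[OF apos[OF that]] by simp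
      then have "(\<forall>i\<in>A. expchar (?y i) (q0 * deck P b) = expchar (?y i) q0) \<longleftrightarrow> (\<forall>i\<in>A. int (?a i) dvd pairing (ch i) b)" for b
        by (intro ball_cong refl)
      then show ?thesis by (simp only:)
    qed
    finally have c: "(of_nat (card (cov_hyp_inter P ch A (\<lambda>_. q0) \<inter> ?F)) :: complex) = of_nat (card ?F) * mean M ?I" .
    have "(of_nat (arith_mult ch A) :: complex) = (\<Prod>i\<in>A. of_nat (?a i)) * mean M ?I"
      by (rule arith_mult_mean[OF A att M aM])
    then show ?thesis unfolding c by (simp only: mult_ac)
  qed
  obtain w' where w': "u = q0 * vexp w'" using torus_vexp_quotient[OF u q0t(1)] .
  have "p * vexp (cmul (covmat P) w') = p * vexp w"
    using z(1) by (simp add: w' cov_map_mult[OF P] q0t(2) cov_map_vexp[OF P])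
  then have "vexp (cmul (covmat P) w') = vexp w" using torus_mult_left_cancel[OF pt] by blast
  then obtain c where c: "cmul (covmat P) w' = w + two_pi_i *s ivec c" unfolding vexp_eq_iff by blast
  have yu: "expchar (?y i) u = expchar (?y i) q0 * exp (pairing (ch i) (cmul (covmat P) w') / of_nat (?a i))" if "i \<in> A" for i
  proof -
    have "pairing (?y i) w' = pairing (ch i) (cmul (covmat P) w') / of_nat (?a i)"
      using pairing_cov_root[OF P ne[OF that], of w'] apos[OF that] by (simp add: eq_divide_eq mult.commute)
    then show ?thesis by (simp only: w' expchar_mult expchar_vexp)
  qed
  have ratio: "expchar (?y i) u / expchar (?y i) (q0 * deck P b)
      = exp (pairing (ch i) (cmul (covmat P) w') / of_nat (?a i)) * zeta (?a i) (pairing (ch i) b)" if "i \<in> A" for i b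
  proof -
    have "zeta (?a i) (- pairing (ch i) b) * zeta (?a i) (pairing (ch i) b) = 1"
      unfolding zeta_add[symmetric] by (simp add: zeta_def)
    then show ?thesis unfolding yu[OF that] yk[OF that] using expchar_nonzero[OF q0t(1), of "?y i"]
      by (simp add: field_simps)
  qed
  have neq: "expchar (?y i) u \<noteq> expchar (?y i) q" if i: "i \<in> A" and q: "q \<in> ?F" for i q
  proof
    assume eq: "expchar (?y i) u = expchar (?y i) q"
    have qt: "q \<in> torus" "cov_map P q = p" using q by (auto simp: cov_fibre_def)
    have "expchar (ch i) (cov_map P v) = expchar (?y i) v ^ ?a i" if "v \<in> torus" for v
      unfolding expchar_cov_map[OF P that] cov_root(2)[OF P ne[OF i]] by (rule expchar_scale_nat[OF that])
    then have "expchar (ch i) (cov_map P u) = expchar (ch i) p" using u qt eq by metis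
    moreover have "expchar (ch i) p = 1" using p i by (simp add: hyp_inter_def hyp_def)
    ultimately show False using z(2)[OF i] by simp
  qed
  show thesis
  proof (rule that[OF M aM])
    fix vs
    let ?\<psi> = "pullback (cov_map P) (psi_set ch A) u vs"
    have "(\<Sum>q\<in>?F. omega_bar_cov_set P ch A q u vs)
        = (\<Sum>q\<in>?F. (\<Prod>i\<in>A. kappa (expchar (?y i) u / expchar (?y i) q) / of_nat (?a i)) * ?\<psi>)"
      by (intro sum.cong refl omega_bar_cov_set_eq[OF P A ne u _ neq]) (auto simp: cov_fibre_def)
    also have "\<dots> = of_nat (card ?F) * mean M (\<lambda>b. (\<Prod>i\<in>A. kappa (expchar (?y i) u / expchar (?y i) (q0 * deck P b)) / of_nat (?a i)) * ?\<psi>)"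
      by (rule avg)
    also have "(\<lambda>b. (\<Prod>i\<in>A. kappa (expchar (?y i) u / expchar (?y i) (q0 * deck P b)) / of_nat (?a i)) * ?\<psi>)
        = (\<lambda>b. (?\<psi> / (\<Prod>i\<in>A. of_nat (?a i))) * (\<Prod>i\<in>A. kappa (exp (pairing (ch i) (cmul (covmat P) w') / of_nat (?a i)) * zeta (?a i) (pairing (ch i) b))))"
      by (simp add: ratio prod_dividef mult.commute cong: prod.cong)
    also have "mean M \<dots> = (?\<psi> / (\<Prod>i\<in>A. of_nat (?a i))) * layer_mean ch A ?a M (cmul (covmat P) w')"
      unfolding layer_mean_def by (rule mean_scale)
    also have "layer_mean ch A ?a M (cmul (covmat P) w') = layer_mean ch A ?a M w"
      unfolding c by (rule layer_mean_shift[OF M aM])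
    finally have s: "(\<Sum>q\<in>?F. omega_bar_cov_set P ch A q u vs)
        = of_nat (card ?F) * (?\<psi> / (\<Prod>i\<in>A. of_nat (?a i)) * layer_mean ch A ?a M w)" .
    have pa: "(\<Prod>i\<in>A. of_nat (?a i) :: complex) \<noteq> 0" using A apos by (simp add: prod_zero_iff)
    have "q0 \<in> cov_hyp_inter P ch A (\<lambda>_. q0) \<inter> ?F"
      using q0 q0t by (simp add: I)
    then have n: "(of_nat (card (cov_hyp_inter P ch A (\<lambda>_. q0) \<inter> ?F)) :: complex) \<noteq> 0"
      using fin by auto
    have m: "(of_nat (arith_mult ch A) :: complex) \<noteq> 0"
    proof
      assume "(of_nat (arith_mult ch A) :: complex) = 0"
      then have "of_nat (card (cov_hyp_inter P ch A (\<lambda>_. q0) \<inter> ?F)) * (\<Prod>i\<in>A. of_nat (?a i)) = (0 :: complex)"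
        unfolding card by (simp only: mult_zero_right)
      then show False using n pa by (simp only: mult_eq_0_iff) simp
    qed
    have e: "1 / n * (f * (\<psi> / a * l)) = l / m * \<psi>" if "n * a = f * m" "n \<noteq> 0" "a \<noteq> 0" "m \<noteq> 0" for n f \<psi> a l m :: complex
    proof -
      have "f = n * a / m" using that by (simp add: field_simps)
      then show ?thesis using that by (simp add: field_simps)
    qed
    show "1 / of_nat (card (cov_hyp_inter P ch A (\<lambda>_. q0) \<inter> ?F)) * (\<Sum>q\<in>?F. omega_bar_cov_set P ch A q u vs)
      = layer_mean ch A ?a M w / of_nat (arith_mult ch A) * ?\<psi>"
      unfolding s by (rule e[OF card n pa m])
  qed
qed

section \<open>The power coverings\<close>

text \<open>The covering by \<open>N\<close>-th powers pulls \<open>expchar x\<close> back to \<open>expchar (N *s x)\<close>, so \<open>a = N\<close> for every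
primitive character. For a suitable \<open>N\<close> it separates any given independent set.\<close>

lemma power_covering:
  fixes x :: "int^'d::finite"
  assumes N: "N > 0"
  shows "is_covering (mat (1 / of_nat N) :: rat^'d^'d)"
    and "primitive_char x \<Longrightarrow> num_comp (mat (1 / of_nat N) :: rat^'d^'d) x = N"
proof -
  let ?P = "mat (1 / of_nat N) :: rat^'d^'d"
  have vm: "v v* ?P = (1 / of_nat N) *s v" for v
    by (simp add: vector_matrix_mult_def mat_def vec_eq_iff if_distrib cong: if_cong)
  have r: "ratvec (int N *s y) v* ?P = ratvec y" for y :: "int^'d"
    using N by (simp add: vm ratvec_scale vec_eq_iff)
  have mm: "mat a ** mat b = (mat (a * b) :: rat^'d^'d)" for a b
  proof -
    have "(mat a ** mat b :: rat^'d^'d) $ i $ j = (\<Sum>k\<in>UNIV. if i = k then (if k = j then a * b else 0) else 0)" for i j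
      unfolding matrix_matrix_mult_def mat_def vec_lambda_beta by (intro sum.cong refl) auto
    then show ?thesis by (simp add: vec_eq_iff mat_def)
  qed
  have "invertible ?P" unfolding invertible_def
    by (rule exI[of _ "mat (of_nat N)"]) (use N in \<open>simp add: mm\<close>)
  moreover have "range ratvec \<subseteq> lattice_of ?P"
  proof
    fix l assume "l \<in> range (ratvec :: int^'d \<Rightarrow> _)"
    then obtain y where "l = ratvec y" by blast
    then have "l = ratvec (int N *s y) v* ?P" by (simp only: r)
    then show "l \<in> lattice_of ?P" unfolding lattice_of_def by (rule range_eqI)
  qed
  ultimately show P: "is_covering ?P" by (simp add: is_covering_def)
  assume x: "primitive_char x"
  then have x0: "x \<noteq> 0" by (simp add: primitive_char_def)
  obtain b :: "int^'d" where b: "pairing x b = 1" using primitive_char_pairing[OF x] .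
  obtain b' :: "int^'d" where b': "pairing (cov_root ?P x) b' = 1" using cov_root(3)[OF P x0] by blast
  have "ratvec (x v* covmat ?P) v* ?P = ratvec (int N *s x) v* ?P" by (simp only: ratvec_covmat[OF P] r)
  then have "ratvec (x v* covmat ?P) = ratvec (int N *s x)"
    by (rule vector_matrix_mult_inject[OF \<open>invertible ?P\<close>])
  then have "x v* covmat ?P = int N *s x" by (simp only: ratvec_inject)
  then have "int (num_comp ?P x) *s cov_root ?P x = int N *s x" using cov_root(2)[OF P x0] by simp
  then show "num_comp ?P x = N" by (rule content_unique[OF _ b' b])
qed

section \<open>The form of a layer\<close>

text \<open>Existence: the right-hand side does not depend on the covering nor on the point of \<open>W\<close>, because
\<open>layer_mean\<close> depends neither on the denominators nor on changes of \<open>w\<close> orthogonal to \<open>A\<close>, so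
\<open>averaged_form\<close> shows that it satisfies the defining equation for every separating covering.
Uniqueness: a power covering separates \<open>A\<close>, and its differential is surjective at every point, so
a form is determined by its pullback.\<close>

lemma omega_bar_eq:
  fixes ch :: "nat \<Rightarrow> int^'d::finite"
  assumes A: "finite A" "A \<subseteq> E" and prim: "\<And>i. i \<in> A \<Longrightarrow> primitive_char (ch i)" and ind: "indep ch A"
    and W: "W \<in> components (hyp_inter ch A)" and p: "p \<in> W"
    and a: "attains ch A a" "M > 0" "\<And>i. i \<in> A \<Longrightarrow> a i dvd M"
    and z: "z \<in> arr_complement ch E" "z = p * vexp w"
  shows "omega_bar ch E W A z vs = layer_mean ch A a M w / of_nat (arith_mult ch A) * psi_set ch A z vs"
proof -
  let ?M = "arr_complement ch E"
  have ne: "ch i \<noteq> 0" if "i \<in> A" for i using prim[OF that] by (simp add: primitive_char_def)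
  have WH: "W \<subseteq> hyp_inter ch A" by (rule in_components_subset[OF W])
  have Weq: "W = {r * vexp v | v. \<forall>x\<in>ch ` A. pairing x v = 0}" if "r \<in> W" for r
    using char_kernel_components[OF _ _ that, of "ch ` A"] W A(1) by (simp add: hyp_inter_char_kernel)
  have pt: "p \<in> torus" using p WH by (auto simp: hyp_inter_def)
  have Mt: "x \<in> torus" "\<And>i. i \<in> A \<Longrightarrow> expchar (ch i) x \<noteq> 1" if "x \<in> ?M" for x
    using that A(2) by (auto simp: arr_complement_def hyp_def)
  have pch: "expchar (ch i) p = 1" if "i \<in> A" for i using p WH that by (auto simp: hyp_inter_def hyp_def)
  define g where "g x = layer_mean ch A a M (SOME v. x = p * vexp v) / of_nat (arith_mult ch A)" for x
  have g: "g x = layer_mean ch A a M v / of_nat (arith_mult ch A)" if "x = p * vexp v" for x v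
  proof -
    have "x = p * vexp (SOME v. x = p * vexp v)" by (rule someI) (rule that)
    then have "vexp (SOME v. x = p * vexp v) = vexp v" using that torus_mult_left_cancel[OF pt] by metis
    then obtain c where c: "(SOME v. x = p * vexp v) = v + two_pi_i *s ivec c" unfolding vexp_eq_iff by blast
    show ?thesis unfolding g_def c by (simp only: layer_mean_shift[OF a(2,3)])
  qed
  define \<omega> where "\<omega> x vs = (if x \<in> ?M then g x * psi_set ch A x vs else 0)" for x vs
  let ?spec = "\<lambda>\<omega>. form_on ?M \<omega> \<and>
    (\<forall>P p q0. is_covering P \<longrightarrow> separates P ch A \<longrightarrow> p \<in> W \<longrightarrow> q0 \<in> cov_fibre P {p} \<longrightarrow>
      (\<forall>u\<in>cov_fibre P ?M. \<forall>vs.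
        pullback (cov_map P) \<omega> u vs =
          1 / of_nat (card (cov_hyp_inter P ch A (\<lambda>_. q0) \<inter> cov_fibre P {p}))
            * (\<Sum>q\<in>cov_fibre P {p}. omega_bar_cov_set P ch A q u vs)))"
  have spec: "?spec \<omega>"
  proof (intro conjI allI impI ballI)
    show "form_on ?M \<omega>"
      unfolding form_on_def
    proof (intro conjI ballI allI impI)
      fix x assume x: "x \<in> ?M"
      have alt: "alternating (psi_set ch A x)"
        unfolding psi_set_def by (rule ext_prod_alternating[OF A(1)]) (simp_all add: one_form_psi multilin_psi Mt[OF x])
      have "\<omega> x = (\<lambda>vs. g x * psi_set ch A x vs)" using x by (simp add: \<omega>_def fun_eq_iff)
      then show "alternating (\<omega> x)" using alt
        by (simp add: alternating_def linear_scale_eq algebra_simps)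
    next
      fix x assume "x \<notin> ?M" then show "\<omega> x = (\<lambda>_. 0)" by (simp add: \<omega>_def fun_eq_iff)
    qed
  next
    fix P r q0 u vs
    let ?n = "\<lambda>i. num_comp P (ch i)"
    assume P: "is_covering P" and sep: "separates P ch A" and r: "r \<in> W" and q0: "q0 \<in> cov_fibre P {r}"
      and u: "u \<in> cov_fibre P ?M"
    have ut: "u \<in> torus" and fu: "cov_map P u \<in> ?M" using u by (auto simp: cov_fibre_def)
    have rH: "r \<in> hyp_inter ch A" and rt: "r \<in> torus" using r WH by (auto simp: hyp_inter_def)
    obtain v where v: "cov_map P u = r * vexp v" using torus_vexp_quotient[OF Mt(1)[OF fu] rt] .
    obtain v1 where v1: "r = p * vexp v1" "\<And>i. i \<in> A \<Longrightarrow> pairing (ch i) v1 = 0" using r Weq[OF p] by blast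
    have att: "attains ch A ?n"
      by (rule separates_imp_attains[OF P A(1) ind ne sep])
    obtain M' where M': "M' > 0" "\<And>i. i \<in> A \<Longrightarrow> num_comp P (ch i) dvd M'" and
      eq: "\<And>vs. 1 / of_nat (card (cov_hyp_inter P ch A (\<lambda>_. q0) \<inter> cov_fibre P {r}))
            * (\<Sum>q\<in>cov_fibre P {r}. omega_bar_cov_set P ch A q u vs)
      = layer_mean ch A ?n M' v / of_nat (arith_mult ch A) * pullback (cov_map P) (psi_set ch A) u vs"
      using averaged_form[OF P A(1) ne att rH q0 ut v Mt(2)[OF fu]] by blast
    have pv: "cov_map P u = p * vexp (v1 + v)" by (simp add: v v1(1) vexp_add mult.assoc)
    have "exp (pairing (ch i) v) \<noteq> 1" if "i \<in> A" for i
      using Mt(2)[OF fu that] rH that by (simp add: v expchar_mult expchar_vexp hyp_inter_def hyp_def)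
    then have "layer_mean ch A ?n M' v = layer_mean ch A a M v"
      by (rule layer_mean_unique[OF A(1) _ att M' a])
    also have "\<dots> = layer_mean ch A a M (v1 + v)"
      by (rule layer_mean_cong) (simp add: pairing_add_right v1(2))
    finally have "g (cov_map P u) = layer_mean ch A ?n M' v / of_nat (arith_mult ch A)"
      using g[OF pv] by simp
    then show "pullback (cov_map P) \<omega> u vs =
          1 / of_nat (card (cov_hyp_inter P ch A (\<lambda>_. q0) \<inter> cov_fibre P {r}))
            * (\<Sum>q\<in>cov_fibre P {r}. omega_bar_cov_set P ch A q u vs)"
      unfolding eq using fu by (simp add: pullback_def \<omega>_def)
  qed
  have uniq: "\<omega>' = \<omega>" if \<omega>': "?spec \<omega>'" for \<omega>'
  proof (intro ext)
    fix x ts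
    show "\<omega>' x ts = \<omega> x ts"
    proof (cases "x \<in> ?M")
      case False
      then show ?thesis using \<omega>' spec unfolding form_on_def by simp
    next
      case True
      obtain N where N: "N > 0" "attains ch A (\<lambda>_. N)" using indep_attains[OF A(1) ind] by blast
      let ?P = "mat (1 / of_nat N) :: rat^'d^'d"
      have P: "is_covering ?P" by (rule power_covering(1)[OF N(1)])
      have att: "attains ch A (\<lambda>i. num_comp ?P (ch i))"
        using N(2) power_covering(2)[OF N(1) prim] unfolding attains_def by simp
      have sep: "separates ?P ch A" by (rule attains_imp_separates[OF P A(1) ne att])
      obtain q0 where q0: "q0 \<in> torus" "cov_map ?P q0 = p" using cov_map_surj[OF P pt] .
      obtain u where u: "u \<in> torus" "cov_map ?P u = x" using cov_map_surj[OF P Mt(1)[OF True]] .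
      let ?D = "frechet_derivative (cov_map ?P) (at u)"
      have "map ?D (map (inv_into UNIV ?D) ts) = ts"
        by (simp add: surj_f_inv_f[OF surj_frechet_derivative_cov_map[OF P u(1)]] map_idI)
      moreover have "pullback (cov_map ?P) \<omega>' u (map (inv_into UNIV ?D) ts) = pullback (cov_map ?P) \<omega> u (map (inv_into UNIV ?D) ts)"
      proof -
        have q0f: "q0 \<in> cov_fibre ?P {p}" and uf: "u \<in> cov_fibre ?P ?M" using q0 u True by (simp_all add: cov_fibre_def)
        show ?thesis
          unfolding conjunct2[OF \<omega>', rule_format, OF P sep p q0f uf] conjunct2[OF spec, rule_format, OF P sep p q0f uf] ..
      qed
      ultimately show ?thesis by (simp add: pullback_def u(2))
    qed
  qed
  have "omega_bar ch E W A = \<omega>"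
    unfolding omega_bar_def by (rule the_equality[of ?spec, OF spec uniq])
  then show ?thesis using z(1) by (simp add: \<omega>_def g[OF z(2)])
qed

section \<open>The relation of a circuit\<close>

lemma indep_subset: "indep ch A \<Longrightarrow> B \<subseteq> A \<Longrightarrow> indep ch B"
  using inj_on_subset[of "\<lambda>i. ratvec (ch i)" A B]
    vec.independent_mono[of "(\<lambda>i. ratvec (ch i)) ` A" "(\<lambda>i. ratvec (ch i)) ` B"]
  by (simp add: indep_def image_mono)

text \<open>A dependent subset of least cardinality is a circuit.\<close>

lemma dependent_contains_circuit:
  assumes "finite E" "A \<subseteq> E" "\<not> indep ch A"
  shows "\<exists>D\<in>circuits ch E. D \<subseteq> A"
proof -
  have "\<exists>D. (D \<subseteq> A \<and> \<not> indep ch D) \<and> (\<forall>D'. D' \<subseteq> A \<and> \<not> indep ch D' \<longrightarrow> card D \<le> card D')"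
    by (rule ex_has_least_nat[of _ A]) (use assms(3) in simp)
  then obtain D where D: "D \<subseteq> A" "\<not> indep ch D"
    and min: "\<forall>D'. D' \<subseteq> A \<and> \<not> indep ch D' \<longrightarrow> card D \<le> card D'" by (elim exE conjE)
  have fin: "finite D" by (rule finite_subset[OF order_trans[OF D(1) assms(2)] assms(1)])
  have "indep ch D'" if D': "D' \<subset> D" for D'
  proof (rule ccontr)
    assume "\<not> indep ch D'"
    then have "card D \<le> card D'" using min[rule_format, of D'] D' D(1) by blast
    moreover have "card D' < card D" using D' fin by (rule psubset_card_mono[rotated])
    ultimately show False by simp
  qed
  then have "D \<in> circuits ch E" unfolding circuits_def using D assms(2) by blast
  then show ?thesis using D(1) by blast
qed

lemma arith_mult_pos:
  fixes ch :: "nat \<Rightarrow> int^'d::finite"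
  assumes "finite A" "indep ch A"
  shows "arith_mult ch A > 0"
proof -
  obtain N where N: "N > 0" "attains ch A (\<lambda>_. N)" using indep_attains[OF assms] by blast
  let ?S = "{n \<in> PiE A (\<lambda>i. {..<N}). \<exists>x. int N *s x = (\<Sum>i\<in>A. int (n i * (N div N)) *s ch i)}"
  have "(\<lambda>i\<in>A. 0) \<in> ?S" using N(1) by (auto intro!: exI[of _ 0])
  moreover have "finite ?S"
  proof (rule finite_subset)
    show "?S \<subseteq> PiE A (\<lambda>i. {..<N})" by blast
    show "finite (PiE A (\<lambda>i. {..<N}))" using assms(1) by (intro finite_PiE) simp_all
  qed
  ultimately have "card ?S > 0" unfolding card_gt_0_iff by blast
  moreover have "arith_mult ch A = card ?S" by (rule arith_mult_card[OF assms(1) N(2,1)]) simp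
  ultimately show ?thesis by simp
qed

lemma layer_over:
  assumes "L \<in> components (hyp_inter ch E)" "A \<subseteq> E" "p \<in> L"
  shows "layer_over ch A L \<in> components (hyp_inter ch A)" "p \<in> layer_over ch A L"
proof -
  let ?X = "hyp_inter ch A"
  have LX: "L \<subseteq> ?X" using in_components_subset[OF assms(1)] assms(2) by (auto simp: hyp_inter_def)
  have con: "connected L" by (rule in_components_connected[OF assms(1)])
  let ?W = "connected_component_set ?X p"
  have W: "?W \<in> components ?X \<and> L \<subseteq> ?W"
    using connected_component_maximal[OF assms(3) con LX] LX assms(3) by (auto simp: components_def)
  have "layer_over ch A L = ?W" unfolding layer_over_def
  proof (rule the_equality)
    show "?W \<in> components ?X \<and> L \<subseteq> ?W" by (rule W)
    fix W' assume W': "W' \<in> components ?X \<and> L \<subseteq> W'"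
    have "p \<in> W' \<inter> ?W" using W W' assms(3) by blast
    then have "W' \<inter> ?W \<noteq> {}" by blast
    then show "W' = ?W" using components_eq[OF conjunct1[OF W'] conjunct1[OF W]] by (simp only: not_False_eq_True)
  qed
  then show "layer_over ch A L \<in> components (hyp_inter ch A)" "p \<in> layer_over ch A L" using W assms(3) by auto
qed

lemma wedge_sum_left:
  "finite I \<Longrightarrow> ((\<lambda>vs. \<Sum>l\<in>I. f l vs) \<and>\<^sub>w \<beta>) vs = (\<Sum>l\<in>I. (f l \<and>\<^sub>w \<beta>) vs)"
proof (induction I rule: finite_induct)
  case empty show ?case by (simp add: wedge_def)
next
  case (insert l I) then show ?case by (simp add: wedge_add_left)
qed

text \<open>The signs alternate along \<open>D\<close>, starting with \<open>1\<close>.\<close>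

lemma sum_sign_position:
  assumes "finite (D :: nat set)"
  shows "(\<Sum>j\<in>D. (-1) ^ card {b \<in> D. b < j}) = (if odd (card D) then 1 else 0 :: complex)"
  using assms
proof (induction D rule: finite_min_induct)
  case empty show ?case by simp
next
  case (insert a D)
  have aD: "a \<notin> D" using insert.hyps by auto
  have 0: "{b \<in> insert a D. b < a} = {}" using insert.hyps(2) by force
  have s: "card {b \<in> insert a D. b < j} = Suc (card {b \<in> D. b < j})" if "j \<in> D" for j
  proof -
    have "{b \<in> insert a D. b < j} = insert a {b \<in> D. b < j}" using insert.hyps(2)[OF that] by auto
    then show ?thesis using aD insert.hyps(1) by simp
  qed
  have "(\<Sum>j\<in>D. (-1) ^ card {b \<in> insert a D. b < j}) = (\<Sum>j\<in>D. - ((-1) ^ card {b \<in> D. b < j}) :: complex)"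
    by (intro sum.cong refl) (simp only: s power_Suc mult_minus1)
  then have "(\<Sum>j\<in>insert a D. (-1) ^ card {b \<in> insert a D. b < j}) = 1 - (\<Sum>j\<in>D. (-1) ^ card {b \<in> D. b < j} :: complex)"
    unfolding sum.insert[OF insert.hyps(1) aD] 0 by (simp add: sum_negf)
  then show ?case using insert.IH insert.hyps(1) aD by simp
qed

text \<open>Wedge the linear relation between the \<open>\<psi>\<^sub>l\<close> with \<open>\<psi>\<close> of \<open>E - {i, j}\<close>: only the terms
\<open>l = i\<close> and \<open>l = j\<close> survive, and moving their factor into place gives the signs.\<close>

lemma psi_exchange:
  fixes ch :: "nat \<Rightarrow> int^'d::finite" and x :: "nat \<Rightarrow> int"
  assumes E: "E = {0..n}" "C \<subseteq> E" and rel: "(\<Sum>l\<in>C. x l *s ch l) = 0" and z: "z \<in> torus"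
    and ij: "i \<in> C" "j \<in> C"
  shows "of_int (x i) * (-1) ^ i * psi_set ch (E - {j}) z vs = of_int (x j) * (-1) ^ j * psi_set ch (E - {i}) z vs"
proof -
  have main: "of_int (x i) * (-1) ^ i * psi_set ch (E - {j}) z vs = of_int (x j) * (-1) ^ j * psi_set ch (E - {i}) z vs"
    if ij: "i \<in> C" "j \<in> C" "i < j" for i j
  proof -
    let ?\<alpha> = "\<lambda>l. psi ch l z"
    let ?R = "E - {i, j}"
    let ?Y = "\<lambda>l. (?\<alpha> l \<and>\<^sub>w ext_prod ?\<alpha> ?R) vs"
    have fin: "finite C" "finite ?R" using E finite_subset by auto
    have of: "one_form (?\<alpha> l)" for l by (rule one_form_psi[OF z])
    have sum0: "(\<lambda>us. \<Sum>l\<in>C. of_int (x l) * ?\<alpha> l us) = (\<lambda>_. 0)"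
    proof
      fix us :: "(complex^'d) list"
      have "(\<Sum>l\<in>C. of_int (x l) * (pairing (ch l) v / two_pi_i)) = 0" for v
      proof -
        have "(\<Sum>l\<in>C. of_int (x l) * (pairing (ch l) v / two_pi_i)) = pairing (\<Sum>l\<in>C. x l *s ch l) v / two_pi_i"
          by (simp add: pairing_sum_left pairing_scale_left sum_divide_distrib)
        then show ?thesis by (simp add: rel)
      qed
      then show "(\<Sum>l\<in>C. of_int (x l) * ?\<alpha> l us) = 0"
      proof (cases "\<exists>v. us = [v]")
        case False
        then have "?\<alpha> l us = 0" for l by (auto simp: psi_eq[OF z] split: list.splits)
        then show ?thesis by simp
      qed (auto simp: psi_eq[OF z])
    qed
    have "0 = ((\<lambda>us. \<Sum>l\<in>C. of_int (x l) * ?\<alpha> l us) \<and>\<^sub>w ext_prod ?\<alpha> ?R) vs"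
      unfolding sum0 by (simp add: wedge_def)
    also have "\<dots> = (\<Sum>l\<in>C. of_int (x l) * ?Y l)"
      by (simp add: wedge_sum_left[OF fin(1)] wedge_scale_left)
    also have "\<dots> = (\<Sum>l\<in>{i, j}. of_int (x l) * ?Y l)"
    proof (rule sum.mono_neutral_right[OF fin(1)])
      show "{i, j} \<subseteq> C" using ij by simp
      show "\<forall>l\<in>C - {i, j}. of_int (x l) * ?Y l = 0"
      proof
        fix l assume "l \<in> C - {i, j}"
        then have "?Y l = 0" using E(2) by (intro wedge_ext_prod_member[OF fin(2) _ of]) auto
        then show "of_int (x l) * ?Y l = 0" by simp
      qed
    qed
    also have "\<dots> = of_int (x i) * ?Y i + of_int (x j) * ?Y j" using ij by simp
    also have "?Y i = (-1) ^ i * psi_set ch (E - {j}) z vs"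
    proof -
      have "{s \<in> ?R. s < i} = {..<i}" using ij E by auto
      moreover have "insert i ?R = E - {j}" using ij E by auto
      ultimately show ?thesis using wedge_ext_prod_insert[where a = i and \<alpha> = ?\<alpha> and vs = vs, OF fin(2) _ of of] by (simp add: psi_set_def)
    qed
    also have "?Y j = - ((-1) ^ j * psi_set ch (E - {i}) z vs)"
    proof -
      have "{s \<in> ?R. s < j} = {..<j} - {i}" using ij E by auto
      then have "card {s \<in> ?R. s < j} = j - 1" using ij by simp
      moreover have "insert j ?R = E - {i}" using ij E by auto
      moreover have "(-1) ^ (j - 1) = - ((-1) ^ j :: complex)" using ij by (cases j) auto
      ultimately show ?thesis using wedge_ext_prod_insert[where a = j and \<alpha> = ?\<alpha> and vs = vs, OF fin(2) _ of of] by (simp add: psi_set_def)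
    qed
    finally show ?thesis by (simp add: mult.assoc)
  qed
  consider "i < j" | "i = j" | "j < i" by linarith
  then show ?thesis
  proof cases
    case 1 then show ?thesis by (rule main[OF ij])
  next
    case 2 then show ?thesis by simp
  next
    case 3 then show ?thesis by (rule main[OF ij(2,1), symmetric])
  qed
qed

theorem theorem6p12:
  fixes ch :: "nat \<Rightarrow> int ^ 'd::finite"
    and n k :: nat
    and E C F :: "nat set"
    and c :: "nat \<Rightarrow> int"
    and L :: "(complex ^ 'd) set"
  assumes E: "E = {0..n}"
    and primitive: "\<forall>i\<in>E. primitive_char (ch i)"
    and essential: "essential ch E"
    and C: "C = {0..k}" "C \<subseteq> E"
    and unique_circuit: "circuits ch E = {C}"
    and F: "F = E - C"
    and c: "\<forall>i\<in>C. c i \<in> {1, -1}"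
      "(\<Sum>i\<in>C. (c i * int (arith_mult ch (C - {i}))) *s ch i) = 0"
    and L: "L \<in> components (hyp_inter ch E)"
  shows "\<forall>z\<in>arr_complement ch E. \<forall>vs.
    (\<Sum>j\<in>C. \<Sum>(A, B)\<in>{(A, B). F \<subseteq> A \<and> E = A \<union> B \<union> {j} \<and> A \<inter> B = {} \<and> j \<notin> A \<and> j \<notin> B
                              \<and> even (card B)}.
       (- 1) ^ card {a \<in> A. a \<le> j} * of_int (\<Prod>i\<in>B. c i)
         * (of_nat (arith_mult ch A) / of_nat (arith_mult ch (A \<union> B)))
         * eta_bar ch E (layer_over ch A L) A B z vs) = 0"
proof (intro ballI allI)
  fix z vs assume z: "z \<in> arr_complement ch E"
  let ?m = "\<lambda>i. arith_mult ch (C - {i})"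
  let ?\<psi> = "\<lambda>j. psi_set ch (E - {j}) z vs"
  let ?q = "\<lambda>j. arith_mult ch (E - {j})"
  have finE: "finite E" and finC: "finite C" using E C by auto
  have zE: "expchar (ch i) z \<noteq> 1" if "i \<in> E" for i
    using z that by (auto simp: arr_complement_def hyp_def)
  have zt: "z \<in> torus" using z by (auto simp: arr_complement_def)
  obtain p where p: "p \<in> L" using in_components_nonempty[OF L] by blast
  have pE: "p \<in> hyp_inter ch E" using in_components_subset[OF L] p by blast
  then have pt: "p \<in> torus" by (simp add: hyp_inter_def)
  obtain w where w: "z = p * vexp w" using torus_vexp_quotient[OF zt pt] .
  have ew: "exp (pairing (ch i) w) \<noteq> 1" if "i \<in> E" for i
    using zE[OF that] pE that by (simp add: w expchar_mult expchar_vexp hyp_inter_def hyp_def)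
  have ind: "indep ch (E - {j})" if "j \<in> C" for j
  proof (rule ccontr)
    assume "\<not> indep ch (E - {j})"
    then obtain D where "D \<in> circuits ch E" "D \<subseteq> E - {j}"
      using dependent_contains_circuit[OF finE, of "E - {j}" ch] by blast
    then show False using that unique_circuit by auto
  qed
  have mpos: "?m i > 0" if "i \<in> C" for i
    using C that by (intro arith_mult_pos indep_subset[OF ind[OF that]]) (auto simp: finC)
  have qpos: "?q j > 0" if "j \<in> C" for j using ind[OF that] by (intro arith_mult_pos) (auto simp: finE)

  have "\<exists>N>0. attains ch (E - {j}) (\<lambda>_. N)" if "j \<in> C" for j
    using indep_attains[OF _ ind[OF that]] finE by blast
  then obtain N0 where N0: "\<And>j. j \<in> C \<Longrightarrow> N0 j > 0" "\<And>j. j \<in> C \<Longrightarrow> attains ch (E - {j}) (\<lambda>_. N0 j)" by metis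
  \<comment> \<open>The first factor clears the denominators of all the dual bases, the second makes \<open>N / m\<^sub>i\<close> an integer
    that is still a multiple of the first.\<close>
  define N where "N = (\<Prod>j\<in>C. N0 j) * (\<Prod>i\<in>C. ?m i)"
  define m where "m i = (if i \<in> C then ?m i else 1)" for i
  define a where "a i = N div m i" for i
  have N: "N > 0" unfolding N_def using N0(1) mpos finC by simp
  have mdvd: "m i dvd (\<Prod>i\<in>C. ?m i)" for i using finC by (auto simp: m_def intro: dvd_prodI)
  have m0: "m i > 0" for i using mpos by (simp add: m_def)
  have am: "a i * m i = N" for i using mdvd[of i] unfolding a_def N_def by (simp add: dvd_mult)
  have adN: "a i dvd N" for i using am[of i] by (metis dvd_triv_left)
  have apos: "a i > 0" for i using am[of i] N by (auto intro: Nat.gr0I)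
  have attj: "attains ch (E - {j}) a" if j: "j \<in> C" for j
  proof (rule attains_dvd[OF N0(2)[OF j]])
    fix i
    have "N0 j dvd (\<Prod>j\<in>C. N0 j)" using finC j by (intro dvd_prodI)
    moreover have "a i = (\<Prod>j\<in>C. N0 j) * ((\<Prod>i\<in>C. ?m i) div m i)"
      unfolding a_def N_def by (rule div_mult_swap[OF mdvd, symmetric])
    ultimately show "N0 j dvd a i" by simp
  qed

  \<comment> \<open>All the layers contain \<open>L\<close>, so the same point \<open>p\<close> and the same logarithm \<open>w\<close> serve for all of them.\<close>
  let ?S = "\<lambda>A. layer_mean ch A a N w"
  have eta: "eta_bar ch E (layer_over ch A L) A B z vs = ?S A / of_nat (arith_mult ch A) * psi_set ch (A \<union> B) z vs"
    if AB: "A \<union> B = E - {j}" "A \<inter> B = {}" and j: "j \<in> C" for A B j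
  proof -
    have sub: "A \<subseteq> E - {j}" "A \<subseteq> E" and fin: "finite A" "finite B"
      using AB finE finite_subset[of A E] finite_subset[of B E] by auto
    have "omega_bar ch E (layer_over ch A L) A z = (\<lambda>us. ?S A / of_nat (arith_mult ch A) * psi_set ch A z us)"
    proof
      fix us
      show "omega_bar ch E (layer_over ch A L) A z us = ?S A / of_nat (arith_mult ch A) * psi_set ch A z us"
        using omega_bar_eq[OF fin(1) sub(2) _ indep_subset[OF ind[OF j] sub(1)] layer_over[OF L sub(2) p]
            attains_subset[OF attj[OF j] sub(1)] N adN z w] primitive sub(2) by auto
    qed
    then have "eta_bar ch E (layer_over ch A L) A B z vs =
      ?S A / of_nat (arith_mult ch A) * ((-1) ^ ell A B * (psi_set ch A z \<and>\<^sub>w psi_set ch B z) vs)"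
      by (simp only: eta_bar_def wedge_scale_left mult.left_commute)
    also have "(psi_set ch A z \<and>\<^sub>w psi_set ch B z) vs = (-1) ^ ell A B * psi_set ch (A \<union> B) z vs"
      unfolding psi_set_def by (intro wedge_ext_prod_disjoint fin AB(2) one_form_psi zt)
    finally show ?thesis by (simp add: mult.assoc[symmetric] power_add[symmetric])
  qed

  \<comment> \<open>In \<open>arith_mult_mean\<close> for \<open>E - {j}\<close> the set of vectors \<open>b\<close> does not depend on \<open>j\<close>: by the relation of the
    circuit, the divisibility for the indices in \<open>C - {j}\<close> implies the one for \<open>j\<close>. Only the missing factor
    \<open>a j = N / m j\<close> of the product depends on \<open>j\<close>.\<close>
  have qm: "\<exists>K. \<forall>j\<in>C. of_nat (?q j) = (K :: complex) * of_nat (m j)"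
  proof -
    have dv: "(\<forall>i\<in>E - {j}. int (a i) dvd pairing (ch i) b) \<longleftrightarrow> (\<forall>i\<in>E. int (a i) dvd pairing (ch i) b)" if j: "j \<in> C" for j and b :: "int^'d"
    proof
      assume H: "\<forall>i\<in>E - {j}. int (a i) dvd pairing (ch i) b"
      have "int N dvd (c i * int (m i)) * pairing (ch i) b" if "i \<in> C - {j}" for i
      proof -
        have "int (a i) dvd pairing (ch i) b" using H that C by auto
        then have "int (m i) * int (a i) dvd int (m i) * pairing (ch i) b" by (rule mult_dvd_mono[OF dvd_refl])
        then have "int N dvd int (m i) * pairing (ch i) b" using am[of i] by (metis mult.commute of_nat_mult)
        then have "int N dvd c i * (int (m i) * pairing (ch i) b)" by (rule dvd_mult)
        then show ?thesis by (simp only: mult.assoc)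
      qed
      then have "int N dvd (\<Sum>i\<in>C - {j}. (c i * int (m i)) * pairing (ch i) b)" by (intro dvd_sum)
      moreover have "(\<Sum>i\<in>C. (c i * int (m i)) * pairing (ch i) b) = 0"
      proof -
        have "(\<Sum>i\<in>C. (c i * int (m i)) * pairing (ch i) b) = pairing (\<Sum>i\<in>C. (c i * int (?m i)) *s ch i) b"
          by (simp add: pairing_sum_left pairing_scale_left m_def cong: sum.cong)
        then show ?thesis by (simp only: c(2) pairing_zero)
      qed
      then have "(c j * int (m j)) * pairing (ch j) b = - (\<Sum>i\<in>C - {j}. (c i * int (m i)) * pairing (ch i) b)"
        using sum.remove[OF finC j, of "\<lambda>i. (c i * int (m i)) * pairing (ch i) b"] by simp
      ultimately have "int N dvd c j * (int (m j) * pairing (ch j) b)" by (simp add: mult.assoc)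
      then have "int N dvd int (m j) * pairing (ch j) b" using c(1) j by (cases "c j = 1") auto
      then have "int (m j) * int (a j) dvd int (m j) * pairing (ch j) b" using am[of j] by (metis mult.commute of_nat_mult)
      then have "int (a j) dvd pairing (ch j) b" using m0[of j] by simp
      then show "\<forall>i\<in>E. int (a i) dvd pairing (ch i) b" using H by auto
    qed auto
    let ?I = "mean N (\<lambda>b::int^'d. if \<forall>i\<in>E. int (a i) dvd pairing (ch i) b then 1 else 0)"
    have "of_nat (?q j) = ((\<Prod>i\<in>E. of_nat (a i)) * ?I / of_nat N) * of_nat (m j)" if j: "j \<in> C" for j
    proof -
      have "of_nat (?q j) = (\<Prod>i\<in>E - {j}. of_nat (a i)) * mean N (\<lambda>b. if \<forall>i\<in>E - {j}. int (a i) dvd pairing (ch i) b then 1 else 0)"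
        by (rule arith_mult_mean[OF _ attj[OF j] N adN]) (simp add: finE)
      then have q: "of_nat (?q j) = (\<Prod>i\<in>E - {j}. of_nat (a i)) * ?I" unfolding dv[OF j] .
      have "(\<Prod>i\<in>E. of_nat (a i) :: complex) = of_nat (a j) * (\<Prod>i\<in>E - {j}. of_nat (a i))"
        using C j finE by (intro prod.remove) auto
      moreover have "(of_nat N :: complex) = of_nat (a j) * of_nat (m j)" using am[of j] by (metis of_nat_mult)
      ultimately show ?thesis using q apos[of j] m0[of j] by simp
    qed
    then show ?thesis by blast
  qed
  then obtain K :: complex where K: "\<And>j. j \<in> C \<Longrightarrow> of_nat (?q j) = K * of_nat (m j)" by blast
  have csq: "(of_int (c j) :: complex) * of_int (c j) = 1" if "j \<in> C" for j using c(1) that by auto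
  define Q where "Q j = ?\<psi> j / of_nat (?q j)" for j
  \<comment> \<open>The common value of \<open>(-1)\<^sup>j c\<^sub>j Q\<^sub>j\<close>, read off at \<open>j = 0\<close>.\<close>
  define \<Psi> where "\<Psi> = of_int (c 0) * Q 0"
  have Q: "Q j = (-1) ^ j * of_int (c j) * \<Psi>" if j: "j \<in> C" for j
  proof -
    have o: "0 \<in> C" using C by simp
    have "of_int (c 0 * int (?m 0)) * (-1) ^ 0 * ?\<psi> j = of_int (c j * int (?m j)) * (-1) ^ j * ?\<psi> 0"
      by (rule psi_exchange[OF E C(2) c(2) zt o j])
    then have ex: "of_int (c 0) * of_nat (m 0) * ?\<psi> j = of_int (c j) * of_nat (m j) * (-1) ^ j * ?\<psi> 0"
      using o j by (simp add: m_def)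
    have qn: "(of_nat (?q 0) :: complex) \<noteq> 0" "(of_nat (?q j) :: complex) \<noteq> 0" using qpos[OF o] qpos[OF j] by auto
    have "of_int (c 0) * of_nat (?q 0) * ?\<psi> j = of_int (c j) * of_nat (?q j) * (-1) ^ j * ?\<psi> 0"
      using arg_cong[OF ex, of "\<lambda>x. K * x"] by (simp add: K[OF o] K[OF j] mult_ac)
    then have "of_int (c 0) * Q j = of_int (c j) * (-1) ^ j * Q 0"
      using qn by (simp add: Q_def field_simps)
    then have "of_int (c 0) * (of_int (c 0) * Q j) = of_int (c 0) * (of_int (c j) * (-1) ^ j * Q 0)" by simp
    then show ?thesis using csq[OF o] by (simp add: \<Psi>_def mult.assoc[symmetric])
  qed

  let ?O = "{D. D \<subseteq> C \<and> odd (card D)}"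
  let ?T = "\<lambda>D. of_int (\<Prod>i\<in>D. c i) * ?S (E - D)"
  \<comment> \<open>Inside the mean, the factors with index in \<open>F\<close> are common to all terms, and replacing \<open>\<tau>\<^sub>i\<close> by
    \<open>t\<^sub>i\<close> turns the sign \<open>c\<^sub>D\<close> into the common sign \<open>c\<^sub>C\<close>.\<close>
  have key: "(\<Sum>D\<in>?O. ?T D) = 0"
  proof -
    have "(\<Sum>D\<in>?O. ?T D) = mean N (\<lambda>b. \<Sum>D\<in>?O. of_int (\<Prod>i\<in>D. c i) *
       (\<Prod>i\<in>E - D. kappa (exp (pairing (ch i) w / of_nat (a i)) * zeta (a i) (pairing (ch i) b))))"
      unfolding mean_sum layer_mean_def mean_scale ..
    also have "\<dots> = mean N (\<lambda>b::int^'d. 0)"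
    proof (rule mean_cong)
      fix b
      let ?\<tau> = "\<lambda>i. exp (pairing (ch i) w / of_nat (a i)) * zeta (a i) (pairing (ch i) b)"
      let ?t = "\<lambda>i. exp (of_int (c i * int (m i)) * pairing (ch i) (w + two_pi_i *s ivec b) / of_nat N)"
      have \<tau>: "?\<tau> i = exp (of_nat (m i) * pairing (ch i) (w + two_pi_i *s ivec b) / of_nat N)" for i
      proof -
        have "(of_nat N :: complex) = of_nat (a i) * of_nat (m i)" using am[of i] by (metis of_nat_mult)
        then have "of_nat (m i) * pairing (ch i) (w + two_pi_i *s ivec b) / of_nat N = pairing (ch i) (w + two_pi_i *s ivec b) / of_nat (a i)"
          using m0[of i] apos[of i] by simp
        then show ?thesis
          by (simp only: pairing_add_right pairing_scale_right pairing_ivec add_divide_distrib exp_add zeta_def)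
      qed
      have \<tau>1: "?\<tau> i \<noteq> 1" if "i \<in> E" for i
      proof
        assume "?\<tau> i = 1"
        then have "?\<tau> i ^ a i = 1" by (simp only: power_one)
        then show False using ew[OF that] by (simp only: exp_zeta_power[OF apos])
      qed
      have t: "?t i \<noteq> 1 \<and> kappa (?\<tau> i) = of_int (c i) * kappa (?t i)" if i: "i \<in> C" for i
      proof (cases "c i = 1")
        case True
        then have "?t i = ?\<tau> i" unfolding \<tau> by simp
        then show ?thesis using True \<tau>1[of i] i C by auto
      next
        case False
        then have ci: "c i = - 1" using c(1) i by auto
        then have ti: "?t i = inverse (?\<tau> i)" unfolding \<tau> by (simp add: exp_minus[symmetric])
        have ne0: "?\<tau> i \<noteq> 0" by simp
        have iE: "i \<in> E" using i C(2) by blast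
        have "inverse (?\<tau> i) \<noteq> 1" unfolding inverse_eq_1_iff by (rule \<tau>1[OF iE])
        moreover have "kappa (?\<tau> i) = of_int (- 1) * kappa (inverse (?\<tau> i))"
          unfolding kappa_inverse[OF ne0] by simp
        ultimately show ?thesis unfolding ti unfolding ci ..
      qed
      have prod1: "(\<Prod>i\<in>C. ?t i) = 1"
      proof -
        have "(\<Prod>i\<in>C. ?t i) = exp (\<Sum>i\<in>C. of_int (c i * int (m i)) * pairing (ch i) (w + two_pi_i *s ivec b) / of_nat N)"
          by (rule exp_sum[OF finC, symmetric])
        also have "(\<Sum>i\<in>C. of_int (c i * int (m i)) * pairing (ch i) (w + two_pi_i *s ivec b) / of_nat N)
          = pairing (\<Sum>i\<in>C. (c i * int (?m i)) *s ch i) (w + two_pi_i *s ivec b) / of_nat N"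
          by (simp only: pairing_sum_left pairing_scale_left sum_divide_distrib) (simp add: m_def cong: sum.cong)
        also have "\<dots> = 0" by (simp only: c(2) pairing_zero div_0)
        finally show ?thesis by simp
      qed
      have trm: "of_int (\<Prod>i\<in>D. c i) * (\<Prod>i\<in>E - D. kappa (?\<tau> i))
         = of_int (\<Prod>i\<in>C. c i) * (\<Prod>i\<in>F. kappa (?\<tau> i)) * (\<Prod>i\<in>C - D. kappa (?t i))" if D: "D \<subseteq> C" for D
      proof -
        have "E - D = F \<union> (C - D)" "F \<inter> (C - D) = {}" using D C F by auto
        then have "(\<Prod>i\<in>E - D. kappa (?\<tau> i)) = (\<Prod>i\<in>F. kappa (?\<tau> i)) * (\<Prod>i\<in>C - D. kappa (?\<tau> i))"
          using finE finC F by (simp add: prod.union_disjoint)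
        also have "(\<Prod>i\<in>C - D. kappa (?\<tau> i)) = (\<Prod>i\<in>C - D. of_int (c i) * kappa (?t i))"
          using t by (intro prod.cong refl) auto
        also have "\<dots> = of_int (\<Prod>i\<in>C - D. c i) * (\<Prod>i\<in>C - D. kappa (?t i))"
          by (simp only: prod.distrib of_int_prod)
        finally have e: "(\<Prod>i\<in>E - D. kappa (?\<tau> i)) = (\<Prod>i\<in>F. kappa (?\<tau> i)) * (of_int (\<Prod>i\<in>C - D. c i) * (\<Prod>i\<in>C - D. kappa (?t i)))" .
        have "(\<Prod>i\<in>C. c i) = (\<Prod>i\<in>C - D. c i) * (\<Prod>i\<in>D. c i)" by (rule prod.subset_diff[OF D finC])
        then show ?thesis unfolding e by (simp only: of_int_mult mult_ac)
      qed
      have "(\<Sum>D\<in>?O. of_int (\<Prod>i\<in>D. c i) * (\<Prod>i\<in>E - D. kappa (?\<tau> i)))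
        = (\<Sum>D\<in>?O. of_int (\<Prod>i\<in>C. c i) * (\<Prod>i\<in>F. kappa (?\<tau> i)) * (\<Prod>i\<in>C - D. kappa (?t i)))"
        by (intro sum.cong refl trm) simp
      also have "\<dots> = of_int (\<Prod>i\<in>C. c i) * (\<Prod>i\<in>F. kappa (?\<tau> i)) * (\<Sum>D\<in>?O. \<Prod>i\<in>C - D. kappa (?t i))"
        by (rule sum_distrib_left[symmetric])
      also have "(\<Sum>D\<in>?O. \<Prod>i\<in>C - D. kappa (?t i)) = 0"
        by (rule kappa_relation[OF finC _ prod1]) (use t in blast)
      finally show "(\<Sum>D\<in>?O. of_int (\<Prod>i\<in>D. c i) * (\<Prod>i\<in>E - D. kappa (?\<tau> i))) = 0" by simp
    qed
    finally show ?thesis by simp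
  qed

  let ?X = "\<lambda>j. {(A, B). F \<subseteq> A \<and> E = A \<union> B \<union> {j} \<and> A \<inter> B = {} \<and> j \<notin> A \<and> j \<notin> B \<and> even (card B)}"
  let ?f = "\<lambda>j (A, B). (- 1) ^ card {a \<in> A. a \<le> j} * of_int (\<Prod>i\<in>B. c i)
         * (of_nat (arith_mult ch A) / of_nat (arith_mult ch (A \<union> B)))
         * eta_bar ch E (layer_over ch A L) A B z vs"
  \<comment> \<open>For fixed \<open>j\<close>, a pair \<open>(A, B)\<close> is the same as a set \<open>D = B \<union> {j}\<close> of odd size.\<close>
  have inner: "(\<Sum>AB\<in>?X j. ?f j AB) = (\<Sum>D\<in>{D\<in>?O. j \<in> D}. (-1) ^ card {b \<in> D. b < j} * ?T D * \<Psi>)" if j: "j \<in> C" for j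
  proof (rule sum.reindex_bij_witness[of _ "\<lambda>D. (E - D, D - {j})" "\<lambda>(A, B). insert j B"])
    fix AB assume AB: "AB \<in> ?X j"
    obtain A B where p: "AB = (A, B)" by force
    have H: "F \<subseteq> A" "E = A \<union> B \<union> {j}" "A \<inter> B = {}" "j \<notin> A" "j \<notin> B" "even (card B)" using AB p by auto
    have fin: "finite A" "finite B" using H(2) finE by auto
    have A: "A = E - insert j B" unfolding H(2) using H(3,4) by blast
    have B: "insert j B - {j} = B" using H(5) by blast
    show "(E - (case AB of (A, B) \<Rightarrow> insert j B), (case AB of (A, B) \<Rightarrow> insert j B) - {j}) = AB"
      by (simp only: p case_prod_conv A[symmetric] B)
    have "insert j B \<subseteq> C"
    proof
      fix x assume "x \<in> insert j B"
      moreover have "x \<in> E" if "x \<in> B" using that H(2) by blast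
      moreover have "x \<notin> F" if "x \<in> B" using that H(1,3) by blast
      ultimately show "x \<in> C" using j F by blast
    qed
    moreover have "odd (card (insert j B))" using H(5,6) fin by simp
    ultimately show "(case AB of (A, B) \<Rightarrow> insert j B) \<in> {D \<in> ?O. j \<in> D}" by (simp add: p)
    have U: "A \<union> B = E - {j}" unfolding H(2) using H(4,5) by blast
    \<comment> \<open>The \<open>j\<close> indices below \<open>j\<close> are distributed between \<open>A\<close> and \<open>B\<close>.\<close>
    have sg: "(-1) ^ card {a \<in> A. a \<le> j} * (-1) ^ j = ((-1) ^ card {b \<in> insert j B. b < j} :: complex)"
    proof -
      have "{..<j} \<subseteq> A \<union> B" unfolding U using j C E by auto
      then have "{..<j} = {a \<in> A. a \<le> j} \<union> {b \<in> B. b < j}" using H(4) by (auto simp: order.order_iff_strict)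
      moreover have "{a \<in> A. a \<le> j} \<inter> {b \<in> B. b < j} = {}" using H(3) by blast
      then have "card ({a \<in> A. a \<le> j} \<union> {b \<in> B. b < j}) = card {a \<in> A. a \<le> j} + card {b \<in> B. b < j}"
        using fin by (intro card_Un_disjoint) auto
      ultimately have "j = card {a \<in> A. a \<le> j} + card {b \<in> B. b < j}" using card_lessThan[of j] by (simp only:)
      moreover have "{b \<in> insert j B. b < j} = {b \<in> B. b < j}" by auto
      ultimately have "(-1 :: complex) ^ j = (-1) ^ card {a \<in> A. a \<le> j} * (-1) ^ card {b \<in> insert j B. b < j}"
        by (simp only: power_add[symmetric])
      then show ?thesis by (simp only: left_minus_one_mult_self)
    qed
    have mA: "(of_nat (arith_mult ch A) :: complex) \<noteq> 0"
      using arith_mult_pos[OF fin(1) indep_subset[OF ind[OF j], of A]] U by auto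
    have cj: "of_int (\<Prod>i\<in>insert j B. c i) = (of_int (c j) * of_int (\<Prod>i\<in>B. c i) :: complex)"
      using H(5) fin by simp
    have "?f j AB = (- 1) ^ card {a \<in> A. a \<le> j} * of_int (\<Prod>i\<in>B. c i) * ?S A * Q j"
      using mA by (simp add: p eta[OF U H(3) j] Q_def U)
    also have "\<dots> = ((- 1) ^ card {a \<in> A. a \<le> j} * (-1) ^ j) * (of_int (c j) * of_int (\<Prod>i\<in>B. c i)) * ?S A * \<Psi>"
      unfolding Q[OF j] by (simp only: mult_ac)
    also have "\<dots> = (-1) ^ card {b \<in> insert j B. b < j} * ?T (insert j B) * \<Psi>"
      unfolding sg cj[symmetric] A[symmetric] by (simp only: mult.assoc)
    finally show "(-1) ^ card {b \<in> (case AB of (A, B) \<Rightarrow> insert j B). b < j} * ?T (case AB of (A, B) \<Rightarrow> insert j B) * \<Psi> = ?f j AB"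
      by (simp only: p case_prod_conv)
  next
    fix D assume D: "D \<in> {D \<in> ?O. j \<in> D}"
    then have DC: "D \<subseteq> C" "odd (card D)" and jD: "j \<in> D" by simp_all
    have "finite D" using DC(1) finC by (rule finite_subset)
    then have "card D = Suc (card (D - {j}))" using jD by (rule card.remove)
    then have "even (card (D - {j}))" using DC(2) by simp
    moreover have "F \<subseteq> E - D" unfolding F using DC(1) by blast
    moreover have "E = (E - D) \<union> (D - {j}) \<union> {j}" using DC(1) jD C(2) by blast
    ultimately show "(E - D, D - {j}) \<in> ?X j" using jD by blast
    show "(case (E - D, D - {j}) of (A, B) \<Rightarrow> insert j B) = D" using jD by auto
  qed
  have finO: "finite ?O" using finC by simp
  have "(\<Sum>j\<in>C. \<Sum>AB\<in>?X j. ?f j AB) = (\<Sum>j\<in>C. \<Sum>D\<in>{D\<in>?O. j \<in> D}. (-1) ^ card {b \<in> D. b < j} * ?T D * \<Psi>)"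
    by (intro sum.cong refl inner)
  also have "\<dots> = (\<Sum>D\<in>?O. \<Sum>j\<in>{j\<in>C. j \<in> D}. (-1) ^ card {b \<in> D. b < j} * ?T D * \<Psi>)"
    by (rule sum.swap_restrict[OF finC finO])
  also have "\<dots> = (\<Sum>D\<in>?O. ?T D * \<Psi>)"
  proof (intro sum.cong refl)
    fix D assume D: "D \<in> ?O"
    then have e: "{j \<in> C. j \<in> D} = D" and fin: "finite D" and odd: "odd (card D)" using finC finite_subset by auto
    have "(\<Sum>j\<in>{j\<in>C. j \<in> D}. (-1) ^ card {b \<in> D. b < j} * ?T D * \<Psi>) = (\<Sum>j\<in>D. (-1) ^ card {b \<in> D. b < j}) * ?T D * \<Psi>"
      by (simp only: e sum_distrib_right)
    also have "(\<Sum>j\<in>D. (-1) ^ card {b \<in> D. b < j}) = (1 :: complex)"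
      using sum_sign_position[OF fin] odd by (simp only: not_False_eq_True if_True)
    finally show "(\<Sum>j\<in>{j\<in>C. j \<in> D}. (-1) ^ card {b \<in> D. b < j} * ?T D * \<Psi>) = ?T D * \<Psi>"
      by (simp only: mult_1_left)
  qed
  also have "\<dots> = (\<Sum>D\<in>?O. ?T D) * \<Psi>" by (rule sum_distrib_right[symmetric])
  also have "\<dots> = 0" unfolding key by (rule mult_zero_left)
  finally show "(\<Sum>j\<in>C. \<Sum>AB\<in>?X j. ?f j AB) = 0" .
qed

end
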